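(* (i) Let $E$ be a locally convex real vector space with its sheaf $C^\infty_G$ of Gâteaux smooth functions. Then $(E,C^\infty_G)$ is an affine $C^\infty$-scheme if and only if $E$ is smoothly regular, realcompact, and every germ of a $C^\infty_G$-function at a point of $E$ has a global representative (i.e. is the germ of some element of $C^\infty_G(E)$). (ii) Let $E$ be a convenient vector space, let $E_{c^\infty}$ be $E$ with the $c^\infty$-topology, and let $C^\infty_C$ be its sheaf of conveniently smooth functions. Then $(E_{c^\infty},C^\infty_C)$ is an affine $C^\infty$-scheme if and only if $E_{c^\infty}$ is smoothly regular and realcompact.
   Context: A locally convex real vector space (LCVS) is a real vector space with a topology generated by a family of seminorms (initial topology), for which addition and scalar multiplication are continuous. For LCVS $E,F$, $U\subseteq E$ open and $f:U\to F$ continuous, $Df_x(v):=\lim_{t\to0}(f(x+tv)-f(x))/t$ when it exists; $f$ is $\mathbf{C}^1_G$ if $Df_x(v)$ exists for all $(x,v)\in U\times E$ and $Df:U\times E\to F$ is continuous; $f$ is $\mathbf{C}^{k+1}_G$ if $f$ is continuous and $Df$ is $\mathbf{C}^k_G$; $f$ is $C^\infty_G$ (Gâteaux smooth) if it is $\mathbf{C}^k_G$ for all $k$. $C^\infty_G(U)$ is the $C^\infty$-ring of such functions $U\to\mathbb{R}$; this gives a sheaf on $E$. An LCVS $E$ is convenient if a curve $\gamma:\mathbb{R}\to E$ is $C^\infty_G$ if and only if $\ell\circ\gamma\in C^\infty(\mathbb{R})$ for all continuous linear $\ell:E\to\mathbb{R}$. The $c^\infty$-topology on $E$ is the final topology with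 respect to all smooth curves $\mathbb{R}\to E$. For $U$ $c^\infty$-open, $f:U\to\mathbb{R}$ is conveniently smooth if $f\circ\gamma\in C^\infty(\mathbb{R})$ for all smooth curves $\gamma$ with image in $U$; these form a sheaf $C^\infty_C$ on $E_{c^\infty}$. A $C^\infty$-ringed space $(X,\mathcal{O}_X)$ whose structure sheaf is a subsheaf of continuous functions is smoothly regular if $X$ carries the initial topology with respect to all functions in $\Gamma(\mathcal{O}_X)$. $E$ is realcompact if $e\mapsto\mathrm{ev}_e$ is a bijection from $E$ to the set of $C^\infty$-ring homomorphisms from the ring of global smooth functions ($C^\infty_G(E)$, resp. $C^\infty_C(E)$) to $\mathbb{R}$. A ($C^\infty$-)ringed space is an affine $C^\infty$-scheme if it is isomorphic to $\mathrm{Spec}_{C^\infty}(A)$ for some $C^\infty$-ring $A$, where $\mathrm{Spec}_{C^\infty}(A)$ is the set of $C^\infty$-homomorphisms $\varphi:A\to\mathbb{R}$ with basis $U_a=\{\varphi:\varphi(a)\ne0\}$ and structure sheaf the sheafification of $U_a\mapsto A[a^{-1}]$ ($C^\infty$-localization). *)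

theory Defs
  imports "HOL-Analysis.Analysis"
begin

text \<open>
  Throughout, the \<open>n\<close>-th power of a set \<open>X\<close> is \<open>{..<n} \<rightarrow>\<^sub>E X\<close>, and that of a topology \<open>T\<close> is
  \<open>product_topology (\<lambda>_. T) {..<n}\<close>. A real vector space is a type of class \<open>real_vector\<close>;
  its topology is an explicit argument, because one vector space carries several of them.
\<close>

section \<open>Locally convex spaces and Gateaux smooth maps\<close>

definition seminorm :: "('a::real_vector \<Rightarrow> real) \<Rightarrow> bool" where
  "seminorm p \<longleftrightarrow> (\<forall>x y. p (x + y) \<le> p x + p y) \<and> (\<forall>c x. p (c *\<^sub>R x) = \<bar>c\<bar> * p x)"

text \<open>\<open>UNIV\<close> is added to the subbasis for the empty family of seminorms. Not assumed Hausdorff.\<close>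

definition seminorm_topology :: "('a::real_vector \<Rightarrow> real) set \<Rightarrow> 'a topology" where
  "seminorm_topology P =
     topology_generated_by (insert UNIV {{x. p (x - y) < e} | p y e. p \<in> P \<and> e > 0})"

definition lcvs :: "'a::real_vector topology \<Rightarrow> bool" where
  "lcvs T \<longleftrightarrow>
     (\<exists>P. (\<forall>p\<in>P. seminorm p) \<and> T = seminorm_topology P) \<and>
     continuous_map (prod_topology T T) T (\<lambda>(x, y). x + y) \<and>
     continuous_map (prod_topology euclideanreal T) T (\<lambda>(c, x). c *\<^sub>R x)"

text \<open>
  \<open>C\<^sup>k\<^sub>G\<close> refers to \<open>Df\<close>, which lives on \<open>U \<times> E\<close>, so that the domain changes in the recursion on
  \<open>k\<close>. All domains are therefore subsets of powers \<open>E\<^sup>n\<close>, and \<open>E\<^sup>n \<times> E\<^sup>n\<close> is identified with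
  \<open>E\<^sup>2\<^sup>n\<close>: a tuple \<open>z\<close> of length \<open>2n\<close> is the pair \<open>(half1 n z, half2 n z)\<close>.
\<close>

definition half1 :: "nat \<Rightarrow> (nat \<Rightarrow> 'a) \<Rightarrow> (nat \<Rightarrow> 'a)" where
  "half1 n z = (\<lambda>i\<in>{..<n}. z i)"

definition half2 :: "nat \<Rightarrow> (nat \<Rightarrow> 'a) \<Rightarrow> (nat \<Rightarrow> 'a)" where
  "half2 n z = (\<lambda>i\<in>{..<n}. z (n + i))"

definition times_space :: "nat \<Rightarrow> (nat \<Rightarrow> 'a) set \<Rightarrow> (nat \<Rightarrow> 'a) set" where
  "times_space n U = {z \<in> {..<2 * n} \<rightarrow>\<^sub>E UNIV. half1 n z \<in> U}"

definition is_Gateaux_deriv ::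
  "'b::real_vector topology \<Rightarrow> nat \<Rightarrow> ((nat \<Rightarrow> 'a::real_vector) \<Rightarrow> 'b) \<Rightarrow>
     (nat \<Rightarrow> 'a) \<Rightarrow> (nat \<Rightarrow> 'a) \<Rightarrow> 'b \<Rightarrow> bool" where
  "is_Gateaux_deriv S n f x v l \<longleftrightarrow>
     limitin S (\<lambda>t::real. (1 / t) *\<^sub>R (f (\<lambda>i\<in>{..<n}. x i + t *\<^sub>R v i) - f x)) l (at 0)"

text \<open>
  If the target \<open>S\<close> is Hausdorff, \<open>Df\<close> below is uniquely determined on \<open>times_space n U\<close>.
\<close>

primrec Gateaux_C ::
  "nat \<Rightarrow> 'a::real_vector topology \<Rightarrow> 'b::real_vector topology \<Rightarrow> nat \<Rightarrow>
     (nat \<Rightarrow> 'a) set \<Rightarrow> ((nat \<Rightarrow> 'a) \<Rightarrow> 'b) \<Rightarrow> bool" where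
  "Gateaux_C 0 T S n U f \<longleftrightarrow>
     continuous_map (subtopology (product_topology (\<lambda>_. T) {..<n}) U) S f"
| "Gateaux_C (Suc k) T S n U f \<longleftrightarrow>
     continuous_map (subtopology (product_topology (\<lambda>_. T) {..<n}) U) S f \<and>
     (\<exists>Df. (\<forall>z\<in>times_space n U. is_Gateaux_deriv S n f (half1 n z) (half2 n z) (Df z)) \<and>
           Gateaux_C k T S (2 * n) (times_space n U) Df)"

definition Gateaux_smooth ::
  "'a::real_vector topology \<Rightarrow> 'b::real_vector topology \<Rightarrow> 'a set \<Rightarrow> ('a \<Rightarrow> 'b) \<Rightarrow> bool" where
  "Gateaux_smooth T S U f \<longleftrightarrow>
     (\<forall>k. Gateaux_C k T S 1 {x \<in> {..<1} \<rightarrow>\<^sub>E UNIV. x 0 \<in> U} (\<lambda>x. f (x 0)))"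

section \<open>Convenient vector spaces\<close>

definition smooth_curve :: "'a::real_vector topology \<Rightarrow> (real \<Rightarrow> 'a) \<Rightarrow> bool" where
  "smooth_curve T \<gamma> \<longleftrightarrow> Gateaux_smooth euclideanreal T UNIV \<gamma>"

definition smooth_real :: "(real \<Rightarrow> real) \<Rightarrow> bool" where
  "smooth_real g \<longleftrightarrow> (\<forall>k x. (deriv ^^ k) g differentiable at x)"

definition convenient :: "'a::real_vector topology \<Rightarrow> bool" where
  "convenient T \<longleftrightarrow> lcvs T \<and>
     (\<forall>\<gamma>. smooth_curve T \<gamma> \<longleftrightarrow>
       (\<forall>l::'a \<Rightarrow> real. linear l \<and> continuous_map T euclideanreal l \<longrightarrow> smooth_real (l \<circ> \<gamma>)))"

definition cinf_topology :: "'a::real_vector topology \<Rightarrow> 'a topology" where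
  "cinf_topology T = topology (\<lambda>U. \<forall>\<gamma>. smooth_curve T \<gamma> \<longrightarrow> open (\<gamma> -` U))"

lemma openin_cinf_topology:
  "openin (cinf_topology T) U \<longleftrightarrow> (\<forall>\<gamma>. smooth_curve T \<gamma> \<longrightarrow> open (\<gamma> -` U))"
proof -
  have "istopology (\<lambda>U. \<forall>\<gamma>. smooth_curve T \<gamma> \<longrightarrow> open (\<gamma> -` U))"
    unfolding istopology_def by (auto simp: vimage_Union)
  then show ?thesis
    by (simp add: cinf_topology_def)
qed

definition conveniently_smooth ::
  "'a::real_vector topology \<Rightarrow> 'a set \<Rightarrow> ('a \<Rightarrow> real) \<Rightarrow> bool" where
  "conveniently_smooth T U f \<longleftrightarrow>
     (\<forall>\<gamma>. smooth_curve T \<gamma> \<and> range \<gamma> \<subseteq> U \<longrightarrow> smooth_real (f \<circ> \<gamma>))"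

section \<open>\<open>C\<^sup>\<infinity>\<close>-rings\<close>

primrec C_fun :: "nat \<Rightarrow> nat \<Rightarrow> ((nat \<Rightarrow> real) \<Rightarrow> real) \<Rightarrow> bool" where
  "C_fun 0 n f \<longleftrightarrow> continuous_map (product_topology (\<lambda>_. euclideanreal) {..<n}) euclideanreal f"
| "C_fun (Suc k) n f \<longleftrightarrow>
     continuous_map (product_topology (\<lambda>_. euclideanreal) {..<n}) euclideanreal f \<and>
     (\<forall>i<n. \<exists>g. (\<forall>x\<in>{..<n} \<rightarrow>\<^sub>E UNIV. ((\<lambda>t. f (x(i := t))) has_real_derivative g x) (at (x i))) \<and>
                 C_fun k n g)"

definition smooth_fun :: "nat \<Rightarrow> ((nat \<Rightarrow> real) \<Rightarrow> real) \<Rightarrow> bool" where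
  "smooth_fun n f \<longleftrightarrow> (\<forall>k. C_fun k n f)"

text \<open>
  \<open>oper A n f\<close> is the operation \<open>A\<^sup>n \<rightarrow> A\<close> attached to a smooth \<open>f: \<real>\<^sup>n \<rightarrow> \<real>\<close>. Its values at
  non-smooth \<open>f\<close> or outside \<open>{..<n} \<rightarrow>\<^sub>E elts A\<close> are irrelevant, and by the last axiom it depends on
  \<open>f\<close> only through the restriction of \<open>f\<close> to \<open>{..<n} \<rightarrow>\<^sub>E UNIV\<close>.
\<close>

record 'c Cinf_ring =
  elts :: "'c set"
  oper :: "nat \<Rightarrow> ((nat \<Rightarrow> real) \<Rightarrow> real) \<Rightarrow> (nat \<Rightarrow> 'c) \<Rightarrow> 'c"

definition is_Cinf_ring :: "'c Cinf_ring \<Rightarrow> bool" where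
  "is_Cinf_ring A \<longleftrightarrow>
     (\<forall>n f a. smooth_fun n f \<and> a \<in> {..<n} \<rightarrow>\<^sub>E elts A \<longrightarrow> oper A n f a \<in> elts A) \<and>
     (\<forall>n i a. i < n \<and> a \<in> {..<n} \<rightarrow>\<^sub>E elts A \<longrightarrow> oper A n (\<lambda>x. x i) a = a i) \<and>
     (\<forall>m n g h a. smooth_fun m g \<and> (\<forall>j<m. smooth_fun n (h j)) \<and> a \<in> {..<n} \<rightarrow>\<^sub>E elts A \<longrightarrow>
        oper A n (\<lambda>x. g (\<lambda>j\<in>{..<m}. h j x)) a = oper A m g (\<lambda>j\<in>{..<m}. oper A n (h j) a)) \<and>
     (\<forall>n f g a. smooth_fun n f \<and> (\<forall>x\<in>{..<n} \<rightarrow>\<^sub>E UNIV. f x = g x) \<and> a \<in> {..<n} \<rightarrow>\<^sub>E elts A \<longrightarrow>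
        oper A n f a = oper A n g a)"

definition Cinf_hom :: "'c Cinf_ring \<Rightarrow> 'd Cinf_ring \<Rightarrow> ('c \<Rightarrow> 'd) \<Rightarrow> bool" where
  "Cinf_hom A B \<phi> \<longleftrightarrow>
     \<phi> \<in> elts A \<rightarrow> elts B \<and>
     (\<forall>n f a. smooth_fun n f \<and> a \<in> {..<n} \<rightarrow>\<^sub>E elts A \<longrightarrow>
        \<phi> (oper A n f a) = oper B n f (\<lambda>i\<in>{..<n}. \<phi> (a i)))"

definition real_Cinf_ring :: "real Cinf_ring" where
  "real_Cinf_ring = \<lparr>elts = UNIV, oper = (\<lambda>n f a. f a)\<rparr>"

definition real_points :: "'c Cinf_ring \<Rightarrow> ('c \<Rightarrow> real) set" where
  "real_points A = {\<phi> \<in> extensional (elts A). Cinf_hom A real_Cinf_ring \<phi>}"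

section \<open>\<open>C\<^sup>\<infinity>\<close>-localization\<close>

text \<open>
  \<open>A[S\<^sup>-\<^sup>1]\<close> is constructed by generators and relations. \<open>loc_free A S\<close> is the free
  \<open>C\<^sup>\<infinity>\<close>-ring on the generators \<open>Inl b\<close> (\<open>b \<in> A\<close>) and \<open>Inr s\<close> (\<open>s \<in> S\<close>), realised as the smooth
  functions of finitely many of the corresponding coordinates. \<open>loc_rel A S\<close> is the least
  congruence on it for which \<open>Inl\<close> becomes a \<open>C\<^sup>\<infinity>\<close>-homomorphism and \<open>Inr s\<close> an inverse of
  \<open>Inl s\<close>.
\<close>

definition loc_free :: "'c Cinf_ring \<Rightarrow> 'c set \<Rightarrow> (('c + 'c \<Rightarrow> real) \<Rightarrow> real) set" where
  "loc_free A S =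
     {\<lambda>x. f (\<lambda>i\<in>{..<n}. x (g i)) | n f g. smooth_fun n f \<and> g \<in> {..<n} \<rightarrow> elts A <+> S}"

inductive_set loc_rel ::
  "'c Cinf_ring \<Rightarrow> 'c set \<Rightarrow> ((('c + 'c \<Rightarrow> real) \<Rightarrow> real) \<times> (('c + 'c \<Rightarrow> real) \<Rightarrow> real)) set"
  for A :: "'c Cinf_ring" and S :: "'c set" where
  refl: "p \<in> loc_free A S \<Longrightarrow> (p, p) \<in> loc_rel A S"
| sym: "(p, q) \<in> loc_rel A S \<Longrightarrow> (q, p) \<in> loc_rel A S"
| trans: "(p, q) \<in> loc_rel A S \<Longrightarrow> (q, r) \<in> loc_rel A S \<Longrightarrow> (p, r) \<in> loc_rel A S"
| cong: "smooth_fun n f \<Longrightarrow> (\<And>i. i < n \<Longrightarrow> (p i, q i) \<in> loc_rel A S) \<Longrightarrow>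
    ((\<lambda>x. f (\<lambda>i\<in>{..<n}. p i x)), (\<lambda>x. f (\<lambda>i\<in>{..<n}. q i x))) \<in> loc_rel A S"
| hom: "smooth_fun n f \<Longrightarrow> b \<in> {..<n} \<rightarrow>\<^sub>E elts A \<Longrightarrow>
    ((\<lambda>x. x (Inl (oper A n f b))), (\<lambda>x. f (\<lambda>i\<in>{..<n}. x (Inl (b i))))) \<in> loc_rel A S"
| inv: "s \<in> S \<Longrightarrow> ((\<lambda>x. x (Inl s) * x (Inr s)), (\<lambda>x. 1)) \<in> loc_rel A S"

definition localization ::
  "'c Cinf_ring \<Rightarrow> 'c set \<Rightarrow> (('c + 'c \<Rightarrow> real) \<Rightarrow> real) set Cinf_ring" where
  "localization A S =
     \<lparr>elts = loc_free A S // loc_rel A S,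
      oper = (\<lambda>n f C. loc_rel A S `` {\<lambda>x. f (\<lambda>i\<in>{..<n}. (SOME p. p \<in> C i) x)})\<rparr>"

text \<open>For \<open>S \<subseteq> S'\<close>, this is the canonical map \<open>A[S\<^sup>-\<^sup>1] \<rightarrow> A[S'\<^sup>-\<^sup>1]\<close>.\<close>

definition loc_map ::
  "'c Cinf_ring \<Rightarrow> 'c set \<Rightarrow> (('c + 'c \<Rightarrow> real) \<Rightarrow> real) set \<Rightarrow>
     (('c + 'c \<Rightarrow> real) \<Rightarrow> real) set" where
  "loc_map A S' C = loc_rel A S' `` C"

section \<open>\<open>C\<^sup>\<infinity>\<close>-ringed spaces and the spectrum\<close>

record ('x, 's) ringed_space =
  underlying :: "'x topology"
  sections :: "'x set \<Rightarrow> 's Cinf_ring"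
  res :: "'x set \<Rightarrow> 'x set \<Rightarrow> 's \<Rightarrow> 's"

definition preim :: "('x, 's) ringed_space \<Rightarrow> ('x \<Rightarrow> 'y) \<Rightarrow> 'y set \<Rightarrow> 'x set" where
  "preim X h V = {x \<in> topspace (underlying X). h x \<in> V}"

definition ringed_space_iso :: "('x, 's) ringed_space \<Rightarrow> ('y, 't) ringed_space \<Rightarrow> bool" where
  "ringed_space_iso X Y \<longleftrightarrow>
     (\<exists>h H. homeomorphic_map (underlying X) (underlying Y) h \<and>
       (\<forall>V. openin (underlying Y) V \<longrightarrow>
          Cinf_hom (sections Y V) (sections X (preim X h V)) (H V) \<and>
          bij_betw (H V) (elts (sections Y V)) (elts (sections X (preim X h V)))) \<and>
       (\<forall>V W. openin (underlying Y) V \<and> openin (underlying Y) W \<and> W \<subseteq> V \<longrightarrow>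
          (\<forall>s\<in>elts (sections Y V). H W (res Y V W s) = res X (preim X h V) (preim X h W) (H V s))))"

definition basic_open :: "'c Cinf_ring \<Rightarrow> 'c \<Rightarrow> ('c \<Rightarrow> real) set" where
  "basic_open A a = {\<phi> \<in> real_points A. \<phi> a \<noteq> 0}"

text \<open>
  The stalk at \<open>\<phi>\<close>: the colimit of the rings \<open>A[a\<^sup>-\<^sup>1]\<close> over all \<open>a\<close> with \<open>\<phi> \<in> U\<^sub>a\<close>, which is the
  localization of \<open>A\<close> at all these \<open>a\<close>.
\<close>

definition nonvanishing :: "'c Cinf_ring \<Rightarrow> ('c \<Rightarrow> real) \<Rightarrow> 'c set" where
  "nonvanishing A \<phi> = {a \<in> elts A. \<phi> a \<noteq> 0}"

definition stalk ::
  "'c Cinf_ring \<Rightarrow> ('c \<Rightarrow> real) \<Rightarrow> (('c + 'c \<Rightarrow> real) \<Rightarrow> real) set Cinf_ring" where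
  "stalk A \<phi> = localization A (nonvanishing A \<phi>)"

text \<open>
  The sheafification of \<open>U\<^sub>a \<mapsto> A[a\<^sup>-\<^sup>1]\<close>: its sections over \<open>V\<close> are the families of germs on \<open>V\<close>
  that are locally, on some \<open>U\<^sub>a\<close>, induced by an element of \<open>A[a\<^sup>-\<^sup>1]\<close>. The localization is
  indexed by \<open>a\<close>, not by the set \<open>U\<^sub>a\<close>: for general \<open>A\<close>, equal sets \<open>U\<^sub>a\<close> may come with
  different rings \<open>A[a\<^sup>-\<^sup>1]\<close>.
\<close>

definition Spec_sections ::
  "'c Cinf_ring \<Rightarrow> ('c \<Rightarrow> real) set \<Rightarrow>
     (('c \<Rightarrow> real) \<Rightarrow> (('c + 'c \<Rightarrow> real) \<Rightarrow> real) set) Cinf_ring" where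
  "Spec_sections A V =
     \<lparr>elts = {s \<in> (\<Pi>\<^sub>E \<phi>\<in>V. elts (stalk A \<phi>)).
               \<forall>\<phi>\<in>V. \<exists>a\<in>elts A. \<phi> \<in> basic_open A a \<and> basic_open A a \<subseteq> V \<and>
                 (\<exists>t\<in>elts (localization A {a}).
                    \<forall>\<psi>\<in>basic_open A a. s \<psi> = loc_map A (nonvanishing A \<psi>) t)},
      oper = (\<lambda>n f s. \<lambda>\<phi>\<in>V. oper (stalk A \<phi>) n f (\<lambda>i\<in>{..<n}. s i \<phi>))\<rparr>"

definition Spec ::
  "'c Cinf_ring \<Rightarrow> ('c \<Rightarrow> real, ('c \<Rightarrow> real) \<Rightarrow> (('c + 'c \<Rightarrow> real) \<Rightarrow> real) set) ringed_space" where
  "Spec A =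
     \<lparr>underlying = topology_generated_by (basic_open A ` elts A),
      sections = Spec_sections A,
      res = (\<lambda>V W s. restrict s W)\<rparr>"

text \<open>The type argument is the type in which the elements of the \<open>C\<^sup>\<infinity>\<close>-ring are taken.\<close>

definition affine_Cinf_scheme :: "'c itself \<Rightarrow> ('x, 's) ringed_space \<Rightarrow> bool" where
  "affine_Cinf_scheme (_ :: 'c itself) X \<longleftrightarrow>
     (\<exists>A :: 'c Cinf_ring. is_Cinf_ring A \<and> ringed_space_iso X (Spec A))"

section \<open>Ringed spaces of functions\<close>

definition function_space ::
  "'x topology \<Rightarrow> ('x set \<Rightarrow> ('x \<Rightarrow> real) \<Rightarrow> bool) \<Rightarrow> ('x, 'x \<Rightarrow> real) ringed_space" where
  "function_space X P =
     \<lparr>underlying = X,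
      sections = (\<lambda>U. \<lparr>elts = {f \<in> extensional U. P U f},
                       oper = (\<lambda>n F f. \<lambda>x\<in>U. F (\<lambda>i\<in>{..<n}. f i x))\<rparr>),
      res = (\<lambda>V W f. restrict f W)\<rparr>"

definition Gateaux_space :: "'a::real_vector topology \<Rightarrow> ('a, 'a \<Rightarrow> real) ringed_space" where
  "Gateaux_space T = function_space T (Gateaux_smooth T euclideanreal)"

definition convenient_space :: "'a::real_vector topology \<Rightarrow> ('a, 'a \<Rightarrow> real) ringed_space" where
  "convenient_space T = function_space (cinf_topology T) (conveniently_smooth T)"

definition global_sections :: "('x, 's) ringed_space \<Rightarrow> 's Cinf_ring" where
  "global_sections X = sections X (topspace (underlying X))"

definition initial_topology :: "'x set \<Rightarrow> ('x \<Rightarrow> real) set \<Rightarrow> 'x topology" where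
  "initial_topology S F =
     topology_generated_by (insert S {{x \<in> S. f x \<in> W} | f W. f \<in> F \<and> open W})"

definition smoothly_regular :: "('x, 'x \<Rightarrow> real) ringed_space \<Rightarrow> bool" where
  "smoothly_regular X \<longleftrightarrow>
     underlying X = initial_topology (topspace (underlying X)) (elts (global_sections X))"

definition realcompact :: "('x, 'x \<Rightarrow> real) ringed_space \<Rightarrow> bool" where
  "realcompact X \<longleftrightarrow>
     bij_betw (\<lambda>e. \<lambda>f\<in>elts (global_sections X). f e)
       (topspace (underlying X)) (real_points (global_sections X))"

definition germs_extend :: "('x, 's) ringed_space \<Rightarrow> bool" where
  "germs_extend X \<longleftrightarrow>
     (\<forall>U e f. openin (underlying X) U \<and> e \<in> U \<and> f \<in> elts (sections X U) \<longrightarrow>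
       (\<exists>g\<in>elts (global_sections X). \<exists>W. openin (underlying X) W \<and> e \<in> W \<and> W \<subseteq> U \<and>
          res X (topspace (underlying X)) W g = res X U W f))"

end

theory Submission
  imports Defs
begin

text \<open>
  The real points of \<open>\<Gamma>(Spec A)\<close> are the evaluations at the points of \<open>Spec A\<close>: a section \<open>s\<close> is
  near a point \<open>\<phi>\<close> the germ of some \<open>c \<in> A\<close>, because \<open>1/a\<close> can be replaced by \<open>\<kappa>(a)\<close> with \<open>\<kappa>\<close>
  smooth on \<open>\<real>\<close>, and multiplication with a bump function makes \<open>s\<close> itself an element of \<open>A\<close>.
  Hence an isomorphism of a space of functions with \<open>Spec A\<close> turns sections into their value
  functions, and regularity, realcompactness and extension of germs are inherited from \<open>Spec A\<close>.

  Conversely, if \<open>A\<close> is the ring of global functions, realcompactness and smooth regularity say that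
  evaluation \<open>E \<rightarrow> Spec A\<close> is a homeomorphism. By bump functions, two elements of \<open>A\<close> that agree
  near a point have the same germ in the stalk of \<open>Spec A\<close>, so the sections of \<open>Spec A\<close> are the
  functions that are locally restrictions of elements of \<open>A\<close>; extension of germs says that these are
  all local functions. For conveniently smooth functions, a cutoff function extends germs.
\<close>

section \<open>Smooth functions on \<open>\<real>\<^sup>n\<close>\<close>

text \<open>A ring \<open>A\<close> need not be determined by the values of its elements at real
  points, so equality of germs cannot be read off from values. Local arguments in
  \<open>Spec A\<close> rest instead on identities in \<open>A\<close>: if \<open>e c = e c'\<close>
  and \<open>e\<close> is invertible in the stalk, then \<open>c\<close> and \<open>c'\<close> have
  the same germ. The identities come from smooth functions of one variable applied to a single
  element, since these hold in every C^\<infinity>-ring. This is why bumps, steps and local inverses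
  are built on the real line. An isomorphism with \<open>Spec A\<close> consists of bijections of
  section rings that respect operations and restrictions; nothing is given about values. Evaluation
  at \<open>x\<close> is a real point of the global sections, hence evaluation at some
  \<open>\<phi>\<close>. If \<open>\<phi>\<close> differed from \<open>h x\<close>, some element
  nonzero at \<open>\<phi>\<close> would restrict to the zero section near \<open>h x\<close>, a
  contradiction. Derivatives of composites are handled uniformly by \<open>total_diff\<close>, which
  turns the derivative of a smooth function of several quantities into a smooth function of these
  quantities and their derivatives.\<close>

definition pd :: "nat \<Rightarrow> ((nat \<Rightarrow> real) \<Rightarrow> real) \<Rightarrow> (nat \<Rightarrow> real) \<Rightarrow> real" where
  "pd i f x = deriv (\<lambda>t. f (x(i := t))) (x i)"

lemma upd_PiE: "x \<in> {..<n} \<rightarrow>\<^sub>E (UNIV::real set) \<Longrightarrow> i < n \<Longrightarrow> x(i := t) \<in> {..<n} \<rightarrow>\<^sub>E UNIV"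
  by (auto simp: PiE_def extensional_def)

lemma C_fun_cong:
  assumes "\<And>x. x \<in> {..<n} \<rightarrow>\<^sub>E UNIV \<Longrightarrow> f x = g x" "C_fun k n f"
  shows "C_fun k n g"
proof -
  have c: "continuous_map (product_topology (\<lambda>_. euclideanreal) {..<n}) euclideanreal g"
    if "continuous_map (product_topology (\<lambda>_. euclideanreal) {..<n}) euclideanreal f"
    by (rule continuous_map_eq[OF that]) (use assms(1) in auto)
  show ?thesis
  proof (cases k)
    case 0
    then show ?thesis using assms c by simp
  next
    case (Suc k')
    have "(\<lambda>t. g (x(i := t))) = (\<lambda>t. f (x(i := t)))"
      if "i < n" "x \<in> {..<n} \<rightarrow>\<^sub>E UNIV" for i x
      using assms(1)[OF upd_PiE[OF that(2,1)]] by auto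
    with Suc assms c show ?thesis by auto
  qed
qed

lemma C_fun_continuous:
  "C_fun k n f \<Longrightarrow> continuous_map (product_topology (\<lambda>_. euclideanreal) {..<n}) euclideanreal f"
  by (cases k) auto

lemma C_fun_SucI:
  assumes "continuous_map (product_topology (\<lambda>_. euclideanreal) {..<n}) euclideanreal f"
    and "\<And>i x. i < n \<Longrightarrow> x \<in> {..<n} \<rightarrow>\<^sub>E UNIV \<Longrightarrow>
      ((\<lambda>t. f (x(i := t))) has_real_derivative g i x) (at (x i))"
    and "\<And>i. i < n \<Longrightarrow> C_fun k n (g i)"
  shows "C_fun (Suc k) n f"
  using assms by auto

text \<open>By uniqueness of derivatives, the existential witness agrees on the power with the
  canonical \<open>pd i f\<close>. The witness then does not depend on the order \<open>k\<close>,
  so statements for all orders can share it.\<close>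

lemma C_fun_SucD:
  assumes "C_fun (Suc k) n f" "i < n"
  shows "C_fun k n (pd i f)"
    and "x \<in> {..<n} \<rightarrow>\<^sub>E UNIV \<Longrightarrow>
      ((\<lambda>t. f (x(i := t))) has_real_derivative pd i f x) (at (x i))"
proof -
  obtain g where g: "\<And>x. x\<in>{..<n} \<rightarrow>\<^sub>E UNIV \<Longrightarrow>
      ((\<lambda>t. f (x(i := t))) has_real_derivative g x) (at (x i))" "C_fun k n g"
    using assms unfolding C_fun.simps by blast
  have e: "g x = pd i f x" if "x \<in> {..<n} \<rightarrow>\<^sub>E UNIV" for x
    unfolding pd_def using g(1)[OF that] by (rule DERIV_imp_deriv[symmetric])
  show "C_fun k n (pd i f)"
    using C_fun_cong[OF e g(2)] .
  show "x \<in> {..<n} \<rightarrow>\<^sub>E UNIV \<Longrightarrow>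
      ((\<lambda>t. f (x(i := t))) has_real_derivative pd i f x) (at (x i))"
    using g(1) e by force
qed

lemma C_fun_mono: "C_fun (Suc k) n f \<Longrightarrow> C_fun k n f"
proof (induction k arbitrary: f)
  case (Suc k)
  show ?case
    by (rule C_fun_SucI[where g = "\<lambda>i. pd i f"])
       (rule C_fun_continuous[OF Suc.prems] C_fun_SucD(2)[OF Suc.prems]
         Suc.IH[OF C_fun_SucD(1)[OF Suc.prems]]; assumption)+
qed auto

lemma C_fun_add: "C_fun k n f \<Longrightarrow> C_fun k n g \<Longrightarrow> C_fun k n (\<lambda>x. f x + g x)"
proof (induction k arbitrary: f g)
  case 0
  then show ?case by (simp add: continuous_map_add)
next
  case (Suc k)
  show ?case
  proof (rule C_fun_SucI[where g = "\<lambda>i x. pd i f x + pd i g x"])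
    fix i x assume "i < n" and "x \<in> {..<n} \<rightarrow>\<^sub>E (UNIV::real set)"
    from DERIV_add[OF C_fun_SucD(2)[OF Suc.prems(1) this] C_fun_SucD(2)[OF Suc.prems(2) this]]
    show "((\<lambda>t. f (x(i := t)) + g (x(i := t))) has_real_derivative
        pd i f x + pd i g x) (at (x i))" .
  next
    fix i assume "i < n"
    with Suc show "C_fun k n (\<lambda>x. pd i f x + pd i g x)"
      by (intro Suc.IH C_fun_SucD)
  qed (use Suc.prems C_fun_continuous in \<open>auto intro!: continuous_map_add simp del: C_fun.simps\<close>)
qed

lemma C_fun_mult: "C_fun k n f \<Longrightarrow> C_fun k n g \<Longrightarrow> C_fun k n (\<lambda>x. f x * g x)"
proof (induction k arbitrary: f g)
  case 0
  then show ?case by (simp add: continuous_map_real_mult)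
next
  case (Suc k)
  show ?case
  proof (rule C_fun_SucI[where g = "\<lambda>i x. pd i f x * g x + pd i g x * f x"])
    fix i x assume "i < n" and "x \<in> {..<n} \<rightarrow>\<^sub>E (UNIV::real set)"
    from DERIV_mult[OF C_fun_SucD(2)[OF Suc.prems(1) this] C_fun_SucD(2)[OF Suc.prems(2) this], unfolded fun_upd_triv]
    show "((\<lambda>t. f (x(i := t)) * g (x(i := t))) has_real_derivative
        pd i f x * g x + pd i g x * f x) (at (x i))" .
  next
    fix i assume "i < n"
    then show "C_fun k n (\<lambda>x. pd i f x * g x + pd i g x * f x)"
      by (intro C_fun_add Suc.IH C_fun_SucD(1)[OF Suc.prems(1)] C_fun_SucD(1)[OF Suc.prems(2)]
          C_fun_mono[OF Suc.prems(1)] C_fun_mono[OF Suc.prems(2)])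
  qed (use Suc.prems C_fun_continuous in \<open>auto intro!: continuous_map_real_mult simp del: C_fun.simps\<close>)
qed

lemma C_fun_const: "C_fun k n (\<lambda>x. c)"
proof (induction k arbitrary: c)
  case (Suc k)
  show ?case
    by (rule C_fun_SucI[where g = "\<lambda>i x. 0"]) (use Suc in auto)
qed auto

lemma C_fun_proj:
  assumes "j < n"
  shows "C_fun k n (\<lambda>x. x j)"
proof (cases k)
  case (Suc k')
  show ?thesis unfolding Suc
    by (rule C_fun_SucI[where g = "\<lambda>i x. if i = j then 1 else 0",
          OF continuous_map_product_coordinates])
       (use assms in \<open>auto intro!: C_fun_const simp del: C_fun.simps\<close>)
next
  case 0
  then show ?thesis
    using continuous_map_product_coordinates[of j "{..<n}" "\<lambda>_. euclideanreal"] assms by simp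
qed

lemma C_fun_sum:
  "finite I \<Longrightarrow> (\<And>i. i \<in> I \<Longrightarrow> C_fun k n (f i)) \<Longrightarrow> C_fun k n (\<lambda>x. \<Sum>i\<in>I. f i x)"
  by (induction I rule: finite_induct) (auto intro: C_fun_add C_fun_const)

lemma smooth_fun_continuous:
  "smooth_fun n f \<Longrightarrow> continuous_map (product_topology (\<lambda>_. euclideanreal) {..<n}) euclideanreal f"
  unfolding smooth_fun_def using C_fun_continuous by blast

lemma smooth_fun_pd: "smooth_fun n f \<Longrightarrow> i < n \<Longrightarrow> smooth_fun n (pd i f)"
  unfolding smooth_fun_def using C_fun_SucD(1) by blast

lemma smooth_fun_pd_deriv:
  "smooth_fun n f \<Longrightarrow> i < n \<Longrightarrow> x \<in> {..<n} \<rightarrow>\<^sub>E UNIV \<Longrightarrow>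
     ((\<lambda>t. f (x(i := t))) has_real_derivative pd i f x) (at (x i))"
  unfolding smooth_fun_def using C_fun_SucD(2) by blast

lemma smooth_fun_const: "smooth_fun n (\<lambda>x. c)"
  and smooth_fun_proj: "j < n \<Longrightarrow> smooth_fun n (\<lambda>x. x j)"
  and smooth_fun_add: "smooth_fun n f \<Longrightarrow> smooth_fun n g \<Longrightarrow> smooth_fun n (\<lambda>x. f x + g x)"
  and smooth_fun_mult: "smooth_fun n f \<Longrightarrow> smooth_fun n g \<Longrightarrow> smooth_fun n (\<lambda>x. f x * g x)"
  and smooth_fun_sum: "finite I \<Longrightarrow> (\<And>i. i \<in> I \<Longrightarrow> smooth_fun n (h i)) \<Longrightarrow>
    smooth_fun n (\<lambda>x. \<Sum>i\<in>I. h i x)"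
  unfolding smooth_fun_def
  by (auto intro: C_fun_const C_fun_proj C_fun_add C_fun_mult C_fun_sum)

text \<open>Bounding the distance from \<open>a\<close> instead of naming an interval covers
  \<open>b < a\<close> and \<open>a = b\<close> as well, so the chain rule needs no distinction of
  signs.\<close>

lemma MVT_symmetric:
  fixes u :: "real \<Rightarrow> real"
  assumes "\<And>t. (u has_real_derivative u' t) (at t)"
  shows "\<exists>z. \<bar>z - a\<bar> \<le> \<bar>b - a\<bar> \<and> u b - u a = (b - a) * u' z"
proof (cases a b rule: linorder_cases)
  case less
  from MVT2[OF this, of u u'] assms obtain z where "z > a" "z < b" "u b - u a = (b - a) * u' z"
    by blast
  then show ?thesis by (intro exI[of _ z]) auto
next
  case greater
  from MVT2[OF this, of u u'] assms obtain z where "z > b" "z < a" "u a - u b = (a - b) * u' z"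
    by blast
  then show ?thesis by (intro exI[of _ z]) (auto simp: algebra_simps)
qed auto

text \<open>
  The increment is a telescoping sum of increments in one coordinate, each of which is evaluated by
  the mean value theorem.
\<close>

lemma smooth_fun_chain:
  assumes F: "smooth_fun n F"
    and u: "\<And>i. i < n \<Longrightarrow> (u i has_real_derivative d i) (at t0)"
  shows "((\<lambda>t. F (\<lambda>i\<in>{..<n}. u i t)) has_real_derivative
     (\<Sum>i<n. pd i F (\<lambda>i\<in>{..<n}. u i t0) * d i)) (at t0)"
proof -
  define p where "p = (\<lambda>i\<in>{..<n}. u i t0)"
  \<comment> \<open>Coordinates below \<open>i\<close> have already moved to time \<open>t\<close>,
    the others are still at \<open>t0\<close>; passing from \<open>i\<close> to \<open>Suc i\<close>
    moves coordinate \<open>i\<close> alone.\<close>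
  define y where "y i t = (\<lambda>j\<in>{..<n}. if j < i then u j t else u j t0)" for i t
  have "\<exists>\<xi>. \<bar>\<xi> - u i t0\<bar> \<le> \<bar>u i t - u i t0\<bar> \<and>
      F ((y i t)(i := u i t)) - F ((y i t)(i := u i t0)) =
        (u i t - u i t0) * pd i F ((y i t)(i := \<xi>))" if "i < n" for i t
  proof (rule MVT_symmetric)
    fix s
    have "(y i t)(i := s) \<in> {..<n} \<rightarrow>\<^sub>E UNIV"
      using that by (auto simp: y_def PiE_def extensional_def)
    from smooth_fun_pd_deriv[OF F that this]
    show "((\<lambda>s. F ((y i t)(i := s))) has_real_derivative pd i F ((y i t)(i := s))) (at s)"
      by simp
  qed
  then obtain \<xi> where xi: "\<And>i t. i < n \<Longrightarrow> \<bar>\<xi> i t - u i t0\<bar> \<le> \<bar>u i t - u i t0\<bar>"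
    "\<And>i t. i < n \<Longrightarrow> F ((y i t)(i := u i t)) - F ((y i t)(i := u i t0)) =
        (u i t - u i t0) * pd i F ((y i t)(i := \<xi> i t))"
    by metis
  have ytu: "(y i t)(i := u i t) = y (Suc i) t" "(y i t)(i := u i t0) = y i t" if "i < n" for i t
    using that by (auto simp: y_def fun_eq_iff)
  have tel: "F (y n t) - F (y 0 t) = (\<Sum>i<n. (u i t - u i t0) * pd i F ((y i t)(i := \<xi> i t)))" for t
  proof -
    have "F (y n t) - F (y 0 t) = (\<Sum>i<n. F (y (Suc i) t) - F (y i t))"
      by (rule sum_lessThan_telescope[symmetric])
    also have "\<dots> = (\<Sum>i<n. (u i t - u i t0) * pd i F ((y i t)(i := \<xi> i t)))"
      by (rule sum.cong) (auto simp: xi(2)[symmetric] ytu)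
    finally show ?thesis .
  qed
  have y_n: "y n t = (\<lambda>i\<in>{..<n}. u i t)" and y_0: "y 0 t = p" for t
    by (auto simp: y_def p_def fun_eq_iff)
  have ulim: "(u i \<longlongrightarrow> u i t0) (at t0)" if "i < n" for i
    using DERIV_isCont[OF u[OF that]] by (simp add: isCont_def)
  \<comment> \<open>Since \<open>\<xi> i t\<close> is no farther from \<open>u i t0\<close> than
    \<open>u i t\<close> is, the argument tends to \<open>p\<close>; continuity of
    \<open>pd i F\<close> does the rest.\<close>
  have lim: "((\<lambda>t. pd i F ((y i t)(i := \<xi> i t))) \<longlongrightarrow> pd i F p) (at t0)" if i: "i < n" for i
  proof -
    have xl: "(\<xi> i \<longlongrightarrow> u i t0) (at t0)"
    proof -
      have "((\<lambda>t. \<bar>u i t - u i t0\<bar>) \<longlongrightarrow> 0) (at t0)"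
        using ulim[OF i] by (simp add: LIM_zero tendsto_rabs_zero)
      then have "((\<lambda>t. \<xi> i t - u i t0) \<longlongrightarrow> 0) (at t0)"
        by (rule Lim_null_comparison[rotated]) (use xi(1)[OF i] in auto)
      then show ?thesis by (simp add: LIM_zero_iff)
    qed
    have "limitin (product_topology (\<lambda>_. euclideanreal) {..<n}) (\<lambda>t. (y i t)(i := \<xi> i t)) p (at t0)"
      unfolding limitin_componentwise
    proof (intro conjI ballI)
      show "p \<in> extensional {..<n}" by (simp add: p_def)
      show "\<forall>\<^sub>F t in at t0. (y i t)(i := \<xi> i t) \<in> topspace (product_topology (\<lambda>_. euclideanreal) {..<n})"
        using i by (intro always_eventually allI) (auto simp: y_def PiE_def extensional_def)
      fix j assume j: "j \<in> {..<n}"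
      show "limitin euclideanreal (\<lambda>t. ((y i t)(i := \<xi> i t)) j) (p j) (at t0)"
        using i j xl ulim[of j] by (cases "j = i"; cases "j < i") (auto simp: y_def p_def)
    qed
    from continuous_map_limit[OF smooth_fun_continuous[OF smooth_fun_pd[OF F i]] this]
    show ?thesis by (simp add: o_def)
  qed
  have "((\<lambda>t. \<Sum>i<n. pd i F ((y i t)(i := \<xi> i t)) * ((u i t - u i t0) / (t - t0)))
      \<longlongrightarrow> (\<Sum>i<n. pd i F p * d i)) (at t0)"
    by (intro tendsto_sum tendsto_mult lim) (use u in \<open>auto simp: has_field_derivative_iff\<close>)
  moreover have "(\<Sum>i<n. pd i F ((y i t)(i := \<xi> i t)) * ((u i t - u i t0) / (t - t0))) =
      (F (\<lambda>i\<in>{..<n}. u i t) - F p) / (t - t0)" for t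
    using tel[of t] by (simp add: y_n y_0 sum_divide_distrib mult.commute)
  ultimately show ?thesis
    unfolding has_field_derivative_iff p_def by simp
qed

lemma continuous_map_tuple:
  "(\<And>j. j < m \<Longrightarrow> continuous_map X Y (h j)) \<Longrightarrow>
    continuous_map X (product_topology (\<lambda>_. Y) {..<m}) (\<lambda>x. \<lambda>j\<in>{..<m}. h j x)"
  by (rule continuous_map_coordinatewise_then_product) auto

text \<open>Induction on the order for all outer functions at once: the chain rule leads from
  \<open>F\<close> to the \<open>pd j F\<close> composed with the same inner functions, times
  derivatives of the latter, which are smooth already.\<close>

lemma smooth_fun_comp:
  assumes "smooth_fun m F" and h: "\<And>j. j < m \<Longrightarrow> smooth_fun n (h j)"
  shows "smooth_fun n (\<lambda>x. F (\<lambda>j\<in>{..<m}. h j x))"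
proof -
  have c: "continuous_map (product_topology (\<lambda>_. euclideanreal) {..<n}) euclideanreal
      (\<lambda>x. F (\<lambda>j\<in>{..<m}. h j x))" if "smooth_fun m F" for F
  proof -
    have "continuous_map (product_topology (\<lambda>_. euclideanreal) {..<n})
        (product_topology (\<lambda>_. euclideanreal) {..<m}) (\<lambda>x. \<lambda>j\<in>{..<m}. h j x)"
      by (intro continuous_map_tuple smooth_fun_continuous h)
    from continuous_map_compose[OF this smooth_fun_continuous[OF that]]
    show ?thesis unfolding o_def .
  qed
  have "C_fun k n (\<lambda>x. F (\<lambda>j\<in>{..<m}. h j x))" for k
    using assms(1)
  proof (induction k arbitrary: F)
    case 0
    then show ?case unfolding C_fun.simps by (rule c)
  next
    case (Suc k)
    show ?case
    proof (rule C_fun_SucI[where g = "\<lambda>i x. \<Sum>j<m. pd j F (\<lambda>j\<in>{..<m}. h j x) * pd i (h j) x"])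
      fix i x assume ix: "i < n" "x \<in> {..<n} \<rightarrow>\<^sub>E (UNIV::real set)"
      show "((\<lambda>t. F (\<lambda>j\<in>{..<m}. h j (x(i := t)))) has_real_derivative
          (\<Sum>j<m. pd j F (\<lambda>j\<in>{..<m}. h j x) * pd i (h j) x)) (at (x i))"
        using smooth_fun_chain[OF Suc.prems, of "\<lambda>j t. h j (x(i := t))" "\<lambda>j. pd i (h j) x" "x i",
            OF smooth_fun_pd_deriv[OF h ix]] by (simp only: fun_upd_triv)
    next
      fix i assume "i < n"
      then show "C_fun k n (\<lambda>x. \<Sum>j<m. pd j F (\<lambda>j\<in>{..<m}. h j x) * pd i (h j) x)"
        using smooth_fun_pd[OF h]
        by (intro C_fun_sum C_fun_mult Suc.IH smooth_fun_pd[OF Suc.prems] finite_lessThan)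
           (simp_all add: smooth_fun_def)
    qed (rule c[OF Suc.prems])
  qed
  then show ?thesis by (simp add: smooth_fun_def)
qed

text \<open>
  The derivative of \<open>F (f\<^sub>0, \<dots>, f\<^sub>m\<^sub>-\<^sub>1)\<close> is again a smooth function of the \<open>f\<^sub>j\<close> and their
  derivatives, namely this one.
\<close>

definition total_diff :: "nat \<Rightarrow> ((nat \<Rightarrow> real) \<Rightarrow> real) \<Rightarrow> (nat \<Rightarrow> real) \<Rightarrow> real" where
  "total_diff m F y = (\<Sum>j<m. pd j F (\<lambda>i\<in>{..<m}. y i) * y (m + j))"

lemma smooth_fun_total_diff:
  assumes "smooth_fun m F"
  shows "smooth_fun (2 * m) (total_diff m F)"
  unfolding total_diff_def
proof (intro smooth_fun_sum smooth_fun_mult)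
  fix j assume "j \<in> {..<m}"
  then show "smooth_fun (2 * m) (\<lambda>y. pd j F (\<lambda>i\<in>{..<m}. y i))"
    by (intro smooth_fun_comp smooth_fun_pd assms smooth_fun_proj) auto
qed (auto intro: smooth_fun_proj)

lemma smooth_fun_chain_total_diff:
  assumes "smooth_fun m F" "\<And>i. i < m \<Longrightarrow> (u i has_real_derivative d i) (at t0)"
  shows "((\<lambda>t. F (\<lambda>i\<in>{..<m}. u i t)) has_real_derivative
     total_diff m F (\<lambda>i\<in>{..<2 * m}. if i < m then u i t0 else d (i - m))) (at t0)"
proof -
  have "total_diff m F (\<lambda>i\<in>{..<2 * m}. if i < m then u i t0 else d (i - m)) =
      (\<Sum>i<m. pd i F (\<lambda>i\<in>{..<m}. u i t0) * d i)"
    unfolding total_diff_def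
    by (intro sum.cong refl arg_cong2[where f = "(*)"] arg_cong[where f = "pd _ F"])
       (auto simp: fun_eq_iff)
  with smooth_fun_chain[OF assms] show ?thesis by simp
qed

section \<open>Smooth functions of one variable\<close>

lemma smooth_real_deriv: "smooth_real u \<Longrightarrow> smooth_real (deriv u)"
  unfolding smooth_real_def by (metis funpow_swap1 funpow.simps(2) o_apply)

lemma smooth_real_has_deriv: "smooth_real u \<Longrightarrow> (u has_real_derivative deriv u x) (at x)"
  unfolding smooth_real_def
  by (metis DERIV_deriv_iff_real_differentiable funpow_0)

text \<open>A class of functions that is closed under differentiation consists of smooth functions.
  Choosing a suitable class \<open>K\<close> replaces formulas for iterated derivatives.\<close>

lemma smooth_real_coinduct:
  assumes "K u"
    and "\<And>u. K u \<Longrightarrow> \<exists>u'. (\<forall>x. (u has_real_derivative u' x) (at x)) \<and> K u'"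
  shows "smooth_real u"
proof -
  have K: "K (deriv v) \<and> (\<forall>x. v differentiable at x)" if v: "K v" for v
  proof -
    obtain v' where "\<forall>x. (v has_real_derivative v' x) (at x)" and K: "K v'"
      using assms(2)[OF v] by blast
    then have v': "(v has_real_derivative v' x) (at x)" for x by blast
    have "deriv v = v'" using DERIV_imp_deriv[OF v'] by auto
    moreover have "v differentiable at x" for x
      using v' by (rule real_differentiable_def[THEN iffD2, OF exI])
    ultimately show ?thesis using K by simp
  qed
  have "K ((deriv ^^ k) u)" for k
    by (induction k) (use assms(1) K in auto)
  then show ?thesis unfolding smooth_real_def using K by blast
qed

text \<open>The class for the coinduction lets \<open>m\<close>, \<open>F\<close> and the inner
  functions vary, because differentiation replaces \<open>F\<close> by \<open>total_diff m F\<close>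
  and doubles the number of inner functions.\<close>

lemma smooth_real_comp:
  assumes "smooth_fun m F" "\<And>j. j < m \<Longrightarrow> smooth_real (v j)"
  shows "smooth_real (\<lambda>t. F (\<lambda>j\<in>{..<m}. v j t))"
proof (rule smooth_real_coinduct[where K = "\<lambda>u. \<exists>m F v. smooth_fun m F \<and>
    (\<forall>j<m. smooth_real (v j)) \<and> u = (\<lambda>t. F (\<lambda>j\<in>{..<m}. v j t))"])
  fix u assume "\<exists>m F v. smooth_fun m F \<and> (\<forall>j<m. smooth_real (v j)) \<and> u = (\<lambda>t. F (\<lambda>j\<in>{..<m}. v j t))"
  then obtain m F v where F: "smooth_fun m F" and v: "\<And>j. j<m \<Longrightarrow> smooth_real (v j)"
    and u: "u = (\<lambda>t. F (\<lambda>j\<in>{..<m}. v j t))" by blast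
  show "\<exists>u'. (\<forall>x. (u has_real_derivative u' x) (at x)) \<and>
      (\<exists>m F v. smooth_fun m F \<and> (\<forall>j<m. smooth_real (v j)) \<and> u' = (\<lambda>t. F (\<lambda>j\<in>{..<m}. v j t)))"
  proof (intro exI[of _ "\<lambda>t. total_diff m F (\<lambda>j\<in>{..<2 * m}.
        (if j < m then v j else deriv (v (j - m))) t)"] conjI exI[of _ "2 * m"]
      exI[of _ "total_diff m F"] exI[of _ "\<lambda>j. if j < m then v j else deriv (v (j - m))"]
      allI impI)
    show "smooth_fun (2 * m) (total_diff m F)" using F by (rule smooth_fun_total_diff)
    show "smooth_real (if j < m then v j else deriv (v (j - m)))" if "j < 2 * m" for j
      using that v smooth_real_deriv by auto
    show "(u has_real_derivative (\<lambda>t. total_diff m F (\<lambda>j\<in>{..<2 * m}.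
        (if j < m then v j else deriv (v (j - m))) t)) x) (at x)" for x
      using smooth_fun_chain_total_diff[OF F, of v "\<lambda>j. deriv (v j) x" x] smooth_real_has_deriv[OF v]
      by (auto simp: u if_distrib[of "\<lambda>f. f _"] cong: if_cong)
  qed simp
qed (use assms in blast)

text \<open>Links the two notions of smoothness, so that the functions built on the real line below
  act as unary operations on C^\<infinity>-rings.\<close>

lemma smooth_fun_1:
  assumes "smooth_real u"
  shows "smooth_fun 1 (\<lambda>x. u (x 0))"
proof -
  have "C_fun k 1 (\<lambda>x. u (x 0))" for k
    using assms
  proof (induction k arbitrary: u)
    have c: "continuous_map (product_topology (\<lambda>_. euclideanreal) {..<1::nat}) euclideanreal (\<lambda>x. u (x 0))"
      if "smooth_real u" for u
    proof -
      have "continuous_map euclideanreal euclideanreal u"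
        using DERIV_isCont[OF smooth_real_has_deriv[OF that]]
        by (simp add: continuous_on_eq_continuous_at)
      from continuous_map_compose[OF continuous_map_product_coordinates[of 0 "{..<1::nat}" "\<lambda>_. euclideanreal"] this]
      show ?thesis by (simp only: o_def lessThan_iff zero_less_one True_implies_equals)
    qed
    case 0
    then show ?case using c by simp
    case (Suc k u)
    show ?case
      by (rule C_fun_SucI[where g = "\<lambda>i x. deriv u (x 0)"])
         (use Suc c smooth_real_deriv smooth_real_has_deriv in \<open>auto simp del: C_fun.simps\<close>)
  qed
  then show ?thesis by (simp add: smooth_fun_def)
qed

lemma smooth_real_compose:
  assumes "smooth_real u" "smooth_real v"
  shows "smooth_real (\<lambda>t. u (v t))"
  using smooth_real_comp[OF smooth_fun_1[OF assms(1)], of "\<lambda>_. v"] assms(2) by simp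

lemma smooth_real_const: "smooth_real (\<lambda>t. c)"
  using smooth_real_comp[OF smooth_fun_const[of 0]] by simp

lemma smooth_real_add: "smooth_real u \<Longrightarrow> smooth_real v \<Longrightarrow> smooth_real (\<lambda>t. u t + v t)"
  and smooth_real_mult: "smooth_real u \<Longrightarrow> smooth_real v \<Longrightarrow> smooth_real (\<lambda>t. u t * v t)"
proof -
  have *: "smooth_fun 2 (\<lambda>x. x 0 + x 1)" "smooth_fun 2 (\<lambda>x. x 0 * x 1)"
    by (auto intro!: smooth_fun_add smooth_fun_mult smooth_fun_proj)
  assume "smooth_real u" "smooth_real v"
  with *[THEN smooth_real_comp, of "\<lambda>i. if i = 0 then u else v"]
  show "smooth_real (\<lambda>t. u t + v t)" "smooth_real (\<lambda>t. u t * v t)"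
    by auto
qed

lemma smooth_real_id: "smooth_real (\<lambda>t. t)"
proof (rule smooth_real_coinduct[where K = "\<lambda>u. u = (\<lambda>t. t) \<or> (\<exists>c. u = (\<lambda>t. c))"])
  fix u :: "real \<Rightarrow> real" assume "u = (\<lambda>t. t) \<or> (\<exists>c. u = (\<lambda>t. c))"
  then show "\<exists>u'. (\<forall>x. (u has_real_derivative u' x) (at x)) \<and> (u' = (\<lambda>t. t) \<or> (\<exists>c. u' = (\<lambda>t. c)))"
  proof (elim disjE exE)
    assume "u = (\<lambda>t. t)"
    then show ?thesis by (intro exI[of _ "\<lambda>_. 1"]) auto
  next
    fix c assume "u = (\<lambda>t. c)"
    then show ?thesis by (intro exI[of _ "\<lambda>_. 0"]) auto
  qed
qed auto

lemma smooth_real_diff: "smooth_real u \<Longrightarrow> smooth_real v \<Longrightarrow> smooth_real (\<lambda>t. u t - v t)"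
  using smooth_real_add[of u "\<lambda>t. (-1) * v t"] smooth_real_mult[OF smooth_real_const[of "-1"], of v]
  by simp

lemma smooth_real_divide:
  assumes "smooth_real v" "smooth_real u" "\<And>t. u t \<noteq> 0"
  shows "smooth_real (\<lambda>t. v t / u t)"
proof (rule smooth_real_coinduct[where K = "\<lambda>w. \<exists>v u. smooth_real v \<and> smooth_real u \<and>
    (\<forall>t. u t \<noteq> 0) \<and> w = (\<lambda>t. v t / u t)"])
  fix w assume "\<exists>v u. smooth_real v \<and> smooth_real u \<and> (\<forall>t. u t \<noteq> 0) \<and> w = (\<lambda>t. v t / u t)"
  then obtain v u where vu: "smooth_real v" "smooth_real u" "\<And>t. u t \<noteq> 0" "w = (\<lambda>t. v t / u t)"
    by blast
  show "\<exists>w'. (\<forall>x. (w has_real_derivative w' x) (at x)) \<and> (\<exists>v u. smooth_real v \<and> smooth_real u \<and>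
    (\<forall>t. u t \<noteq> 0) \<and> w' = (\<lambda>t. v t / u t))"
  proof (intro exI conjI allI)
    show "smooth_real (\<lambda>t. deriv v t * u t - v t * deriv u t)" "smooth_real (\<lambda>t. u t * u t)"
      by (intro smooth_real_diff smooth_real_mult smooth_real_deriv vu)+
    show "(w has_real_derivative
        (\<lambda>t. (deriv v t * u t - v t * deriv u t) / (u t * u t)) x) (at x)" for x
      unfolding vu(4) by (rule DERIV_divide) (use vu smooth_real_has_deriv in auto)
  qed (use vu in auto)
qed (use assms in blast)

lemmas smooth_real_intros =
  smooth_real_const smooth_real_id smooth_real_add smooth_real_mult smooth_real_diff

section \<open>Flat functions, bumps and cutoffs on the real line\<close>

definition exp_bump :: "real \<Rightarrow> real" where
  "exp_bump x = (if x > 0 then exp (- 1 / x) else 0)"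

lemma exp_bump_nonneg: "exp_bump x \<ge> 0"
  and exp_bump_eq_0_iff: "exp_bump x = 0 \<longleftrightarrow> x \<le> 0"
  by (auto simp: exp_bump_def)

lemma exp_bump_pos_iff: "exp_bump x > 0 \<longleftrightarrow> x > 0"
  by (simp add: exp_bump_def)

lemma poly_exp_decay: "((\<lambda>x::real. poly p x * exp (- x)) \<longlongrightarrow> 0) at_top"
proof -
  have "((\<lambda>x::real. \<Sum>i\<le>degree p. coeff p i * (x ^ i / exp x)) \<longlongrightarrow> (\<Sum>i\<le>degree p. coeff p i * 0)) at_top"
    by (intro tendsto_sum tendsto_mult tendsto_const tendsto_power_div_exp_0)
  moreover have "(\<Sum>i\<le>degree p. coeff p i * (x ^ i / exp x)) = poly p x * exp (- x)" for x
    by (simp add: poly_altdef exp_minus sum_distrib_right divide_inverse mult.assoc)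
  ultimately show ?thesis by simp
qed

text \<open>The class consists of the functions \<open>p(1/x) exp(-1/x)\<close> for
  \<open>x > 0\<close>, extended by zero, with \<open>p\<close> a polynomial. With
  \<open>y = 1/x\<close> the derivative is \<open>y^2 (p - p')(y) exp(-y)\<close>, again of this
  form.\<close>

lemma smooth_exp_bump: "smooth_real exp_bump"
proof -
  define u :: "real poly \<Rightarrow> real \<Rightarrow> real"
    where "u p x = (if x > 0 then poly p (inverse x) * exp (- inverse x) else 0)" for p x
  have D: "(u p has_real_derivative u ([:0, 0, 1:] * (p - pderiv p)) x) (at x)" for p x
  proof (cases x "0 :: real" rule: linorder_cases)
    case less
    have "((\<lambda>_. 0) has_real_derivative 0) (at x)" by simp
    then have "(u p has_real_derivative 0) (at x)"
      by (rule has_field_derivative_transform_within_open[where S = "{..<0}"])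
         (use less in \<open>auto simp: u_def\<close>)
    then show ?thesis using less by (simp add: u_def)
  next
    case greater
    have "((\<lambda>x. poly p (inverse x) * exp (- inverse x)) has_real_derivative
        u ([:0, 0, 1:] * (p - pderiv p)) x) (at x)"
      unfolding u_def using greater
      by (auto intro!: derivative_eq_intros DERIV_chain2[OF poly_DERIV]
          simp: algebra_simps power2_eq_square)
    then show ?thesis
      by (rule has_field_derivative_transform_within_open[where S = "{0<..}"])
         (use greater in \<open>auto simp: u_def\<close>)
  next
    case equal
    \<comment> \<open>The additional factor \<open>[:0, 1:]\<close> is the \<open>1/y\<close> of the
      difference quotient at 0.\<close>
    have "((\<lambda>y. poly ([:0, 1:] * p) (inverse y) * exp (- inverse y)) \<longlongrightarrow> 0) (at_right 0)"
      by (rule filterlim_compose[OF poly_exp_decay filterlim_inverse_at_top_right])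
    then have "((\<lambda>y. (u p y - u p 0) / (y - 0)) \<longlongrightarrow> 0) (at_right 0)"
      by (rule Lim_transform_eventually)
         (auto simp: u_def eventually_at_right_less field_simps intro!: eventually_at_rightI[of 0 1])
    moreover have "((\<lambda>y. (u p y - u p 0) / (y - 0)) \<longlongrightarrow> 0) (at_left 0)"
      by (rule Lim_transform_eventually[OF tendsto_const])
         (auto simp: u_def intro!: eventually_at_leftI[of "-1" 0])
    ultimately have "((\<lambda>y. (u p y - u p 0) / (y - 0)) \<longlongrightarrow> 0) (at 0)"
      by (rule filterlim_split_at[rotated])
    then show ?thesis
      using equal by (simp add: has_field_derivative_iff u_def)
  qed
  have "exp_bump = u 1"
    by (auto simp: exp_bump_def u_def fun_eq_iff inverse_eq_divide)
  then show ?thesis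
    by (intro smooth_real_coinduct[where K = "\<lambda>w. \<exists>p. w = u p"]) (use D in blast)+
qed

lemma smooth_bump:
  fixes r :: real
  assumes "open W" "r \<in> W"
  obtains u where "smooth_real u" "u r \<noteq> 0" "\<And>x. u x \<noteq> 0 \<Longrightarrow> x \<in> W"
proof -
  obtain e where e: "e > 0" "ball r e \<subseteq> W"
    using assms by (auto simp: open_contains_ball)
  show ?thesis
  proof
    show "smooth_real (\<lambda>t. exp_bump (e * e - (t - r) * (t - r)))"
      by (intro smooth_real_intros smooth_real_compose[OF smooth_exp_bump])
    show "exp_bump (e * e - (r - r) * (r - r)) \<noteq> 0"
      using mult_pos_pos[OF e(1) e(1)] by (simp add: exp_bump_eq_0_iff)
    fix x assume "exp_bump (e * e - (x - r) * (x - r)) \<noteq> 0"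
    then have "(x - r)\<^sup>2 < e\<^sup>2" by (simp add: exp_bump_eq_0_iff power2_eq_square)
    then have "\<bar>x - r\<bar> < e" using e(1) power_mono[of e "\<bar>x - r\<bar>" 2] by fastforce
    then show "x \<in> W" using e(2) by (auto simp: dist_real_def)
  qed
qed

text \<open>The usual smooth transition, from 0 up to 1/4 to 1 from 1/2 on. Both thresholds lie
  strictly between 0 and 1, so it is constant near 0 and near 1: products with it can be extended by
  zero, and do not change a function near a point normalised to 1.\<close>

definition smooth_step :: "real \<Rightarrow> real" where
  "smooth_step t = exp_bump (t - 1/4) / (exp_bump (t - 1/4) + exp_bump (1/2 - t))"

lemma exp_bump_sum_pos: "exp_bump (t - 1/4) + exp_bump (1/2 - t) > 0"
  using exp_bump_nonneg[of "t - 1/4"] exp_bump_nonneg[of "1/2 - t"]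
    exp_bump_pos_iff[of "t - 1/4"] exp_bump_pos_iff[of "1/2 - t"]
  by (cases "t > 1/4") linarith+

lemma smooth_smooth_step: "smooth_real smooth_step"
proof -
  have "exp_bump (t - 1/4) + exp_bump (1/2 - t) \<noteq> 0" for t
    using exp_bump_sum_pos[of t] by simp
  then show ?thesis
    unfolding smooth_step_def
    by (intro smooth_real_divide smooth_real_intros smooth_real_compose[OF smooth_exp_bump])
qed

lemma smooth_step_eq_0: "t \<le> 1/4 \<Longrightarrow> smooth_step t = 0"
  and smooth_step_eq_1: "t \<ge> 1/2 \<Longrightarrow> smooth_step t = 1"
  using exp_bump_eq_0_iff[of "t - 1/4"] exp_bump_eq_0_iff[of "1/2 - t"]
  by (auto simp: smooth_step_def)

lemma smooth_step_range: "0 \<le> smooth_step t" "smooth_step t \<le> 1"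
  using exp_bump_sum_pos[of t] exp_bump_nonneg[of "t - 1/4"] exp_bump_nonneg[of "1/2 - t"]
  by (auto simp: smooth_step_def)

text \<open>Rescaling by \<open>1 / r\<close> moves \<open>r\<close> to 1. There \<open>m\<close>, a
  mixture of \<open>u\<close> and 1 weighted by \<open>smooth_step\<close>, is positive everywhere
  and equals \<open>u\<close> from 1/2 on, so its reciprocal yields \<open>k\<close>; the bump
  \<open>c\<close> lives where the rescaled argument exceeds 1/2. The last conclusion is a global
  identity of functions, and so can be transferred to rings.\<close>

lemma smooth_local_inverse:
  fixes r :: real
  assumes "r \<noteq> 0"
  obtains c k where "smooth_real c" "smooth_real k" "c r \<noteq> 0" "\<And>y. c y \<noteq> 0 \<Longrightarrow> y \<noteq> 0"
    "\<And>y. c y * (y * k y) = c y"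
proof
  define m where "m u = smooth_step u * u + (1 - smooth_step u)" for u
  have m: "m u > 0" for u
  proof (cases "u > 1/4")
    case True
    then have "smooth_step u * u + (1 - smooth_step u) * 1 > 0"
      using smooth_step_range[of u] by (cases "smooth_step u = 0") (auto intro: add_pos_nonneg)
    then show ?thesis by (simp add: m_def)
  qed (simp add: m_def smooth_step_eq_0)
  have sm: "smooth_real m"
    unfolding m_def by (intro smooth_real_intros smooth_smooth_step)
  show "smooth_real (\<lambda>y. exp_bump ((1 / r) * y - 1/2))"
    by (intro smooth_real_intros smooth_real_compose[OF smooth_exp_bump])
  have "m t \<noteq> 0" for t using m[of t] by simp
  then show "smooth_real (\<lambda>y. (1 / r) / m ((1 / r) * y))"
    by (intro smooth_real_divide smooth_real_intros smooth_real_compose[OF sm])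
  show "exp_bump ((1 / r) * r - 1/2) \<noteq> 0"
    using assms by (simp add: exp_bump_eq_0_iff)
  show "y \<noteq> 0" if "exp_bump ((1 / r) * y - 1/2) \<noteq> 0" for y
    using that by (auto simp: exp_bump_eq_0_iff)
  show "exp_bump ((1 / r) * y - 1/2) * (y * ((1 / r) / m ((1 / r) * y))) = exp_bump ((1 / r) * y - 1/2)"
    for y
  proof (cases "(1 / r) * y > 1/2")
    case True
    then have "m ((1 / r) * y) = (1 / r) * y" "y \<noteq> 0"
      by (auto simp: m_def smooth_step_eq_1)
    then show ?thesis using assms by simp
  next
    case False
    then have "exp_bump ((1 / r) * y - 1/2) = 0"
      by (simp only: exp_bump_eq_0_iff)
    then show ?thesis by (simp only: mult_zero_left)
  qed
qed

text \<open>Agreement near \<open>t\<close> is also agreement near every point close to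
  \<open>t\<close>, hence it passes to derivatives, and being locally smooth is preserved by
  differentiation.\<close>

lemma smooth_real_local:
  assumes "\<And>t. \<exists>v. smooth_real v \<and> (\<forall>\<^sub>F s in nhds t. w s = v s)"
  shows "smooth_real w"
proof (rule smooth_real_coinduct[where K = "\<lambda>w. \<forall>t. \<exists>v. smooth_real v \<and> (\<forall>\<^sub>F s in nhds t. w s = v s)"])
  fix w :: "real \<Rightarrow> real" assume w: "\<forall>t. \<exists>v. smooth_real v \<and> (\<forall>\<^sub>F s in nhds t. w s = v s)"
  have D: "(w has_real_derivative deriv v t) (at t)"
    if "smooth_real v" "\<forall>\<^sub>F s in nhds t. w s = v s" for v t
    using DERIV_cong_ev[OF HOL.refl that(2) HOL.refl] smooth_real_has_deriv[OF that(1)] by simp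
  have D': "deriv w t = deriv v t" if "smooth_real v" "\<forall>\<^sub>F s in nhds t. w s = v s" for v t
    by (rule DERIV_imp_deriv[OF D[OF that]])
  show "\<exists>w'. (\<forall>x. (w has_real_derivative w' x) (at x)) \<and>
      (\<forall>t. \<exists>v. smooth_real v \<and> (\<forall>\<^sub>F s in nhds t. w' s = v s))"
  proof (rule exI[of _ "deriv w"], intro conjI allI)
    fix t
    obtain v where v: "smooth_real v" "\<forall>\<^sub>F s in nhds t. w s = v s" using w by blast
    show "(w has_real_derivative deriv w t) (at t)"
      using D[OF v] D'[OF v] by simp
    have "\<forall>\<^sub>F s in nhds t. \<forall>\<^sub>F s in nhds s. w s = v s"
      using v(2) by (simp add: eventually_eventually)
    then have "\<forall>\<^sub>F s in nhds t. deriv w s = deriv v s"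
      by (rule eventually_mono) (rule D'[OF v(1)])
    then show "\<exists>v. smooth_real v \<and> (\<forall>\<^sub>F s in nhds t. deriv w s = v s)"
      using smooth_real_deriv[OF v(1)] by blast
  qed
qed (use assms in blast)

text \<open>Convenient smoothness is tested on curves defined on the whole line. Precomposing with
  \<open>p\<close> forces a curve that is in an open set only near \<open>a\<close> to stay there,
  without changing it near \<open>a\<close>. The cutoff makes \<open>p\<close> constant away from
  \<open>a\<close>.\<close>

lemma smooth_reparametrization:
  fixes a e :: real
  assumes "e > 0"
  obtains p where "smooth_real p" "\<And>t. \<bar>p t - a\<bar> < e" "\<forall>\<^sub>F t in nhds a. p t = t"
proof
  let ?q = "\<lambda>t. 1 - (1 / (e * e)) * ((t - a) * (t - a))"
  let ?p = "\<lambda>t. a + (t - a) * smooth_step (?q t)"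
  show "smooth_real ?p"
    by (intro smooth_real_intros smooth_real_compose[OF smooth_smooth_step])
  show "\<bar>?p t - a\<bar> < e" for t
  proof (cases "?q t \<le> 1/4")
    case True
    then show ?thesis using assms by (simp add: smooth_step_eq_0)
  next
    case False
    then have "(1 / (e * e)) * ((t - a) * (t - a)) < 1" by linarith
    then have "(t - a) * (t - a) / (e * e) < 1" by simp
    then have "(t - a)\<^sup>2 < e\<^sup>2"
      using mult_pos_pos[OF assms assms] by (simp only: divide_less_eq_1_pos power2_eq_square)
    then have "\<bar>t - a\<bar> < e" using assms power_mono[of e "\<bar>t - a\<bar>" 2] by fastforce
    moreover have "\<bar>(t - a) * smooth_step (?q t)\<bar> \<le> \<bar>t - a\<bar> * 1"
      unfolding abs_mult using smooth_step_range[of "?q t"] by (intro mult_left_mono) auto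
    ultimately show ?thesis by simp
  qed
  have "(?q \<longlongrightarrow> ?q a) (nhds a)"
    by (intro tendsto_intros filterlim_ident)
  then have "\<forall>\<^sub>F t in nhds a. ?q t > 1/2"
    by (rule order_tendstoD) simp
  then show "\<forall>\<^sub>F t in nhds a. ?p t = t"
    by (rule eventually_mono) (simp add: smooth_step_eq_1)
qed

section \<open>Elements of \<open>C\<^sup>\<infinity>\<close>-rings and their real points\<close>

text \<open>A nullary operation; \<open>\<lambda>_. undefined\<close> is the only element of the
  zeroth power \<open>{..<0} \<rightarrow>\<^sub>E elts A\<close>.\<close>

definition const_elt :: "'c Cinf_ring \<Rightarrow> real \<Rightarrow> 'c" where
  "const_elt A c = oper A 0 (\<lambda>_. c) (\<lambda>_. undefined)"

definition app_elt :: "'c Cinf_ring \<Rightarrow> (real \<Rightarrow> real) \<Rightarrow> 'c \<Rightarrow> 'c" where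
  "app_elt A u a = oper A 1 (\<lambda>x. u (x 0)) (\<lambda>i\<in>{..<1}. a)"

definition mult_elt :: "'c Cinf_ring \<Rightarrow> 'c \<Rightarrow> 'c \<Rightarrow> 'c" where
  "mult_elt A a b = oper A 2 (\<lambda>x. x 0 * x 1) (\<lambda>i\<in>{..<2}. if i = 0 then a else b)"

lemma smooth_fun_times: "smooth_fun 2 (\<lambda>x. x 0 * x 1)"
  by (auto intro!: smooth_fun_mult smooth_fun_proj)

lemma restrict_cong_less:
  "(\<And>i. i < n \<Longrightarrow> f i = g i) \<Longrightarrow> (\<lambda>i\<in>{..<n}. f i) = (\<lambda>i\<in>{..<n}. g i)"
  by (auto intro: restrict_ext)

lemma Cinf_hom_oper:
  "Cinf_hom A real_Cinf_ring \<phi> \<Longrightarrow> smooth_fun n f \<Longrightarrow> a \<in> {..<n} \<rightarrow>\<^sub>E elts A \<Longrightarrow>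
     \<phi> (oper A n f a) = f (\<lambda>i\<in>{..<n}. \<phi> (a i))"
  unfolding Cinf_hom_def by (simp add: real_Cinf_ring_def)

lemma Cinf_hom_const:
  assumes "Cinf_hom A real_Cinf_ring \<phi>"
  shows "\<phi> (const_elt A c) = c"
  unfolding const_elt_def by (subst Cinf_hom_oper[OF assms smooth_fun_const]) auto

lemma Cinf_hom_app:
  assumes "Cinf_hom A real_Cinf_ring \<phi>" "smooth_real u" "a \<in> elts A"
  shows "\<phi> (app_elt A u a) = u (\<phi> a)"
  unfolding app_elt_def by (subst Cinf_hom_oper[OF assms(1) smooth_fun_1[OF assms(2)]]) (use assms in auto)

lemma Cinf_hom_mult:
  assumes "Cinf_hom A real_Cinf_ring \<phi>" "a \<in> elts A" "b \<in> elts A"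
  shows "\<phi> (mult_elt A a b) = \<phi> a * \<phi> b"
  unfolding mult_elt_def by (subst Cinf_hom_oper[OF assms(1) smooth_fun_times]) (use assms in auto)

lemma real_pointsD: "\<phi> \<in> real_points A \<Longrightarrow> Cinf_hom A real_Cinf_ring \<phi>"
  by (simp add: real_points_def)

lemma real_points_eqI:
  "\<phi> \<in> real_points A \<Longrightarrow> \<psi> \<in> real_points A \<Longrightarrow> (\<And>a. a \<in> elts A \<Longrightarrow> \<phi> a = \<psi> a) \<Longrightarrow> \<phi> = \<psi>"
  unfolding real_points_def by (auto intro: extensionalityI)

section \<open>Germs, their values and the free ring\<close>

definition gen :: "'c \<Rightarrow> ('c + 'c \<Rightarrow> real) \<Rightarrow> real" where
  "gen c = (\<lambda>x. x (Inl c))"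

text \<open>The image of \<open>c\<close> in \<open>A[S^-1]\<close>; for
  \<open>S = nonvanishing A \<phi>\<close> it is the germ of \<open>c\<close> at
  \<open>\<phi>\<close>.\<close>

definition germ :: "'c Cinf_ring \<Rightarrow> 'c set \<Rightarrow> 'c \<Rightarrow> (('c + 'c \<Rightarrow> real) \<Rightarrow> real) set" where
  "germ A S c = loc_rel A S `` {gen c}"

text \<open>
  If \<open>\<phi>\<close> does not vanish on \<open>S\<close>, evaluation of representatives at \<open>point_eval \<phi>\<close> is the homomorphism
  \<open>A[S\<^sup>-\<^sup>1] \<rightarrow> \<real>\<close> induced by \<open>\<phi>\<close>. The coordinates \<open>Inr s\<close> with \<open>\<phi> s = 0\<close> are junk.
\<close>

definition point_eval :: "('c \<Rightarrow> real) \<Rightarrow> ('c + 'c \<Rightarrow> real)" where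
  "point_eval \<phi> = case_sum \<phi> (\<lambda>s. 1 / \<phi> s)"

definition germ_value :: "('c \<Rightarrow> real) \<Rightarrow> (('c + 'c \<Rightarrow> real) \<Rightarrow> real) set \<Rightarrow> real" where
  "germ_value \<phi> C = (SOME p. p \<in> C) (point_eval \<phi>)"

definition section_value :: "(('c \<Rightarrow> real) \<Rightarrow> (('c + 'c \<Rightarrow> real) \<Rightarrow> real) set) \<Rightarrow> ('c \<Rightarrow> real) \<Rightarrow> real"
  where "section_value s \<phi> = germ_value \<phi> (s \<phi>)"

lemma loc_free_gen:
  assumes "i \<in> elts A <+> S"
  shows "(\<lambda>x. x i) \<in> loc_free A S"
  unfolding loc_free_def mem_Collect_eq
  by (intro exI[of _ "1::nat"] exI[of _ "\<lambda>x. x 0"] exI[of _ "\<lambda>_. i"])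
     (use assms in \<open>auto intro: smooth_fun_proj\<close>)

text \<open>The arguments use finitely many generators each, but different ones. The union
  \<open>V\<close> of all of them is enumerated by \<open>e\<close>, and every argument is rewritten
  in these common coordinates through \<open>ix\<close>.\<close>

lemma loc_free_oper:
  assumes "smooth_fun n f" and p: "\<And>i. i < n \<Longrightarrow> p i \<in> loc_free A S"
  shows "(\<lambda>x. f (\<lambda>i\<in>{..<n}. p i x)) \<in> loc_free A S"
proof -
  have "\<forall>i. i < n \<longrightarrow> (\<exists>N F g. p i = (\<lambda>x. F (\<lambda>j\<in>{..<N}. x (g j))) \<and> smooth_fun N F \<and>
      g \<in> {..<N} \<rightarrow> elts A <+> S)"
    using p unfolding loc_free_def by blast
  then obtain N F G where p_eq: "\<And>i. i < n \<Longrightarrow> p i = (\<lambda>x. F i (\<lambda>j\<in>{..<N i}. x (G i j)))"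
    and F: "\<And>i. i < n \<Longrightarrow> smooth_fun (N i) (F i)"
    and G: "\<And>i. i < n \<Longrightarrow> G i \<in> {..<N i::nat} \<rightarrow> elts A <+> S"
    by metis
  define V where "V = (\<Union>i<n. G i ` {..<N i})"
  have "finite V" by (simp add: V_def)
  from ex_bij_betw_nat_finite[OF this]
  obtain e where e: "bij_betw e {0..<card V} V" by blast
  define ix where "ix v = inv_into {0..<card V} e v" for v
  have ix: "ix v < card V" "e (ix v) = v" if "v \<in> V" for v
    using e that inv_into_into[of v e "{0..<card V}"] f_inv_into_f[of v e "{0..<card V}"]
    by (auto simp: bij_betw_def ix_def)
  have mem: "G i j \<in> V" if "i < n" "j < N i" for i j
    using that by (auto simp: V_def)
  have eq: "(\<lambda>x. f (\<lambda>i\<in>{..<n}. p i x)) =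
      (\<lambda>x. (\<lambda>y. f (\<lambda>i\<in>{..<n}. F i (\<lambda>j\<in>{..<N i}. y (ix (G i j))))) (\<lambda>k\<in>{..<card V}. x (e k)))"
    by (intro ext arg_cong[where f = f] restrict_cong_less)
       (auto simp: p_eq ix mem intro!: arg_cong[where f = "F _"] restrict_cong_less)
  show ?thesis
    unfolding eq loc_free_def mem_Collect_eq
  proof (intro exI conjI)
    show "smooth_fun (card V) (\<lambda>y. f (\<lambda>i\<in>{..<n}. F i (\<lambda>j\<in>{..<N i}. y (ix (G i j)))))"
      by (intro smooth_fun_comp assms F smooth_fun_proj ix mem)
    show "e \<in> {..<card V} \<rightarrow> elts A <+> S"
    proof
      fix k assume "k \<in> {..<card V}"
      then have "e k \<in> V" using bij_betwE[OF e] by simp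
      then obtain i j where "i < n" "j < N i" "e k = G i j" by (auto simp: V_def)
      then show "e k \<in> elts A <+> S" using G[of i] by auto
    qed
  qed simp
qed

context
  fixes A :: "'c Cinf_ring"
  assumes A: "is_Cinf_ring A"
begin

lemma oper_closed: "smooth_fun n f \<Longrightarrow> a \<in> {..<n} \<rightarrow>\<^sub>E elts A \<Longrightarrow> oper A n f a \<in> elts A"
  and oper_proj: "i < n \<Longrightarrow> a \<in> {..<n} \<rightarrow>\<^sub>E elts A \<Longrightarrow> oper A n (\<lambda>x. x i) a = a i"
  and oper_comp: "smooth_fun m g \<Longrightarrow> (\<And>j. j < m \<Longrightarrow> smooth_fun n (h j)) \<Longrightarrow>
    a \<in> {..<n} \<rightarrow>\<^sub>E elts A \<Longrightarrow>
    oper A n (\<lambda>x. g (\<lambda>j\<in>{..<m}. h j x)) a = oper A m g (\<lambda>j\<in>{..<m}. oper A n (h j) a)"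
proof -
  note A' = A[unfolded is_Cinf_ring_def]
  show "smooth_fun n f \<Longrightarrow> a \<in> {..<n} \<rightarrow>\<^sub>E elts A \<Longrightarrow> oper A n f a \<in> elts A"
    using A'[THEN conjunct1] by blast
  show "i < n \<Longrightarrow> a \<in> {..<n} \<rightarrow>\<^sub>E elts A \<Longrightarrow> oper A n (\<lambda>x. x i) a = a i"
    using A'[THEN conjunct2, THEN conjunct1] by blast
  show "smooth_fun m g \<Longrightarrow> (\<And>j. j < m \<Longrightarrow> smooth_fun n (h j)) \<Longrightarrow> a \<in> {..<n} \<rightarrow>\<^sub>E elts A \<Longrightarrow>
    oper A n (\<lambda>x. g (\<lambda>j\<in>{..<m}. h j x)) a = oper A m g (\<lambda>j\<in>{..<m}. oper A n (h j) a)"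
    using A'[THEN conjunct2, THEN conjunct2, THEN conjunct1] by simp
qed

lemma const_elt_closed: "const_elt A c \<in> elts A"
  unfolding const_elt_def by (intro oper_closed smooth_fun_const) auto

lemma app_elt_closed: "smooth_real u \<Longrightarrow> a \<in> elts A \<Longrightarrow> app_elt A u a \<in> elts A"
  unfolding app_elt_def by (intro oper_closed smooth_fun_1) auto

lemma mult_elt_closed: "a \<in> elts A \<Longrightarrow> b \<in> elts A \<Longrightarrow> mult_elt A a b \<in> elts A"
  unfolding mult_elt_def by (intro oper_closed smooth_fun_times) auto

lemma app_elt_id: "a \<in> elts A \<Longrightarrow> app_elt A (\<lambda>t. t) a = a"
  unfolding app_elt_def by (subst oper_proj) auto

lemma app_elt_const: "a \<in> elts A \<Longrightarrow> app_elt A (\<lambda>t. c) a = const_elt A c"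
  using oper_comp[of 0 "\<lambda>_. c" 1 undefined "\<lambda>i\<in>{..<1}. a", OF smooth_fun_const]
  by (simp add: app_elt_def const_elt_def restrict_def[of _ "{}"])

text \<open>By the composition axiom, a product computed between functions on the line is the
  product computed in \<open>A\<close>. This transfers identities such as a vanishing product of
  bumps to arbitrary C^\<infinity>-rings.\<close>

lemma mult_app_elt:
  assumes "smooth_real u" "smooth_real v" "a \<in> elts A"
  shows "mult_elt A (app_elt A u a) (app_elt A v a) = app_elt A (\<lambda>t. u t * v t) a"
proof -
  let ?h = "\<lambda>j::nat. \<lambda>x::nat \<Rightarrow> real. if j = 0 then u (x 0) else v (x 0)"
  have "oper A 1 (\<lambda>x. (\<lambda>y. y 0 * y 1) (\<lambda>j\<in>{..<2}. ?h j x)) (\<lambda>i\<in>{..<1}. a) =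
      oper A 2 (\<lambda>x. x 0 * x 1) (\<lambda>j\<in>{..<2}. oper A 1 (?h j) (\<lambda>i\<in>{..<1}. a))"
  proof (rule oper_comp[OF smooth_fun_times])
    show "smooth_fun 1 (?h j)" for j
      by (cases "j = 0") (use smooth_fun_1[OF assms(1)] smooth_fun_1[OF assms(2)] in simp_all)
    show "(\<lambda>i\<in>{..<1}. a) \<in> {..<1} \<rightarrow>\<^sub>E elts A"
      using assms by simp
  qed
  moreover have "(\<lambda>j\<in>{..<2}. oper A 1 (?h j) (\<lambda>i\<in>{..<1}. a)) =
      (\<lambda>i\<in>{..<2}. if i = 0 then app_elt A u a else app_elt A v a)"
    by (intro restrict_cong_less) (auto simp: app_elt_def)
  ultimately show ?thesis
    unfolding mult_elt_def by (simp add: app_elt_def)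
qed

text \<open>Both elements are bumps of the rescaled \<open>a\<close>, one living above 1/2 and one
  below. Their product vanishes as a function of one variable and hence in \<open>A\<close> itself,
  so \<open>e\<close> has zero germ wherever \<open>d\<close> is nonzero, in particular at all zeros
  of \<open>a\<close>.\<close>

lemma separating_elts:
  assumes "\<phi> \<in> real_points A" "a \<in> elts A" "\<phi> a \<noteq> 0"
  obtains e d where "e \<in> elts A" "d \<in> elts A" "\<phi> e \<noteq> 0" "mult_elt A d e = const_elt A 0"
    "\<And>\<psi>. \<psi> \<in> real_points A \<Longrightarrow> \<psi> a = 0 \<Longrightarrow> \<psi> d \<noteq> 0"
proof
  let ?u = "\<lambda>t. exp_bump ((1 / \<phi> a) * t - 1/2)" and ?v = "\<lambda>t. exp_bump (1/2 - (1 / \<phi> a) * t)"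
  have s: "smooth_real ?u" "smooth_real ?v"
    by (intro smooth_real_intros smooth_real_compose[OF smooth_exp_bump])+
  show "app_elt A ?u a \<in> elts A" "app_elt A ?v a \<in> elts A"
    by (intro app_elt_closed s assms)+
  show "\<phi> (app_elt A ?u a) \<noteq> 0"
    unfolding Cinf_hom_app[OF real_pointsD[OF assms(1)] s(1) assms(2)]
    using assms by (simp add: exp_bump_eq_0_iff)
  have "(\<lambda>t. ?v t * ?u t) = (\<lambda>t. 0)"
    by (auto simp: exp_bump_eq_0_iff fun_eq_iff)
  then show "mult_elt A (app_elt A ?v a) (app_elt A ?u a) = const_elt A 0"
    using mult_app_elt[OF s(2,1) assms(2)] app_elt_const[OF assms(2)] by simp
  show "\<psi> (app_elt A ?v a) \<noteq> 0" if "\<psi> \<in> real_points A" "\<psi> a = 0" for \<psi>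
    unfolding Cinf_hom_app[OF real_pointsD[OF that(1)] s(2) assms(2)]
    using that by (simp add: exp_bump_eq_0_iff)
qed

section \<open>Germs in the localization\<close>

lemma loc_rel_free:
  assumes S: "S \<subseteq> elts A" and "(p, q) \<in> loc_rel A S"
  shows "p \<in> loc_free A S \<and> q \<in> loc_free A S"
  using assms(2)
proof induction
  case (cong n f p q)
  then show ?case by (auto intro!: loc_free_oper)
next
  case (hom n f b)
  then have "b i \<in> elts A" if "i < n" for i using that by auto
  then show ?case
    using hom oper_closed[of n f b] by (auto intro!: loc_free_oper loc_free_gen)
next
  case (inv s)
  \<comment> \<open>Both sides of the relation are written as operations, of arity 2 and 0, to make
    \<open>loc_free_oper\<close> applicable.\<close>
  have "(\<lambda>x. (\<lambda>y. y 0 * y 1) (\<lambda>i\<in>{..<2::nat}. (if i = 0 then \<lambda>x. x (Inl s) else (\<lambda>x. x (Inr s))) x))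
      \<in> loc_free A S"
    by (intro loc_free_oper smooth_fun_times) (use inv S in \<open>auto intro!: loc_free_gen\<close>)
  moreover have "(\<lambda>x. (\<lambda>y. 1) (\<lambda>i\<in>{..<0::nat}. undefined x)) \<in> loc_free A S"
    by (intro loc_free_oper smooth_fun_const) auto
  ultimately show ?case by simp
qed auto

lemma loc_rel_equiv: "S \<subseteq> elts A \<Longrightarrow> equiv (loc_free A S) (loc_rel A S)"
  by (rule equivI) (auto simp: refl_on_def dest: loc_rel_free
      intro: loc_rel.refl symI[OF loc_rel.sym] transI[OF loc_rel.trans])

text \<open>It suffices to check the generating relations: \<open>hom\<close> holds because
  \<open>\<phi>\<close> is a homomorphism, \<open>inv\<close> because \<open>\<phi>\<close> is
  nonzero on \<open>S\<close>. This makes \<open>germ_value\<close> independent of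
  representatives.\<close>

lemma loc_rel_eval:
  assumes "\<phi> \<in> real_points A" and "S \<subseteq> nonvanishing A \<phi>" and "(p, q) \<in> loc_rel A S"
  shows "p (point_eval \<phi>) = q (point_eval \<phi>)"
  using assms(3)
proof induction
  case (cong n f p q)
  then show ?case by (intro arg_cong[where f = f] restrict_cong_less) auto
next
  case (hom n f b)
  then show ?case
    using Cinf_hom_oper[OF real_pointsD[OF assms(1)] hom] by (simp add: point_eval_def)
next
  case (inv s)
  then show ?case using assms by (auto simp: point_eval_def nonvanishing_def)
qed auto

lemma loc_rel_mono:
  assumes "S \<subseteq> S'" "S' \<subseteq> elts A"
  shows "loc_rel A S \<subseteq> loc_rel A S'"
proof safe
  fix p q assume "(p, q) \<in> loc_rel A S"
  then show "(p, q) \<in> loc_rel A S'"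
  proof induction
    case (refl p)
    then obtain n f g where "smooth_fun n f" "g \<in> {..<n} \<rightarrow> elts A <+> S"
      "p = (\<lambda>x. f (\<lambda>i\<in>{..<n}. x (g i)))"
      unfolding loc_free_def by blast
    moreover have "elts A <+> S \<subseteq> elts A <+> S'" using assms(1) by auto
    with \<open>g \<in> {..<n} \<rightarrow> elts A <+> S\<close> have "g \<in> {..<n} \<rightarrow> elts A <+> S'" by blast
    ultimately have "p \<in> loc_free A S'" unfolding loc_free_def by blast
    then show ?case by (rule loc_rel.refl)
  qed (use assms in \<open>blast intro: loc_rel.intros\<close>)+
qed

lemma loc_rel_mult:
  assumes "(p, q) \<in> loc_rel A S" "(p', q') \<in> loc_rel A S"
  shows "(\<lambda>x. p x * p' x, \<lambda>x. q x * q' x) \<in> loc_rel A S"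
  using loc_rel.cong[OF smooth_fun_times,
      of "\<lambda>i. if i = 0 then p else p'" "\<lambda>i. if i = 0 then q else q'" A S] assms
  by simp

lemma loc_rel_oper:
  "smooth_fun n f \<Longrightarrow> b \<in> {..<n} \<rightarrow>\<^sub>E elts A \<Longrightarrow>
    (gen (oper A n f b), \<lambda>x. f (\<lambda>i\<in>{..<n}. gen (b i) x)) \<in> loc_rel A S"
  unfolding gen_def by (rule loc_rel.hom)

lemma loc_rel_mult_elt:
  assumes "a \<in> elts A" "b \<in> elts A"
  shows "(gen (mult_elt A a b), \<lambda>x. gen a x * gen b x) \<in> loc_rel A S"
proof -
  have "(\<lambda>i\<in>{..<2}. if i = 0 then a else b) \<in> {..<2::nat} \<rightarrow>\<^sub>E elts A"
    using assms by auto
  from loc_rel_oper[OF smooth_fun_times this, of S]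
  show ?thesis by (simp add: mult_elt_def)
qed

lemma loc_rel_const_elt: "(gen (const_elt A c), \<lambda>x. c) \<in> loc_rel A S"
  using loc_rel_oper[OF smooth_fun_const[of 0 c], of "\<lambda>_. undefined" S] by (simp add: const_elt_def)

lemma gen_free: "c \<in> elts A \<Longrightarrow> gen c \<in> loc_free A S"
  and inv_free: "s \<in> S \<Longrightarrow> (\<lambda>x. x (Inr s)) \<in> loc_free A S"
  unfolding gen_def by (auto intro!: loc_free_gen)

text \<open>Modulo the relation, \<open>c\<close> equals the formal inverse of \<open>e\<close>
  times \<open>e c\<close>. For a bump \<open>e\<close>, agreement after multiplication expresses
  local agreement in purely algebraic terms.\<close>

lemma loc_rel_cancel:
  assumes S: "S \<subseteq> elts A" and e: "e \<in> S" and c: "c \<in> elts A" "c' \<in> elts A"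
    and eq: "mult_elt A e c = mult_elt A e c'"
  shows "(gen c, gen c') \<in> loc_rel A S"
proof -
  have *: "(gen c, \<lambda>x. x (Inr e) * gen (mult_elt A e c) x) \<in> loc_rel A S" if "c \<in> elts A" for c
  proof -
    have "(\<lambda>x. x (Inr e) * gen (mult_elt A e c) x, \<lambda>x. x (Inr e) * (gen e x * gen c x)) \<in> loc_rel A S"
      using e S that by (intro loc_rel_mult loc_rel.refl inv_free loc_rel_mult_elt) auto
    moreover have "(\<lambda>x. x (Inl e) * x (Inr e) * gen c x, \<lambda>x. 1 * gen c x) \<in> loc_rel A S"
      using e S that by (intro loc_rel_mult loc_rel.refl loc_rel.inv gen_free) auto
    moreover have "(\<lambda>x. x (Inr e) * (gen e x * gen c x)) = (\<lambda>x. x (Inl e) * x (Inr e) * gen c x)"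
      by (auto simp: gen_def)
    ultimately show ?thesis
      by (auto intro: loc_rel.sym loc_rel.trans)
  qed
  show ?thesis
    using *[OF c(1)] *[OF c(2)] unfolding eq by (blast intro: loc_rel.sym loc_rel.trans)
qed

text \<open>Cancelling \<open>e\<close> shows that \<open>k\<close> is inverse to \<open>a\<close>
  modulo the relation, and inverses are unique.\<close>

lemma loc_rel_inverse:
  assumes S: "S \<subseteq> elts A" and "e \<in> S" "a \<in> S" and k: "k \<in> elts A"
    and eq: "mult_elt A e (mult_elt A a k) = mult_elt A e (const_elt A 1)"
  shows "(\<lambda>x. x (Inr a), gen k) \<in> loc_rel A S"
proof -
  have a: "a \<in> elts A" using assms by blast
  have "(gen (mult_elt A a k), gen (const_elt A 1)) \<in> loc_rel A S"
    by (rule loc_rel_cancel[OF S \<open>e \<in> S\<close> _ _ eq]) (intro mult_elt_closed const_elt_closed a k)+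
  then have 1: "(\<lambda>x. gen a x * gen k x, \<lambda>x. 1) \<in> loc_rel A S"
    using loc_rel_mult_elt[OF a k, of S] loc_rel_const_elt[of 1 S]
    by (blast intro: loc_rel.sym loc_rel.trans)
  have "(\<lambda>x. x (Inr a) * (gen a x * gen k x), \<lambda>x. x (Inr a) * 1) \<in> loc_rel A S"
    by (intro loc_rel_mult[OF loc_rel.refl 1] inv_free assms)
  moreover have "(\<lambda>x. x (Inl a) * x (Inr a) * gen k x, \<lambda>x. 1 * gen k x) \<in> loc_rel A S"
    by (intro loc_rel_mult loc_rel.refl loc_rel.inv gen_free assms)
  moreover have "(\<lambda>x. x (Inr a) * (gen a x * gen k x)) = (\<lambda>x. x (Inl a) * x (Inr a) * gen k x)"
    by (auto simp: gen_def)
  ultimately show ?thesis by (auto intro: loc_rel.sym loc_rel.trans)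
qed

lemma class_eqI: "S \<subseteq> elts A \<Longrightarrow> (p, q) \<in> loc_rel A S \<Longrightarrow> loc_rel A S `` {p} = loc_rel A S `` {q}"
  using equiv_class_eq[OF loc_rel_equiv] .

lemma germ_cancel:
  assumes "S \<subseteq> elts A" "e \<in> S" "c \<in> elts A" "c' \<in> elts A" "mult_elt A e c = mult_elt A e c'"
  shows "germ A S c = germ A S c'"
  unfolding germ_def by (rule class_eqI[OF assms(1) loc_rel_cancel[OF assms]])

text \<open>The operation is defined by choosing representatives; the congruence rule allows any
  others in their place.\<close>

lemma localization_oper:
  assumes S: "S \<subseteq> elts A" and f: "smooth_fun n f"
    and p: "\<And>i. i < n \<Longrightarrow> p i \<in> loc_free A S" "\<And>i. i < n \<Longrightarrow> C i = loc_rel A S `` {p i}"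
  shows "oper (localization A S) n f C = loc_rel A S `` {\<lambda>x. f (\<lambda>i\<in>{..<n}. p i x)}"
proof -
  have "(p i, SOME q. q \<in> C i) \<in> loc_rel A S" if "i < n" for i
  proof -
    have "p i \<in> C i" using p[OF that] by (auto intro: loc_rel.refl)
    then have "(SOME q. q \<in> C i) \<in> C i" by (subst some_in_eq) blast
    then show ?thesis using p(2)[OF that] by auto
  qed
  then have "(\<lambda>x. f (\<lambda>i\<in>{..<n}. p i x), \<lambda>x. f (\<lambda>i\<in>{..<n}. (SOME q. q \<in> C i) x)) \<in> loc_rel A S"
    by (rule loc_rel.cong[OF f])
  from class_eqI[OF S this] show ?thesis by (simp add: localization_def)
qed

lemma germ_oper:
  assumes S: "S \<subseteq> elts A" and f: "smooth_fun n f" and a: "a \<in> {..<n} \<rightarrow>\<^sub>E elts A"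
  shows "oper (localization A S) n f (\<lambda>i\<in>{..<n}. germ A S (a i)) = germ A S (oper A n f a)"
proof -
  have "oper (localization A S) n f (\<lambda>i\<in>{..<n}. germ A S (a i)) =
      loc_rel A S `` {\<lambda>x. f (\<lambda>i\<in>{..<n}. gen (a i) x)}"
    by (rule localization_oper[OF S f]) (use a in \<open>auto intro!: gen_free simp: germ_def\<close>)
  also have "\<dots> = germ A S (oper A n f a)"
    unfolding germ_def by (intro class_eqI S loc_rel.sym[OF loc_rel_oper] f a)
  finally show ?thesis .
qed

lemma germ_value_class:
  assumes "\<phi> \<in> real_points A" "S \<subseteq> nonvanishing A \<phi>" "p \<in> loc_free A S"
  shows "germ_value \<phi> (loc_rel A S `` {p}) = p (point_eval \<phi>)"
proof -
  have "(SOME q. q \<in> loc_rel A S `` {p}) \<in> loc_rel A S `` {p}"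
    by (subst some_in_eq) (auto intro: loc_rel.refl assms)
  then show ?thesis
    using loc_rel_eval[OF assms(1,2), of p] by (auto simp: germ_value_def)
qed

lemma nonvanishing_subset: "nonvanishing A \<phi> \<subseteq> elts A"
  by (auto simp: nonvanishing_def)

lemma germ_value_germ:
  "\<phi> \<in> real_points A \<Longrightarrow> c \<in> elts A \<Longrightarrow> germ_value \<phi> (germ A (nonvanishing A \<phi>) c) = \<phi> c"
  unfolding germ_def by (simp add: germ_value_class gen_free) (simp add: gen_def point_eval_def)

lemma germ_in_stalk: "c \<in> elts A \<Longrightarrow> germ A (nonvanishing A \<phi>) c \<in> elts (stalk A \<phi>)"
  unfolding stalk_def localization_def germ_def by (auto intro!: quotientI gen_free)

lemma germ_value_oper:
  assumes \<phi>: "\<phi> \<in> real_points A" and f: "smooth_fun n f" and C: "C \<in> {..<n} \<rightarrow> elts (stalk A \<phi>)"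
  shows "germ_value \<phi> (oper (stalk A \<phi>) n f C) = f (\<lambda>i\<in>{..<n}. germ_value \<phi> (C i))"
proof -
  let ?S = "nonvanishing A \<phi>"
  have "\<forall>i. i < n \<longrightarrow> (\<exists>p\<in>loc_free A ?S. C i = loc_rel A ?S `` {p})"
    using C by (force simp: stalk_def localization_def quotient_def)
  then obtain p where p: "\<And>i. i < n \<Longrightarrow> p i \<in> loc_free A ?S" "\<And>i. i < n \<Longrightarrow> C i = loc_rel A ?S `` {p i}"
    by metis
  have "oper (stalk A \<phi>) n f C = loc_rel A ?S `` {\<lambda>x. f (\<lambda>i\<in>{..<n}. p i x)}"
    unfolding stalk_def by (rule localization_oper[OF nonvanishing_subset f p])
  then have "germ_value \<phi> (oper (stalk A \<phi>) n f C) = f (\<lambda>i\<in>{..<n}. p i (point_eval \<phi>))"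
    using germ_value_class[OF \<phi> order_refl loc_free_oper[OF f p(1)]] by simp
  also have "\<dots> = f (\<lambda>i\<in>{..<n}. germ_value \<phi> (C i))"
    by (intro arg_cong[where f = f] restrict_cong_less)
       (use p germ_value_class[OF \<phi> order_refl] in auto)
  finally show ?thesis .
qed

text \<open>
  Near \<open>\<phi>\<close>, the inverse of \<open>a\<close> is \<open>\<kappa>(a)\<close> for any smooth \<open>\<kappa>: \<real> \<rightarrow> \<real>\<close> with \<open>\<kappa>(y) = 1/y\<close> near
  \<open>\<phi>(a)\<close>. Therefore elements of \<open>A[a\<^sup>-\<^sup>1]\<close> have the same germs as elements of \<open>A\<close>.
\<close>

lemma localization_locally_germ:
  assumes \<phi>: "\<phi> \<in> real_points A" and a: "a \<in> elts A" "\<phi> a \<noteq> 0" and t: "t \<in> elts (localization A {a})"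
  obtains c e where "c \<in> elts A" "e \<in> elts A" "\<phi> \<in> basic_open A e" "basic_open A e \<subseteq> basic_open A a"
    "\<And>\<psi>. \<psi> \<in> basic_open A e \<Longrightarrow>
      loc_map A (nonvanishing A \<psi>) t = germ A (nonvanishing A \<psi>) c"
proof -
  obtain p where p: "p \<in> loc_free A {a}" "t = loc_rel A {a} `` {p}"
    using t by (auto simp: localization_def quotient_def)
  then obtain n f g where f: "smooth_fun n f" and g: "g \<in> {..<n} \<rightarrow> elts A <+> {a}"
    and p_eq: "p = (\<lambda>x. f (\<lambda>i\<in>{..<n}. x (g i)))"
    unfolding loc_free_def by blast
  obtain u k where u: "smooth_real u" and k: "smooth_real k" and "u (\<phi> a) \<noteq> 0"
    and u0: "\<And>y. u y \<noteq> 0 \<Longrightarrow> y \<noteq> 0" and uk: "\<And>y. u y * (y * k y) = u y"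
    by (rule smooth_local_inverse[OF a(2)]) blast
  define e where "e = app_elt A u a"
  \<comment> \<open>A representative is a smooth function of elements of \<open>A\<close> and of the
    formal inverse of \<open>a\<close>. Substituting \<open>app_elt A k a\<close> for the latter
    leaves an expression in \<open>A\<close>, of which \<open>oper A n f b\<close> is the
    value.\<close>
  define b where "b = (\<lambda>i\<in>{..<n}. case g i of Inl b \<Rightarrow> b | Inr _ \<Rightarrow> app_elt A k a)"
  have ka: "app_elt A k a \<in> elts A" and e: "e \<in> elts A"
    unfolding e_def by (intro app_elt_closed k u a)+
  have b: "b \<in> {..<n} \<rightarrow>\<^sub>E elts A"
    using g ka by (force simp: b_def PiE_iff Pi_iff split: sum.split)
  have "mult_elt A e (mult_elt A a (app_elt A k a)) = app_elt A (\<lambda>y. u y * (y * k y)) a"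
    unfolding e_def using mult_app_elt[OF smooth_real_id k a(1)]
      mult_app_elt[OF u smooth_real_mult[OF smooth_real_id k] a(1)] app_elt_id[OF a(1)] by simp
  also have "\<dots> = app_elt A (\<lambda>y. u y * 1) a" by (simp add: uk)
  also have "\<dots> = mult_elt A e (const_elt A 1)"
    unfolding e_def using mult_app_elt[OF u smooth_real_const a(1), of 1] app_elt_const[OF a(1)] by simp
  finally have eq: "mult_elt A e (mult_elt A a (app_elt A k a)) = mult_elt A e (const_elt A 1)" .
  have ea: "\<psi> e = u (\<psi> a)" if "\<psi> \<in> real_points A" for \<psi>
    unfolding e_def by (rule Cinf_hom_app[OF real_pointsD[OF that] u a(1)])
  show ?thesis
  proof
    show "oper A n f b \<in> elts A" by (rule oper_closed[OF f b])
    show "e \<in> elts A" by fact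
    show "\<phi> \<in> basic_open A e"
      using \<phi> ea \<open>u (\<phi> a) \<noteq> 0\<close> by (simp add: basic_open_def)
    show "basic_open A e \<subseteq> basic_open A a"
      using ea u0 by (auto simp: basic_open_def)
    fix \<psi> assume \<psi>: "\<psi> \<in> basic_open A e"
    let ?S = "nonvanishing A \<psi>"
    have S: "?S \<subseteq> elts A" "a \<in> ?S" "e \<in> ?S"
      using \<psi> ea u0 a e by (auto simp: nonvanishing_def basic_open_def)
    have g_b: "(\<lambda>x. x (g i), gen (b i)) \<in> loc_rel A ?S" if "i < n" for i
    proof (cases "g i")
      case (Inl y)
      then have "y \<in> elts A" using g that by (force simp: Pi_iff)
      then show ?thesis
        using Inl that gen_free[of y ?S] by (auto simp: b_def gen_def intro!: loc_rel.refl)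
    next
      case (Inr y)
      then have "y = a" using g that by (force simp: Pi_iff)
      then show ?thesis
        using Inr that loc_rel_inverse[OF S(1,3,2) ka eq] by (simp add: b_def)
    qed
    have "(p, \<lambda>x. f (\<lambda>i\<in>{..<n}. gen (b i) x)) \<in> loc_rel A ?S"
      unfolding p_eq by (rule loc_rel.cong[OF f g_b])
    then have pc: "(p, gen (oper A n f b)) \<in> loc_rel A ?S"
      by (rule loc_rel.trans) (rule loc_rel.sym[OF loc_rel_oper[OF f b]])
    have "loc_map A ?S t = loc_rel A ?S `` {p}"
    proof
      show "loc_map A ?S t \<subseteq> loc_rel A ?S `` {p}"
        unfolding loc_map_def p(2) using loc_rel_mono[of "{a}" ?S] S by (auto intro: loc_rel.trans)
      show "loc_rel A ?S `` {p} \<subseteq> loc_map A ?S t"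
        unfolding loc_map_def p(2) using p(1) by (auto intro: loc_rel.refl)
    qed
    also have "\<dots> = germ A ?S (oper A n f b)"
      unfolding germ_def by (rule class_eqI[OF S(1) pc])
    finally show "loc_map A ?S t = germ A ?S (oper A n f b)" .
  qed
qed

section \<open>The spectrum\<close>

lemma basic_open_mult:
  "a \<in> elts A \<Longrightarrow> b \<in> elts A \<Longrightarrow> basic_open A (mult_elt A a b) = basic_open A a \<inter> basic_open A b"
  by (auto simp: basic_open_def Cinf_hom_mult[OF real_pointsD])

lemma basic_open_const: "c \<noteq> 0 \<Longrightarrow> basic_open A (const_elt A c) = real_points A"
  by (auto simp: basic_open_def Cinf_hom_const[OF real_pointsD])

text \<open>Products show that the sets \<open>basic_open A a\<close> are closed under intersection,
  so the subbasis is a basis.\<close>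

lemma openin_Spec:
  "openin (underlying (Spec A)) V \<longleftrightarrow>
     V \<subseteq> real_points A \<and> (\<forall>\<phi>\<in>V. \<exists>a\<in>elts A. \<phi> \<in> basic_open A a \<and> basic_open A a \<subseteq> V)"
    (is "_ \<longleftrightarrow> ?R V")
proof
  assume "openin (underlying (Spec A)) V"
  then have "generate_topology_on (basic_open A ` elts A) V"
    by (simp add: Spec_def openin_topology_generated_by_iff)
  then show "?R V"
  proof induction
    case (Int U V)
    show ?case
    proof (intro conjI ballI)
      fix \<phi> assume "\<phi> \<in> U \<inter> V"
      with Int obtain a b where "a \<in> elts A" "\<phi> \<in> basic_open A a" "basic_open A a \<subseteq> U"
        "b \<in> elts A" "\<phi> \<in> basic_open A b" "basic_open A b \<subseteq> V"
        by (meson IntD1 IntD2)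
      then show "\<exists>a\<in>elts A. \<phi> \<in> basic_open A a \<and> basic_open A a \<subseteq> U \<inter> V"
        by (intro bexI[of _ "mult_elt A a b"]) (auto simp: basic_open_mult mult_elt_closed)
    qed (use Int in auto)
  next
    case (UN K)
    show ?case
    proof (intro conjI ballI)
      show "\<Union>K \<subseteq> real_points A" using UN by blast
      fix \<phi> assume "\<phi> \<in> \<Union>K"
      then obtain U where U: "U \<in> K" "\<phi> \<in> U" by blast
      with UN obtain a where "a \<in> elts A" "\<phi> \<in> basic_open A a" "basic_open A a \<subseteq> U" by blast
      with U show "\<exists>a\<in>elts A. \<phi> \<in> basic_open A a \<and> basic_open A a \<subseteq> \<Union>K" by blast
    qed
  qed (auto simp: basic_open_def)
next
  assume R: "?R V"
  then have "V = \<Union> {basic_open A a | a. a \<in> elts A \<and> basic_open A a \<subseteq> V}"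
    by blast
  also have "openin (underlying (Spec A)) \<dots>"
    by (intro openin_Union) (auto simp: Spec_def intro: topology_generated_by_Basis)
  finally show "openin (underlying (Spec A)) V" .
qed

lemma topspace_Spec: "topspace (underlying (Spec A)) = real_points A"
proof
  show "topspace (underlying (Spec A)) \<subseteq> real_points A"
    using iffD1[OF openin_Spec openin_topspace] by (rule conjunct1)
  have "openin (underlying (Spec A)) (real_points A)"
    unfolding openin_Spec using basic_open_const[of 1] const_elt_closed[of 1] by auto
  then show "real_points A \<subseteq> topspace (underlying (Spec A))"
    by (rule openin_subset)
qed

lemma openin_basic_open: "a \<in> elts A \<Longrightarrow> openin (underlying (Spec A)) (basic_open A a)"
  unfolding openin_Spec by (auto simp: basic_open_def)

lemma Spec_section_locally_germ:
  assumes "s \<in> elts (Spec_sections A V)" "\<phi> \<in> V"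
  obtains c e where "c \<in> elts A" "e \<in> elts A" "\<phi> \<in> basic_open A e" "basic_open A e \<subseteq> V"
    "\<And>\<psi>. \<psi> \<in> basic_open A e \<Longrightarrow> s \<psi> = germ A (nonvanishing A \<psi>) c"
proof -
  have "\<exists>a\<in>elts A. \<phi> \<in> basic_open A a \<and> basic_open A a \<subseteq> V \<and>
      (\<exists>t\<in>elts (localization A {a}). \<forall>\<psi>\<in>basic_open A a. s \<psi> = loc_map A (nonvanishing A \<psi>) t)"
    using assms by (simp add: Spec_sections_def)
  then obtain a t where a: "a \<in> elts A" "\<phi> \<in> basic_open A a" "basic_open A a \<subseteq> V"
    and t: "t \<in> elts (localization A {a})"
    and s: "\<And>\<psi>. \<psi> \<in> basic_open A a \<Longrightarrow> s \<psi> = loc_map A (nonvanishing A \<psi>) t"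
    by blast
  have "\<phi> \<in> real_points A" "\<phi> a \<noteq> 0" using a by (auto simp: basic_open_def)
  from localization_locally_germ[OF this(1) a(1) this(2) t]
  obtain c e where "c \<in> elts A" "e \<in> elts A" "\<phi> \<in> basic_open A e" "basic_open A e \<subseteq> basic_open A a"
    "\<And>\<psi>. \<psi> \<in> basic_open A e \<Longrightarrow> loc_map A (nonvanishing A \<psi>) t = germ A (nonvanishing A \<psi>) c"
    by blast
  with a(3) s show ?thesis by (intro that[of c e]) auto
qed

text \<open>An element \<open>c\<close> gives an element of \<open>A[e^-1]\<close> that induces its
  germs on the basic open set of \<open>e\<close>. Together with
  \<open>Spec_section_locally_germ\<close>, sections can from here on be treated without
  denominators.\<close>

lemma Spec_sectionI:
  assumes "s \<in> extensional V"
    and s: "\<And>\<phi>. \<phi> \<in> V \<Longrightarrow> \<exists>c\<in>elts A. \<exists>e\<in>elts A. \<phi> \<in> basic_open A e \<and> basic_open A e \<subseteq> V \<and>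
      (\<forall>\<psi>\<in>basic_open A e. s \<psi> = germ A (nonvanishing A \<psi>) c)"
  shows "s \<in> elts (Spec_sections A V)"
proof -
  have "\<exists>a\<in>elts A. \<phi> \<in> basic_open A a \<and> basic_open A a \<subseteq> V \<and> s \<phi> \<in> elts (stalk A \<phi>) \<and>
      (\<exists>t\<in>elts (localization A {a}). \<forall>\<psi>\<in>basic_open A a. s \<psi> = loc_map A (nonvanishing A \<psi>) t)"
    if \<phi>: "\<phi> \<in> V" for \<phi>
  proof -
    obtain c e where ce: "c \<in> elts A" "e \<in> elts A" "\<phi> \<in> basic_open A e" "basic_open A e \<subseteq> V"
      "\<And>\<psi>. \<psi> \<in> basic_open A e \<Longrightarrow> s \<psi> = germ A (nonvanishing A \<psi>) c"
      using s[OF \<phi>] by blast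
    have "loc_map A (nonvanishing A \<psi>) (loc_rel A {e} `` {gen c}) = germ A (nonvanishing A \<psi>) c"
      if "\<psi> \<in> basic_open A e" for \<psi>
    proof
      show "loc_map A (nonvanishing A \<psi>) (loc_rel A {e} `` {gen c}) \<subseteq> germ A (nonvanishing A \<psi>) c"
        unfolding loc_map_def germ_def
        using loc_rel_mono[of "{e}" "nonvanishing A \<psi>"] that ce(2) nonvanishing_subset
        by (auto simp: nonvanishing_def basic_open_def intro: loc_rel.trans)
      show "germ A (nonvanishing A \<psi>) c \<subseteq> loc_map A (nonvanishing A \<psi>) (loc_rel A {e} `` {gen c})"
        unfolding loc_map_def germ_def using gen_free[OF ce(1)] by (auto intro: loc_rel.refl)
    qed
    moreover have "loc_rel A {e} `` {gen c} \<in> elts (localization A {e})"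
      by (auto simp: localization_def intro!: quotientI gen_free ce)
    ultimately show ?thesis
      using ce germ_in_stalk by (intro bexI[of _ e]) auto
  qed
  then show ?thesis
    using assms(1) unfolding Spec_sections_def Cinf_ring.simps mem_Collect_eq PiE_iff by blast
qed

lemma germ_section:
  assumes V: "openin (underlying (Spec A)) V" and c: "c \<in> elts A"
  shows "(\<lambda>\<phi>\<in>V. germ A (nonvanishing A \<phi>) c) \<in> elts (Spec_sections A V)"
proof (rule Spec_sectionI)
  fix \<phi> assume "\<phi> \<in> V"
  then obtain e where e: "e \<in> elts A" "\<phi> \<in> basic_open A e" "basic_open A e \<subseteq> V"
    using V unfolding openin_Spec by blast
  then have "\<forall>\<psi>\<in>basic_open A e. (\<lambda>\<phi>\<in>V. germ A (nonvanishing A \<phi>) c) \<psi> = germ A (nonvanishing A \<psi>) c"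
    by auto
  with e c show "\<exists>c'\<in>elts A. \<exists>e\<in>elts A. \<phi> \<in> basic_open A e \<and> basic_open A e \<subseteq> V \<and>
      (\<forall>\<psi>\<in>basic_open A e. (\<lambda>\<phi>\<in>V. germ A (nonvanishing A \<phi>) c) \<psi> = germ A (nonvanishing A \<psi>) c')"
    by blast
qed simp

lemma section_value_oper:
  assumes "\<phi> \<in> V" "\<phi> \<in> real_points A" "smooth_fun n f" "s \<in> {..<n} \<rightarrow> elts (Spec_sections A V)"
  shows "section_value (oper (Spec_sections A V) n f s) \<phi> = f (\<lambda>i\<in>{..<n}. section_value (s i) \<phi>)"
proof -
  have "(\<lambda>i\<in>{..<n}. s i \<phi>) \<in> {..<n} \<rightarrow> elts (stalk A \<phi>)"
    using assms by (fastforce simp: Spec_sections_def)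
  from germ_value_oper[OF assms(2,3) this] assms(1)
  have "section_value (oper (Spec_sections A V) n f s) \<phi> =
      f (\<lambda>i\<in>{..<n}. germ_value \<phi> ((\<lambda>i\<in>{..<n}. s i \<phi>) i))"
    by (simp add: Spec_sections_def section_value_def)
  also have "\<dots> = f (\<lambda>i\<in>{..<n}. section_value (s i) \<phi>)"
    by (intro arg_cong[where f = f] restrict_cong_less) (simp add: section_value_def)
  finally show ?thesis .
qed

lemma germ_hom:
  assumes V: "openin (underlying (Spec A)) V"
  shows "Cinf_hom A (Spec_sections A V) (\<lambda>c. \<lambda>\<phi>\<in>V. germ A (nonvanishing A \<phi>) c)"
  unfolding Cinf_hom_def
proof (intro conjI allI impI)
  show "(\<lambda>c. \<lambda>\<phi>\<in>V. germ A (nonvanishing A \<phi>) c) \<in> elts A \<rightarrow> elts (Spec_sections A V)"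
    using germ_section[OF V] by blast
  fix n f and a :: "nat \<Rightarrow> 'c" assume fa: "smooth_fun n f \<and> a \<in> {..<n} \<rightarrow>\<^sub>E elts A"
  have "oper (stalk A \<phi>) n f (\<lambda>i\<in>{..<n}. (\<lambda>i\<in>{..<n}. \<lambda>\<phi>\<in>V. germ A (nonvanishing A \<phi>) (a i)) i \<phi>) =
      germ A (nonvanishing A \<phi>) (oper A n f a)" if "\<phi> \<in> V" for \<phi>
  proof -
    have "(\<lambda>i\<in>{..<n}. (\<lambda>i\<in>{..<n}. \<lambda>\<phi>\<in>V. germ A (nonvanishing A \<phi>) (a i)) i \<phi>) =
        (\<lambda>i\<in>{..<n}. germ A (nonvanishing A \<phi>) (a i))"
      using that by (intro restrict_cong_less) simp
    then show ?thesis
      using germ_oper[OF nonvanishing_subset] fa by (simp add: stalk_def)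
  qed
  then show "(\<lambda>\<phi>\<in>V. germ A (nonvanishing A \<phi>) (oper A n f a)) =
      oper (Spec_sections A V) n f (\<lambda>i\<in>{..<n}. \<lambda>\<phi>\<in>V. germ A (nonvanishing A \<phi>) (a i))"
    by (simp add: Spec_sections_def cong: restrict_cong)
qed

end

section \<open>Affine function spaces\<close>

lemma Cinf_hom_comp:
  assumes \<phi>: "Cinf_hom A B \<phi>" and \<psi>: "Cinf_hom B C \<psi>"
  shows "Cinf_hom A C (\<lambda>a. \<psi> (\<phi> a))"
  unfolding Cinf_hom_def
proof (intro conjI allI impI)
  show "(\<lambda>a. \<psi> (\<phi> a)) \<in> elts A \<rightarrow> elts C"
    using \<phi> \<psi> unfolding Cinf_hom_def by blast
  fix n f and a :: "nat \<Rightarrow> 'a" assume fa: "smooth_fun n f \<and> a \<in> {..<n} \<rightarrow>\<^sub>E elts A"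
  then have "\<phi> (oper A n f a) = oper B n f (\<lambda>i\<in>{..<n}. \<phi> (a i))"
    and "(\<lambda>i\<in>{..<n}. \<phi> (a i)) \<in> {..<n} \<rightarrow>\<^sub>E elts B"
    using \<phi> unfolding Cinf_hom_def by auto
  then have "\<psi> (\<phi> (oper A n f a)) = oper C n f (\<lambda>i\<in>{..<n}. \<psi> ((\<lambda>i\<in>{..<n}. \<phi> (a i)) i))"
    using \<psi> fa unfolding Cinf_hom_def by simp
  also have "(\<lambda>i\<in>{..<n}. \<psi> ((\<lambda>i\<in>{..<n}. \<phi> (a i)) i)) = (\<lambda>i\<in>{..<n}. \<psi> (\<phi> (a i)))"
    by (rule restrict_cong_less) simp
  finally show "\<psi> (\<phi> (oper A n f a)) = oper C n f (\<lambda>i\<in>{..<n}. \<psi> (\<phi> (a i)))" .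
qed

context
  fixes A :: "'c Cinf_ring"
  assumes A: "is_Cinf_ring A"
begin

lemma mult_elt_zero: "a \<in> elts A \<Longrightarrow> mult_elt A a (const_elt A 0) = const_elt A 0"
  using mult_app_elt[OF A smooth_real_id smooth_real_const, of a 0]
  by (simp add: app_elt_id[OF A] app_elt_const[OF A])

lemma zero_germ:
  assumes "S \<subseteq> elts A" "d \<in> S" "e \<in> elts A" "mult_elt A d e = const_elt A 0"
  shows "(gen e, \<lambda>x. 0) \<in> loc_rel A S"
proof -
  have "(gen e, gen (const_elt A 0)) \<in> loc_rel A S"
    by (rule loc_rel_cancel[OF A assms(1-3) const_elt_closed[OF A]])
       (use assms mult_elt_zero[of d] in auto)
  then show ?thesis using loc_rel_const_elt[OF A] by (rule loc_rel.trans)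
qed

lemma zero_germ_mult:
  assumes "c \<in> elts A" "e \<in> elts A" "(gen e, \<lambda>x. 0) \<in> loc_rel A S"
  shows "(gen (mult_elt A c e), \<lambda>x. 0) \<in> loc_rel A S"
proof -
  have "(\<lambda>x. gen c x * gen e x, \<lambda>x. gen c x * 0) \<in> loc_rel A S"
    by (intro loc_rel_mult[OF A] loc_rel.refl gen_free[OF A] assms)
  then show ?thesis
    using loc_rel.trans[OF loc_rel_mult_elt[OF A assms(1,2)]] by simp
qed

text \<open>The predicate of a function space is arbitrary, so closure of its sections under smooth
  operations has to be transported from the spectrum; this lemma is the source.\<close>

lemma Spec_sections_oper_closed:
  assumes V: "openin (underlying (Spec A)) V" and f: "smooth_fun n f"
    and s: "s \<in> {..<n} \<rightarrow>\<^sub>E elts (Spec_sections A V)"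
  shows "oper (Spec_sections A V) n f s \<in> elts (Spec_sections A V)"
proof (rule Spec_sectionI[OF A])
  show "oper (Spec_sections A V) n f s \<in> extensional V" by (simp add: Spec_sections_def)
  fix \<phi> assume \<phi>: "\<phi> \<in> V"
  have "\<forall>i. i < n \<longrightarrow> (\<exists>c e. c \<in> elts A \<and> e \<in> elts A \<and> \<phi> \<in> basic_open A e \<and>
      (\<forall>\<psi>\<in>basic_open A e. s i \<psi> = germ A (nonvanishing A \<psi>) c))"
  proof (intro allI impI)
    fix i assume "i < n"
    then have "s i \<in> elts (Spec_sections A V)" using s by blast
    from Spec_section_locally_germ[OF A this \<phi>]
    show "\<exists>c e. c \<in> elts A \<and> e \<in> elts A \<and> \<phi> \<in> basic_open A e \<and>
        (\<forall>\<psi>\<in>basic_open A e. s i \<psi> = germ A (nonvanishing A \<psi>) c)" by metis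
  qed
  then obtain c e where ce: "\<And>i. i < n \<Longrightarrow> c i \<in> elts A" "\<And>i. i < n \<Longrightarrow> e i \<in> elts A"
    "\<And>i. i < n \<Longrightarrow> \<phi> \<in> basic_open A (e i)"
    "\<And>i \<psi>. i < n \<Longrightarrow> \<psi> \<in> basic_open A (e i) \<Longrightarrow> s i \<psi> = germ A (nonvanishing A \<psi>) (c i)"
    by metis
  \<comment> \<open>Inserting \<open>V\<close> keeps the intersection inside \<open>V\<close> and
    the family nonempty even for \<open>n = 0\<close>.\<close>
  have "openin (underlying (Spec A)) (\<Inter> (insert V ((\<lambda>i. basic_open A (e i)) ` {..<n})))"
    by (rule openin_Inter) (use V ce(2) openin_basic_open[OF A] in auto)
  moreover have "\<phi> \<in> \<Inter> (insert V ((\<lambda>i. basic_open A (e i)) ` {..<n}))" using \<phi> ce(3) by auto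
  ultimately obtain d where d: "d \<in> elts A" "\<phi> \<in> basic_open A d"
    "basic_open A d \<subseteq> \<Inter> (insert V ((\<lambda>i. basic_open A (e i)) ` {..<n}))"
    unfolding openin_Spec[OF A] by blast
  define b where "b = (\<lambda>i\<in>{..<n}. c i)"
  have b: "b \<in> {..<n} \<rightarrow>\<^sub>E elts A" using ce(1) by (auto simp: b_def)
  have "oper (Spec_sections A V) n f s \<psi> = germ A (nonvanishing A \<psi>) (oper A n f b)"
    if \<psi>: "\<psi> \<in> basic_open A d" for \<psi>
  proof -
    have "(\<lambda>i\<in>{..<n}. s i \<psi>) = (\<lambda>i\<in>{..<n}. germ A (nonvanishing A \<psi>) (b i))"
      using \<psi> d(3) ce(4) by (intro restrict_cong_less) (auto simp: b_def)
    moreover have "\<psi> \<in> V" using \<psi> d(3) by auto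
    ultimately show ?thesis
      using germ_oper[OF A nonvanishing_subset[OF A] f b, of \<psi>] by (simp add: Spec_sections_def stalk_def)
  qed
  then show "\<exists>c\<in>elts A. \<exists>e\<in>elts A. \<phi> \<in> basic_open A e \<and> basic_open A e \<subseteq> V \<and>
      (\<forall>\<psi>\<in>basic_open A e. oper (Spec_sections A V) n f s \<psi> = germ A (nonvanishing A \<psi>) c)"
    using d oper_closed[OF A f b] by blast
qed

text \<open>
  A homomorphism \<open>\<xi>\<close> on global sections restricts to a point \<open>\<phi>\<close> of \<open>A\<close>. A section \<open>s\<close> becomes an
  element of \<open>A\<close> after multiplication with a suitable \<open>e\<close> supported near \<open>\<phi>\<close>, hence
  \<open>\<xi>(s) \<phi>(e) = s(\<phi>) \<phi>(e)\<close>.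
\<close>

lemma real_points_global_sections:
  assumes \<xi>: "Cinf_hom (Spec_sections A (real_points A)) real_Cinf_ring \<xi>"
  obtains \<phi> where "\<phi> \<in> real_points A"
    "\<And>s. s \<in> elts (Spec_sections A (real_points A)) \<Longrightarrow> \<xi> s = section_value s \<phi>"
proof
  let ?V = "real_points A"
  let ?\<Gamma> = "Spec_sections A ?V"
  define G where "G c = (\<lambda>\<phi>\<in>?V. germ A (nonvanishing A \<phi>) c)" for c
  define \<phi> where "\<phi> = (\<lambda>c\<in>elts A. \<xi> (G c))"
  have V: "openin (underlying (Spec A)) ?V"
    using openin_topspace[of "underlying (Spec A)"] by (simp add: topspace_Spec[OF A])
  have G: "Cinf_hom A ?\<Gamma> G"
    using germ_hom[OF A V] by (simp add: G_def[abs_def])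
  have G_sec: "G c \<in> elts ?\<Gamma>" if "c \<in> elts A" for c
    using G that unfolding Cinf_hom_def by blast
  have "Cinf_hom A real_Cinf_ring \<phi>"
    unfolding Cinf_hom_def
  proof (intro conjI allI impI)
    fix n f and a :: "nat \<Rightarrow> 'c" assume fa: "smooth_fun n f \<and> a \<in> {..<n} \<rightarrow>\<^sub>E elts A"
    then have "\<phi> (oper A n f a) = \<xi> (G (oper A n f a))"
      by (simp add: \<phi>_def oper_closed[OF A])
    also have "\<dots> = f (\<lambda>i\<in>{..<n}. \<xi> (G (a i)))"
      using Cinf_hom_oper[OF Cinf_hom_comp[OF G \<xi>]] fa by simp
    also have "\<dots> = f (\<lambda>i\<in>{..<n}. \<phi> (a i))"
      using fa by (intro arg_cong[where f = f] restrict_cong_less) (auto simp: \<phi>_def)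
    finally show "\<phi> (oper A n f a) = oper real_Cinf_ring n f (\<lambda>i\<in>{..<n}. \<phi> (a i))"
      by (simp add: real_Cinf_ring_def)
  qed (simp add: real_Cinf_ring_def)
  then show \<phi>: "\<phi> \<in> real_points A"
    by (simp add: real_points_def \<phi>_def)
  fix s assume s: "s \<in> elts ?\<Gamma>"
  obtain c e where c: "c \<in> elts A" and e: "e \<in> elts A" "\<phi> \<in> basic_open A e"
    and sc: "\<And>\<psi>. \<psi> \<in> basic_open A e \<Longrightarrow> s \<psi> = germ A (nonvanishing A \<psi>) c"
    using Spec_section_locally_germ[OF A s \<phi>] by metis
  have "\<phi> e \<noteq> 0" using e by (simp add: basic_open_def)
  \<comment> \<open>Multiplying by \<open>e\<close> would not do: at a zero of \<open>e\<close>,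
    where nothing relates \<open>s\<close> to \<open>c\<close>, the germ of \<open>e\<close> may be
    nonzero. The smaller \<open>e'\<close> is annihilated by \<open>d\<close>, which is invertible
    at these zeros, so its germ vanishes there.\<close>
  then obtain e' d where e': "e' \<in> elts A" "d \<in> elts A" "\<phi> e' \<noteq> 0" "mult_elt A d e' = const_elt A 0"
    and d: "\<And>\<psi>. \<psi> \<in> ?V \<Longrightarrow> \<psi> e = 0 \<Longrightarrow> \<psi> d \<noteq> 0"
    by (rule separating_elts[OF A \<phi> e(1)]) blast
  have germ_mult: "mult_elt (localization A (nonvanishing A \<psi>)) (germ A (nonvanishing A \<psi>) b)
      (germ A (nonvanishing A \<psi>) e') = germ A (nonvanishing A \<psi>) (mult_elt A b e')"
    if "b \<in> elts A" for b \<psi>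
  proof -
    have "(\<lambda>i\<in>{..<2}. if i = 0 then b else e') \<in> {..<2::nat} \<rightarrow>\<^sub>E elts A"
      using that e' by auto
    from germ_oper[OF A nonvanishing_subset[OF A] smooth_fun_times this, of \<psi>]
    show ?thesis
      by (simp add: mult_elt_def if_distrib[of "germ A (nonvanishing A \<psi>)"] cong: restrict_cong)
  qed
  have prod: "mult_elt ?\<Gamma> s (G e') = G (mult_elt A c e')"
  proof (rule extensionalityI[of _ ?V])
    fix \<psi> assume \<psi>: "\<psi> \<in> ?V"
    let ?S = "nonvanishing A \<psi>"
    have "mult_elt ?\<Gamma> s (G e') \<psi> = mult_elt (localization A ?S) (s \<psi>) (G e' \<psi>)"
      using \<psi> by (simp add: mult_elt_def Spec_sections_def stalk_def
          if_distrib[of "\<lambda>f. f \<psi>"] cong: restrict_cong)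
    also have "G e' \<psi> = germ A ?S e'" using \<psi> by (simp add: G_def)
    also have "mult_elt (localization A ?S) (s \<psi>) (germ A ?S e') = germ A ?S (mult_elt A c e')"
    proof (cases "\<psi> e = 0")
      case False
      then show ?thesis
        using germ_mult[OF c, of \<psi>] sc[of \<psi>] \<psi> by (simp add: basic_open_def)
    next
      case True
      \<comment> \<open>Here \<open>s\<close> is the germ of some \<open>b\<close> unrelated to
        \<open>c\<close>, but both products contain the zero germ of \<open>e'\<close>.\<close>
      obtain b where b: "b \<in> elts A" and sb: "s \<psi> = germ A ?S b"
        using Spec_section_locally_germ[OF A s \<psi>] by metis
      have "(gen e', \<lambda>x. 0) \<in> loc_rel A ?S"
        using True d[OF \<psi>] e'
        by (intro zero_germ[of _ d] nonvanishing_subset[OF A]) (auto simp: nonvanishing_def)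
      then have "(gen (mult_elt A b e'), gen (mult_elt A c e')) \<in> loc_rel A ?S"
        using zero_germ_mult[OF b e'(1)] zero_germ_mult[OF c e'(1)]
        by (blast intro: loc_rel.trans loc_rel.sym)
      then have "germ A ?S (mult_elt A b e') = germ A ?S (mult_elt A c e')"
        unfolding germ_def by (rule class_eqI[OF A nonvanishing_subset[OF A]])
      then show ?thesis using sb germ_mult[OF b, of \<psi>] by simp
    qed
    also have "\<dots> = G (mult_elt A c e') \<psi>" using \<psi> by (simp add: G_def)
    finally show "mult_elt ?\<Gamma> s (G e') \<psi> = G (mult_elt A c e') \<psi>" .
  qed (auto simp: mult_elt_def Spec_sections_def G_def)
  have "\<xi> s * \<xi> (G e') = \<xi> (G (mult_elt A c e'))"
    using Cinf_hom_mult[OF \<xi> s G_sec[OF e'(1)]] prod by simp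
  then have "\<xi> s * \<phi> e' = \<phi> (mult_elt A c e')"
    using e' mult_elt_closed[OF A c e'(1)] by (simp add: \<phi>_def)
  also have "\<dots> = \<phi> c * \<phi> e'"
    by (rule Cinf_hom_mult[OF real_pointsD[OF \<phi>] c e'(1)])
  finally have "\<xi> s = \<phi> c" using e' by simp
  then show "\<xi> s = section_value s \<phi>"
    using sc[OF e(2)] germ_value_germ[OF A \<phi> c] by (simp add: section_value_def)
qed

text \<open>Basic open sets test only for being nonzero; a bump supported in \<open>W\<close>,
  applied to \<open>c\<close>, converts the condition that the value lies in \<open>W\<close> into
  such a test.\<close>

lemma openin_Spec_elt:
  assumes "c \<in> elts A" "open W"
  shows "openin (underlying (Spec A)) {\<phi> \<in> real_points A. \<phi> c \<in> W}"
  unfolding openin_Spec[OF A]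
proof (intro conjI ballI)
  fix \<phi> assume "\<phi> \<in> {\<phi> \<in> real_points A. \<phi> c \<in> W}"
  then have \<phi>: "\<phi> \<in> real_points A" "\<phi> c \<in> W" by auto
  obtain u where u: "smooth_real u" "u (\<phi> c) \<noteq> 0" "\<And>x. u x \<noteq> 0 \<Longrightarrow> x \<in> W"
    using smooth_bump[OF assms(2) \<phi>(2)] by blast
  have eval: "\<psi> (app_elt A u c) = u (\<psi> c)" if "\<psi> \<in> real_points A" for \<psi>
    by (rule Cinf_hom_app[OF real_pointsD[OF that] u(1) assms(1)])
  show "\<exists>a\<in>elts A. \<phi> \<in> basic_open A a \<and> basic_open A a \<subseteq> {\<phi> \<in> real_points A. \<phi> c \<in> W}"
  proof (intro bexI[of _ "app_elt A u c"] conjI subsetI)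
    show "\<phi> \<in> basic_open A (app_elt A u c)"
      using eval[OF \<phi>(1)] \<phi>(1) u(2) by (simp add: basic_open_def)
    fix \<psi> assume "\<psi> \<in> basic_open A (app_elt A u c)"
    then show "\<psi> \<in> {\<phi> \<in> real_points A. \<phi> c \<in> W}"
      using eval[of \<psi>] u(3) by (simp add: basic_open_def)
  qed (rule app_elt_closed[OF A u(1) assms(1)])
qed auto

end

section \<open>Necessity: consequences of an isomorphism with a spectrum\<close>

lemma function_space_simps [simp]:
  "underlying (function_space X P) = X"
  "elts (sections (function_space X P) U) = {f \<in> extensional U. P U f}"
  "oper (sections (function_space X P) U) n F a = (\<lambda>x\<in>U. F (\<lambda>i\<in>{..<n}. a i x))"
  "res (function_space X P) V W f = restrict f W"
  "preim (function_space X P) h Y = {x \<in> topspace X. h x \<in> Y}"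
  "global_sections (function_space X P) = sections (function_space X P) (topspace X)"
  by (simp_all add: function_space_def preim_def global_sections_def)

lemma Spec_simps:
  "sections (Spec A) = Spec_sections A"
  "res (Spec A) V W s = restrict s W"
  by (simp_all add: Spec_def)

lemma eval_hom:
  "x \<in> U \<Longrightarrow> Cinf_hom (sections (function_space X P) U) real_Cinf_ring (\<lambda>f. f x)"
  by (simp add: Cinf_hom_def real_Cinf_ring_def)

lemma openin_initial_topology:
  assumes "\<And>f. f \<in> F \<Longrightarrow> continuous_map X euclideanreal f"
  shows "openin (initial_topology (topspace X) F) U \<Longrightarrow> openin X U"
  unfolding initial_topology_def openin_topology_generated_by_iff
proof (induction rule: generate_topology_on.induct)
  case (Basis U)
  then show ?case
    using assms by (auto simp: continuous_map_def)
qed auto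

text \<open>The key is \<open>H_val\<close>, which identifies the abstract maps \<open>H\<close> on
  global sections with evaluation along \<open>h\<close>. Then elements of \<open>A\<close> become
  global functions on \<open>X\<close>, basic open sets become their sets of nonvanishing, and real
  points of the global functions come from points of \<open>Spec A\<close>, that is, of
  \<open>X\<close>.\<close>

lemma affine_function_space:
  assumes A: "is_Cinf_ring A" and iso: "ringed_space_iso (function_space X P) (Spec A)"
  shows "smoothly_regular (function_space X P)" "realcompact (function_space X P)"
    "germs_extend (function_space X P)"
proof -
  let ?V = "real_points A" and ?F = "function_space X P"
  let ?\<Gamma> = "Spec_sections A ?V" and ?S = "topspace X"
  let ?GX = "sections ?F ?S"
  obtain h H where hom: "homeomorphic_map X (underlying (Spec A)) h"
    and H_iso: "\<forall>V. openin (underlying (Spec A)) V \<longrightarrow>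
       Cinf_hom (Spec_sections A V) (sections ?F {x \<in> ?S. h x \<in> V}) (H V) \<and>
       bij_betw (H V) (elts (Spec_sections A V)) (elts (sections ?F {x \<in> ?S. h x \<in> V}))"
    and H_res: "\<forall>V W. openin (underlying (Spec A)) V \<and> openin (underlying (Spec A)) W \<and> W \<subseteq> V \<longrightarrow>
       (\<forall>s\<in>elts (Spec_sections A V). H W (restrict s W) = restrict (H V s) {x \<in> ?S. h x \<in> W})"
    using iso unfolding ringed_space_iso_def function_space_simps(1,4,5) Spec_simps
    by (elim exE conjE) (rule that)
  have H: "Cinf_hom (Spec_sections A V) (sections ?F {x \<in> ?S. h x \<in> V}) (H V)"
    "bij_betw (H V) (elts (Spec_sections A V)) (elts (sections ?F {x \<in> ?S. h x \<in> V}))"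
    if "openin (underlying (Spec A)) V" for V
    using H_iso that by (simp_all del: function_space_simps(2))
  have res: "H W (restrict s W) = restrict (H V s) {x \<in> ?S. h x \<in> W}"
    if "openin (underlying (Spec A)) V" "openin (underlying (Spec A)) W" "W \<subseteq> V"
      "s \<in> elts (Spec_sections A V)" for V W s
    using H_res that by simp
  have h: "continuous_map X (underlying (Spec A)) h" "inj_on h ?S" "h ` ?S = ?V"
    using homeomorphic_imp_continuous_map[OF hom] homeomorphic_imp_injective_map[OF hom]
      homeomorphic_imp_surjective_map[OF hom] by (simp_all add: topspace_Spec[OF A])
  have V: "openin (underlying (Spec A)) ?V"
    using openin_topspace[of "underlying (Spec A)"] by (simp add: topspace_Spec[OF A])
  have pre_V: "{x \<in> ?S. h x \<in> ?V} = ?S" using h(3) by auto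
  have HV: "Cinf_hom ?\<Gamma> ?GX (H ?V)" "bij_betw (H ?V) (elts ?\<Gamma>) (elts ?GX)"
    using H[OF V] unfolding pre_V by auto
  define G where "G c = (\<lambda>\<phi>\<in>?V. germ A (nonvanishing A \<phi>) c)" for c
  have G_sec: "G c \<in> elts ?\<Gamma>" if "c \<in> elts A" for c
    unfolding G_def by (rule germ_section[OF A V that])
  have G_val: "section_value (G c) \<phi> = \<phi> c" if "c \<in> elts A" "\<phi> \<in> ?V" for c \<phi>
    using germ_value_germ[OF A that(2,1)] that(2) by (simp add: G_def section_value_def)
  have H_val: "H ?V s x = section_value s (h x)" if x: "x \<in> ?S" and s: "s \<in> elts ?\<Gamma>" for x s
  proof -
    \<comment> \<open>Evaluation at \<open>x\<close> after \<open>H\<close> is a real point of the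
      global sections, so it is evaluation at some \<open>\<phi>\<close>; it remains to identify
      \<open>\<phi>\<close>.\<close>
    obtain \<phi> where \<phi>: "\<phi> \<in> ?V" and \<phi>_val: "\<And>s. s \<in> elts ?\<Gamma> \<Longrightarrow> H ?V s x = section_value s \<phi>"
      by (rule real_points_global_sections[OF A Cinf_hom_comp[OF HV(1) eval_hom[OF x]]]) blast
    have hx: "h x \<in> ?V" using h x by blast
    have "\<phi> = h x"
    proof (rule ccontr)
      assume "\<phi> \<noteq> h x"
      then obtain a where a: "a \<in> elts A" "\<phi> a \<noteq> h x a"
        using real_points_eqI[OF \<phi> hx] by blast
      \<comment> \<open>Subtracting the value at \<open>h x\<close> makes \<open>b\<close> vanish
        there but not at \<open>\<phi>\<close>. The resulting \<open>e\<close> is nonzero at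
        \<open>\<phi>\<close> and has zero germ on a neighbourhood \<open>?W\<close> of
        \<open>h x\<close>; compatibility with restriction to \<open>?W\<close> then contradicts the
        value at \<open>\<phi>\<close>.\<close>
      let ?u = "\<lambda>t. t - h x a"
      define b where "b = app_elt A ?u a"
      have u: "smooth_real ?u" by (intro smooth_real_intros)
      have b: "b \<in> elts A" "\<phi> b \<noteq> 0" "h x b = 0"
        using a app_elt_closed[OF A u a(1)] Cinf_hom_app[OF real_pointsD[OF \<phi>] u a(1)]
          Cinf_hom_app[OF real_pointsD[OF hx] u a(1)] by (simp_all add: b_def)
      obtain e d where ed: "e \<in> elts A" "d \<in> elts A" "\<phi> e \<noteq> 0" "mult_elt A d e = const_elt A 0"
        and d: "\<And>\<psi>. \<psi> \<in> ?V \<Longrightarrow> \<psi> b = 0 \<Longrightarrow> \<psi> d \<noteq> 0"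
        by (rule separating_elts[OF A \<phi> b(1,2)]) blast
      let ?W = "basic_open A d"
      have W: "openin (underlying (Spec A)) ?W" "?W \<subseteq> ?V" "h x \<in> ?W"
        using d[OF hx b(3)] ed(2) hx openin_basic_open[OF A] by (auto simp: basic_open_def)
      have "germ A (nonvanishing A \<psi>) e = germ A (nonvanishing A \<psi>) (const_elt A 0)" if "\<psi> \<in> ?W" for \<psi>
        using that ed
        by (intro germ_cancel[OF A nonvanishing_subset[OF A], of d] const_elt_closed[OF A])
           (auto simp: nonvanishing_def basic_open_def mult_elt_zero[OF A])
      then have "restrict (G e) ?W = restrict (G (const_elt A 0)) ?W"
        using W(2) by (auto simp: G_def fun_eq_iff subset_iff)
      then have "restrict (H ?V (G e)) {x \<in> ?S. h x \<in> ?W} =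
          restrict (H ?V (G (const_elt A 0))) {x \<in> ?S. h x \<in> ?W}"
        using res[OF V W(1,2) G_sec[OF ed(1)]] res[OF V W(1,2) G_sec[OF const_elt_closed[OF A]], of 0]
        by simp
      from fun_cong[OF this, of x] have "H ?V (G e) x = H ?V (G (const_elt A 0)) x"
        using x W(3) by simp
      then show False
        using ed \<phi>_val[OF G_sec] G_val[OF _ \<phi>] const_elt_closed[OF A]
        by (simp add: Cinf_hom_const[OF real_pointsD[OF \<phi>]])
    qed
    then show ?thesis using \<phi>_val[OF s] by simp
  qed
  have HG: "H ?V (G a) y = h y a" if "a \<in> elts A" "y \<in> ?S" for a y
    using H_val[OF that(2) G_sec[OF that(1)]] G_val[OF that(1), of "h y"] h(3) that(2) by auto
  \<comment> \<open>Locally a section has the germ of some \<open>c\<close>, so by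
    \<open>H_val\<close> the function is \<open>y \<mapsto> h y c\<close>, whose continuity follows
    from \<open>openin_Spec_elt\<close>.\<close>
  have cont: "continuous_map X euclideanreal f" if f: "f \<in> elts ?GX" for f
    unfolding continuous_map_def
  proof (intro conjI allI impI)
    fix W :: "real set" assume W: "openin euclideanreal W"
    obtain s where s: "s \<in> elts ?\<Gamma>" "f = H ?V s"
      using f bij_betw_imp_surj_on[OF HV(2)] by blast
    show "openin X {x \<in> ?S. f x \<in> W}"
    proof (subst openin_subopen, intro ballI)
      fix x assume x: "x \<in> {x \<in> ?S. f x \<in> W}"
      then have hx: "h x \<in> ?V" using h by blast
      obtain c e where c: "c \<in> elts A" and e: "e \<in> elts A" "h x \<in> basic_open A e"
        and sc: "\<And>\<psi>. \<psi> \<in> basic_open A e \<Longrightarrow> s \<psi> = germ A (nonvanishing A \<psi>) c"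
        using Spec_section_locally_germ[OF A s(1) hx] by metis
      have fc: "f y = h y c" if "y \<in> ?S" "h y \<in> basic_open A e" for y
        using H_val[OF that(1) s(1)] germ_value_germ[OF A _ c, of "h y"] sc[OF that(2)] that(2) s(2)
        by (simp add: section_value_def basic_open_def)
      let ?U = "basic_open A e \<inter> {\<phi> \<in> ?V. \<phi> c \<in> W}"
      have "openin (underlying (Spec A)) ?U"
        using W by (intro openin_Int openin_basic_open[OF A e(1)] openin_Spec_elt[OF A c]) auto
      with h(1) have "openin X {y \<in> ?S. h y \<in> ?U}"
        by (rule openin_continuous_map_preimage)
      then show "\<exists>T. openin X T \<and> x \<in> T \<and> T \<subseteq> {x \<in> ?S. f x \<in> W}"
        using x hx e(2) fc by (intro exI[of _ "{y \<in> ?S. h y \<in> ?U}"]) auto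
    qed
  qed auto
  have opens: "\<exists>a\<in>elts A. x \<in> {y \<in> ?S. h y a \<noteq> 0} \<and> {y \<in> ?S. h y a \<noteq> 0} \<subseteq> U"
    if U: "openin X U" "x \<in> U" for U x
  proof -
    have US: "U \<subseteq> ?S" using U openin_subset by blast
    have "openin (underlying (Spec A)) (h ` U)"
      using homeomorphic_map_openness[OF hom US] U by simp
    then obtain a where a: "a \<in> elts A" "h x \<in> basic_open A a" "basic_open A a \<subseteq> h ` U"
      unfolding openin_Spec[OF A] using U(2) by blast
    have "y \<in> U" if "y \<in> ?S" "h y a \<noteq> 0" for y
    proof -
      have "h y \<in> h ` U" using that h(3) a(3) by (auto simp: basic_open_def)
      then show ?thesis using that(1) US h(2) by (auto simp: inj_on_def)
    qed
    with a US U(2) show ?thesis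
      by (intro bexI[of _ a]) (auto simp: basic_open_def)
  qed
  show "smoothly_regular ?F"
  proof -
    have "openin (initial_topology ?S (elts ?GX)) U" if U: "openin X U" for U
    proof (subst openin_subopen, intro ballI)
      fix x assume "x \<in> U"
      from opens[OF U this] obtain a where a: "a \<in> elts A" "x \<in> {y \<in> ?S. h y a \<noteq> 0}"
        "{y \<in> ?S. h y a \<noteq> 0} \<subseteq> U" by blast
      have "{y \<in> ?S. h y a \<noteq> 0} = {y \<in> ?S. H ?V (G a) y \<in> - {0}}"
        using HG[OF a(1)] by auto
      moreover have "H ?V (G a) \<in> elts ?GX"
        using HV(2) G_sec[OF a(1)] bij_betwE by blast
      ultimately have "openin (initial_topology ?S (elts ?GX)) {y \<in> ?S. h y a \<noteq> 0}"
        unfolding initial_topology_def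
        by (intro topology_generated_by_Basis) (auto intro!: exI[of _ "- {0}"])
      with a show "\<exists>T. openin (initial_topology ?S (elts ?GX)) T \<and> x \<in> T \<and> T \<subseteq> U" by blast
    qed
    then show ?thesis
      unfolding smoothly_regular_def
      using openin_initial_topology[of "elts ?GX" X, OF cont]
      by (auto simp: topology_eq simp del: function_space_simps(2))
  qed
  show "realcompact ?F"
    unfolding realcompact_def bij_betw_def function_space_simps(1,6)
  proof
    show "inj_on (\<lambda>e. \<lambda>f\<in>elts ?GX. f e) ?S"
    proof (rule inj_onI)
      fix x y assume xy: "x \<in> ?S" "y \<in> ?S" "(\<lambda>f\<in>elts ?GX. f x) = (\<lambda>f\<in>elts ?GX. f y)"
      have "h x a = h y a" if a: "a \<in> elts A" for a
      proof -
        have "H ?V (G a) \<in> elts ?GX"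
          using HV(2) G_sec[OF a] bij_betwE by blast
        then have "H ?V (G a) x = H ?V (G a) y"
          using fun_cong[OF xy(3), of "H ?V (G a)"] by (simp only: restrict_apply if_True)
        then show ?thesis
          using HG[OF a] xy by simp
      qed
      then have "h x = h y" using h(3) xy by (intro real_points_eqI) auto
      then show "x = y" using h(2) xy by (auto simp: inj_on_def)
    qed
    show "(\<lambda>e. \<lambda>f\<in>elts ?GX. f e) ` ?S = real_points ?GX"
    proof (intro equalityI subsetI)
      fix \<xi> assume "\<xi> \<in> (\<lambda>e. \<lambda>f\<in>elts ?GX. f e) ` ?S"
      then obtain x where x: "x \<in> ?S" and \<xi>: "\<xi> = (\<lambda>f\<in>elts ?GX. f x)" by blast
      \<comment> \<open>To make the restricted evaluation a homomorphism, the operations must not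
        leave the global functions. Pulling the arguments back along \<open>H\<close> reduces this
        to closure on the spectrum.\<close>
      have "oper ?GX n F f \<in> elts ?GX" if F: "smooth_fun n F" and f: "f \<in> {..<n} \<rightarrow>\<^sub>E elts ?GX" for n F f
      proof -
        have "\<forall>i. i < n \<longrightarrow> (\<exists>s. s \<in> elts ?\<Gamma> \<and> f i = H ?V s)"
          using f bij_betw_imp_surj_on[OF HV(2)] by (blast dest: PiE_mem)
        then obtain s where s: "\<And>i. i < n \<Longrightarrow> s i \<in> elts ?\<Gamma>" "\<And>i. i < n \<Longrightarrow> f i = H ?V (s i)" by metis
        define t where "t = (\<lambda>i\<in>{..<n}. s i)"
        have t: "t \<in> {..<n} \<rightarrow>\<^sub>E elts ?\<Gamma>" using s by (auto simp: t_def)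
        have "f = (\<lambda>i\<in>{..<n}. H ?V (t i))"
          by (rule extensionalityI[of _ "{..<n}"]) (use f s in \<open>auto simp: t_def PiE_def\<close>)
        then have "oper ?GX n F f = H ?V (oper ?\<Gamma> n F t)"
          using HV(1) F t unfolding Cinf_hom_def by metis
        also have "\<dots> \<in> elts ?GX"
          using Spec_sections_oper_closed[OF A V F t] HV(2) bij_betwE by blast
        finally show ?thesis .
      qed
      then show "\<xi> \<in> real_points ?GX"
        using eval_hom[OF x, of X P] unfolding \<xi> real_points_def Cinf_hom_def
        by (simp add: real_Cinf_ring_def PiE_iff cong: restrict_cong del: function_space_simps(3))
    next
      fix \<xi> assume \<xi>: "\<xi> \<in> real_points ?GX"
      obtain \<phi> where \<phi>: "\<phi> \<in> ?V" and \<phi>_val: "\<And>s. s \<in> elts ?\<Gamma> \<Longrightarrow> \<xi> (H ?V s) = section_value s \<phi>"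
        by (rule real_points_global_sections[OF A Cinf_hom_comp[OF HV(1) real_pointsD[OF \<xi>]]]) blast
      obtain x where x: "x \<in> ?S" "\<phi> = h x" using \<phi> h(3) by blast
      have "\<xi> = (\<lambda>f\<in>elts ?GX. f x)"
      proof (rule extensionalityI[of _ "elts ?GX"])
        fix f assume f: "f \<in> elts ?GX"
        then obtain s where s: "s \<in> elts ?\<Gamma>" "f = H ?V s"
          using bij_betw_imp_surj_on[OF HV(2)] by blast
        then show "\<xi> f = (\<lambda>f\<in>elts ?GX. f x) f"
          using f \<phi>_val[OF s(1)] H_val[OF x(1) s(1)] x(2) by (simp only: restrict_apply if_True)
      qed (use \<xi> in \<open>auto simp: real_points_def\<close>)
      with x(1) show "\<xi> \<in> (\<lambda>e. \<lambda>f\<in>elts ?GX. f e) ` ?S" by blast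
    qed
  qed
  show "germs_extend ?F"
    unfolding germs_extend_def function_space_simps(1,4,6)
  proof (intro allI impI, elim conjE)
    fix U x f assume U: "openin X U" "x \<in> U" and f: "f \<in> elts (sections ?F U)"
    have US: "U \<subseteq> ?S" using U openin_subset by blast
    have hU: "openin (underlying (Spec A)) (h ` U)"
      using homeomorphic_map_openness[OF hom US] U by simp
    have pre_U: "{x \<in> ?S. h x \<in> h ` U} = U"
      using US h(2) by (auto simp: inj_on_def)
    obtain s where s: "s \<in> elts (Spec_sections A (h ` U))" "f = H (h ` U) s"
      using f bij_betw_imp_surj_on[OF H(2)[OF hU]] unfolding pre_U by blast
    have "h x \<in> h ` U" using U by blast
    from Spec_section_locally_germ[OF A s(1) this]
    obtain c e where c: "c \<in> elts A" and e: "e \<in> elts A" "h x \<in> basic_open A e" "basic_open A e \<subseteq> h ` U"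
      and sc: "\<And>\<psi>. \<psi> \<in> basic_open A e \<Longrightarrow> s \<psi> = germ A (nonvanishing A \<psi>) c"
      by metis
    \<comment> \<open>Over the basic open set of \<open>e\<close>, the section of \<open>f\<close>
      has the germs of \<open>c\<close>; therefore the global section \<open>G c\<close> supplies
      the representative of \<open>f\<close> on the preimage.\<close>
    let ?W = "{x \<in> ?S. h x \<in> basic_open A e}"
    have We: "openin (underlying (Spec A)) (basic_open A e)" "basic_open A e \<subseteq> ?V"
      using openin_basic_open[OF A e(1)] by (auto simp: basic_open_def)
    have "restrict s (basic_open A e) = restrict (G c) (basic_open A e)"
      using sc We(2) by (auto simp: G_def fun_eq_iff subset_iff)
    then have "restrict (H ?V (G c)) ?W = restrict f ?W"
      using res[OF V We G_sec[OF c]] res[OF hU We(1) e(3) s(1)] s(2) by simp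
    moreover have "H ?V (G c) \<in> elts ?GX"
      using HV(2) G_sec[OF c] bij_betwE by blast
    moreover have "openin X ?W" using h(1) We(1) by (rule openin_continuous_map_preimage)
    moreover have "x \<in> ?W" "?W \<subseteq> U" using U US e(2,3) pre_U by auto
    ultimately show "\<exists>g\<in>elts ?GX. \<exists>W. openin X W \<and> x \<in> W \<and> W \<subseteq> U \<and> restrict g W = restrict f W"
      by blast
  qed
qed

section \<open>Smoothly regular function spaces\<close>

lemma is_Cinf_ring_functions:
  assumes "\<And>n F f. smooth_fun n F \<Longrightarrow> f \<in> {..<n} \<rightarrow>\<^sub>E elts (sections (function_space X P) U) \<Longrightarrow>
    P U (\<lambda>x\<in>U. F (\<lambda>i\<in>{..<n}. f i x))"
  shows "is_Cinf_ring (sections (function_space X P) U)"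
  unfolding is_Cinf_ring_def
proof (intro conjI allI impI)
  let ?A = "sections (function_space X P) U"
  fix n f and a :: "nat \<Rightarrow> 'a \<Rightarrow> real" assume "smooth_fun n f \<and> a \<in> {..<n} \<rightarrow>\<^sub>E elts ?A"
  then show "oper ?A n f a \<in> elts ?A" using assms by auto
next
  let ?A = "sections (function_space X P) U"
  fix n i and a :: "nat \<Rightarrow> 'a \<Rightarrow> real" assume ia: "i < n \<and> a \<in> {..<n} \<rightarrow>\<^sub>E elts ?A"
  then have "a i \<in> extensional U" by auto
  show "oper ?A n (\<lambda>x. x i) a = a i"
    by (rule extensionalityI[of _ U]) (use ia \<open>a i \<in> extensional U\<close> in simp_all)
next
  let ?A = "sections (function_space X P) U"
  fix m n g h and a :: "nat \<Rightarrow> 'a \<Rightarrow> real"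
  show "oper ?A n (\<lambda>x. g (\<lambda>j\<in>{..<m}. h j x)) a = oper ?A m g (\<lambda>j\<in>{..<m}. oper ?A n (h j) a)"
    by (auto intro!: restrict_ext arg_cong[where f = g])
next
  let ?A = "sections (function_space X P) U"
  fix n f g and a :: "nat \<Rightarrow> 'a \<Rightarrow> real"
  assume "smooth_fun n f \<and> (\<forall>x\<in>{..<n} \<rightarrow>\<^sub>E UNIV. f x = g x) \<and> a \<in> {..<n} \<rightarrow>\<^sub>E elts ?A"
  then show "oper ?A n f a = oper ?A n g a"
    by (auto intro!: restrict_ext)
qed

lemma mult_elt_function:
  "mult_elt (sections (function_space X P) U) a b = (\<lambda>x\<in>U. a x * b x)"
  by (auto simp: mult_elt_def intro!: restrict_ext)

lemma smoothly_regular_open: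
  assumes "smoothly_regular (function_space X P)"
    and "f \<in> elts (sections (function_space X P) (topspace X))" and "open W"
  shows "openin X {x \<in> topspace X. f x \<in> W}"
proof -
  have "X = initial_topology (topspace X) (elts (sections (function_space X P) (topspace X)))"
    using assms(1) unfolding smoothly_regular_def function_space_simps(1,6) .
  moreover have "openin (initial_topology (topspace X)
      (elts (sections (function_space X P) (topspace X)))) {x \<in> topspace X. f x \<in> W}"
    unfolding initial_topology_def using assms(2,3) by (intro topology_generated_by_Basis) blast
  ultimately show ?thesis by simp
qed

text \<open>The analogue of \<open>openin_Spec\<close>: bumps turn subbasic conditions on
  \<open>f x\<close> into nonvanishing of a function, and products give intersections.\<close>

lemma smoothly_regular_basis:
  assumes A: "is_Cinf_ring (sections (function_space X P) (topspace X))"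
    and reg: "smoothly_regular (function_space X P)"
    and U: "openin X U" "x \<in> U"
  obtains a where "a \<in> elts (sections (function_space X P) (topspace X))" "a x \<noteq> 0"
    "{y \<in> topspace X. a y \<noteq> 0} \<subseteq> U"
proof -
  let ?S = "topspace X"
  let ?A = "sections (function_space X P) ?S"
  have "X = initial_topology ?S (elts ?A)"
    using reg unfolding smoothly_regular_def function_space_simps(1,6) .
  with U(1) have "openin (initial_topology ?S (elts ?A)) U" by simp
  then have "generate_topology_on (insert ?S {{x \<in> ?S. f x \<in> W} | f W. f \<in> elts ?A \<and> open W}) U"
    by (simp only: initial_topology_def openin_topology_generated_by_iff)
  then have "U \<subseteq> ?S \<and> (\<forall>x\<in>U. \<exists>a\<in>elts ?A. a x \<noteq> 0 \<and> {y \<in> ?S. a y \<noteq> 0} \<subseteq> U)"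
  proof induction
    case (Int U V)
    show ?case
    proof (intro conjI ballI)
      show US: "U \<inter> V \<subseteq> ?S" using Int by blast
      fix x assume x: "x \<in> U \<inter> V"
      with Int obtain a b where ab: "a \<in> elts ?A" "a x \<noteq> 0" "{y \<in> ?S. a y \<noteq> 0} \<subseteq> U"
        "b \<in> elts ?A" "b x \<noteq> 0" "{y \<in> ?S. b y \<noteq> 0} \<subseteq> V" by (meson IntD1 IntD2)
      with x US show "\<exists>a\<in>elts ?A. a x \<noteq> 0 \<and> {y \<in> ?S. a y \<noteq> 0} \<subseteq> U \<inter> V"
        by (intro bexI[of _ "mult_elt ?A a b"] mult_elt_closed[OF A]) (auto simp: mult_elt_function)
    qed
  next
    case (UN K)
    show ?case
    proof (intro conjI ballI)
      show "\<Union>K \<subseteq> ?S" using UN.IH by blast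
      fix x assume "x \<in> \<Union>K"
      then obtain U where U: "U \<in> K" "x \<in> U" by blast
      with UN.IH[OF U(1)] obtain a where "a \<in> elts ?A" "a x \<noteq> 0" "{y \<in> ?S. a y \<noteq> 0} \<subseteq> U" by blast
      with U show "\<exists>a\<in>elts ?A. a x \<noteq> 0 \<and> {y \<in> ?S. a y \<noteq> 0} \<subseteq> \<Union>K" by blast
    qed
  next
    case (Basis U)
    show ?case
    proof (intro conjI ballI)
      show "U \<subseteq> ?S" using Basis by (elim insertE CollectE exE conjE) auto
      fix x assume x: "x \<in> U"
      show "\<exists>a\<in>elts ?A. a x \<noteq> 0 \<and> {y \<in> ?S. a y \<noteq> 0} \<subseteq> U"
      proof (cases "U = ?S")
        case True
        have "const_elt ?A 1 x \<noteq> 0"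
          using Cinf_hom_const[OF eval_hom, of x ?S X P 1] x True by simp
        with const_elt_closed[OF A, of 1] True show ?thesis by blast
      next
        case False
        with Basis obtain f W where f: "f \<in> elts ?A" and W: "open W" "U = {x \<in> ?S. f x \<in> W}"
          by (elim insertE CollectE exE conjE) auto
        then obtain u where u: "smooth_real u" "u (f x) \<noteq> 0" "\<And>x. u x \<noteq> 0 \<Longrightarrow> x \<in> W"
          using smooth_bump[of W "f x"] x by blast
        have eval: "app_elt ?A u f y = u (f y)" if "y \<in> ?S" for y
          by (rule Cinf_hom_app[OF eval_hom[OF that] u(1) f])
        show ?thesis
          using x W(2) u(2,3) eval
          by (intro bexI[of _ "app_elt ?A u f"] app_elt_closed[OF A u(1) f]) auto
      qed
    qed
  qed auto
  then show ?thesis using U(2) that by blast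
qed

text \<open>Evaluation \<open>h\<close> is bijective by realcompactness and bicontinuous because
  nonvanishing sets form a basis on both sides. On sections, \<open>H\<close> takes values; it is
  injective by \<open>germ_local\<close> and surjective by extension of germs.\<close>

lemma affine_function_spaceI:
  fixes X :: "'x topology" and P :: "'x set \<Rightarrow> ('x \<Rightarrow> real) \<Rightarrow> bool"
  assumes A: "is_Cinf_ring (sections (function_space X P) (topspace X))"
    and restr: "\<And>U f. openin X U \<Longrightarrow> f \<in> elts (sections (function_space X P) (topspace X)) \<Longrightarrow>
      P U (restrict f U)"
    and glue: "\<And>U f. openin X U \<Longrightarrow> f \<in> extensional U \<Longrightarrow>
      (\<And>x. x \<in> U \<Longrightarrow> \<exists>W. openin X W \<and> x \<in> W \<and> W \<subseteq> U \<and> P W (restrict f W)) \<Longrightarrow> P U f"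
    and reg: "smoothly_regular (function_space X P)"
    and rc: "realcompact (function_space X P)"
    and germs: "germs_extend (function_space X P)"
  shows "affine_Cinf_scheme TYPE('x \<Rightarrow> real) (function_space X P)"
proof -
  let ?F = "function_space X P" and ?S = "topspace X"
  let ?A = "sections ?F ?S"
  let ?Y = "underlying (Spec ?A)"
  define h where "h x = (\<lambda>f\<in>elts ?A. f x)" for x
  have h: "bij_betw h ?S (real_points ?A)"
    using rc unfolding realcompact_def function_space_simps(1,6) h_def[abs_def] .
  have h_elt: "h x a = a x" if "a \<in> elts ?A" for x a
    using that by (simp only: h_def restrict_apply if_True)
  have h_pt: "h x \<in> real_points ?A" if "x \<in> ?S" for x
    using bij_betwE[OF h] that by blast
  have h_basic: "h x \<in> basic_open ?A a \<longleftrightarrow> a x \<noteq> 0" if "x \<in> ?S" "a \<in> elts ?A" for x a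
    using h_elt[OF that(2)] h_pt[OF that(1)] by (simp add: basic_open_def del: function_space_simps)
  have h_ex: "\<exists>x\<in>?S. \<phi> = h x" if "\<phi> \<in> real_points ?A" for \<phi>
    using that bij_betw_imp_surj_on[OF h] by blast
  have nonzero_open: "openin X {x \<in> ?S. a x \<noteq> 0}" if "a \<in> elts ?A" for a
    using smoothly_regular_open[OF reg that, of "- {0}"] by (simp add: open_Compl)
  note basis = smoothly_regular_basis[OF A reg]
  have preim_open: "openin X {x \<in> ?S. h x \<in> V}" if V: "openin ?Y V" for V
  proof (subst openin_subopen, intro ballI)
    fix x assume x: "x \<in> {x \<in> ?S. h x \<in> V}"
    then obtain a where a: "a \<in> elts ?A" "h x \<in> basic_open ?A a" "basic_open ?A a \<subseteq> V"
      using V unfolding openin_Spec[OF A] by blast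
    then show "\<exists>T. openin X T \<and> x \<in> T \<and> T \<subseteq> {x \<in> ?S. h x \<in> V}"
      using x nonzero_open[OF a(1)] h_basic[OF _ a(1)]
      by (intro exI[of _ "{x \<in> ?S. a x \<noteq> 0}"]) auto
  qed
  have image_open: "openin ?Y (h ` U)" if U: "openin X U" for U
    unfolding openin_Spec[OF A]
  proof (intro conjI ballI)
    have US: "U \<subseteq> ?S" using openin_subset[OF U] .
    then show "h ` U \<subseteq> real_points ?A" using h_pt by blast
    fix \<phi> assume "\<phi> \<in> h ` U"
    then obtain x where x: "x \<in> U" "\<phi> = h x" by blast
    obtain a where a: "a \<in> elts ?A" "a x \<noteq> 0" "{y \<in> ?S. a y \<noteq> 0} \<subseteq> U"
      by (rule basis[OF U x(1)])
    have "basic_open ?A a \<subseteq> h ` U"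
    proof
      fix \<psi> assume \<psi>: "\<psi> \<in> basic_open ?A a"
      then obtain y where "y \<in> ?S" "\<psi> = h y" using h_ex by (auto simp: basic_open_def)
      with \<psi> a h_basic show "\<psi> \<in> h ` U" by blast
    qed
    with a x US h_basic show "\<exists>a\<in>elts ?A. \<phi> \<in> basic_open ?A a \<and> basic_open ?A a \<subseteq> h ` U"
      by blast
  qed
  have hom: "homeomorphic_map X ?Y h"
    using h preim_open image_open
    by (intro bijective_open_imp_homeomorphic_map)
       (auto simp: continuous_map_def open_map_def topspace_Spec[OF A] bij_betw_def)
  \<comment> \<open>Elements of the ring are functions here, so a \<open>d\<close> that lives in
    \<open>W\<close> gives \<open>d c = d c'\<close> as an identity in the ring, and
    \<open>d\<close> is invertible in the stalk at \<open>h x\<close>.\<close>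
  have germ_local: "germ ?A (nonvanishing ?A (h x)) c = germ ?A (nonvanishing ?A (h x)) c'"
    if W: "openin X W" "x \<in> W" and c: "c \<in> elts ?A" "c' \<in> elts ?A"
      and eq: "\<And>y. y \<in> W \<Longrightarrow> c y = c' y" for W x c c'
  proof -
    obtain d where d: "d \<in> elts ?A" "d x \<noteq> 0" "{y \<in> ?S. d y \<noteq> 0} \<subseteq> W"
      by (rule basis[OF W])
    have "mult_elt ?A d c = mult_elt ?A d c'"
      unfolding mult_elt_function using d(3) eq by (intro restrict_ext) auto
    moreover have "d \<in> nonvanishing ?A (h x)"
      using d h_elt by (simp add: nonvanishing_def del: function_space_simps)
    ultimately show ?thesis
      using c by (intro germ_cancel[OF A nonvanishing_subset[OF A]])
  qed
  let ?U = "\<lambda>V. {x \<in> ?S. h x \<in> V}"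
  define H where "H V s = (\<lambda>x\<in>?U V. section_value s (h x))" for V s
  have local: "\<exists>c\<in>elts ?A. \<exists>W. openin X W \<and> x \<in> W \<and> W \<subseteq> ?U V \<and>
      (\<forall>y\<in>W. s (h y) = germ ?A (nonvanishing ?A (h y)) c) \<and> (\<forall>y\<in>W. section_value s (h y) = c y)"
    if s: "s \<in> elts (Spec_sections ?A V)" and x: "x \<in> ?U V" for s V x
  proof -
    have "h x \<in> V" using x by blast
    from Spec_section_locally_germ[OF A s this]
    obtain c e where c: "c \<in> elts ?A" and e: "e \<in> elts ?A" "h x \<in> basic_open ?A e" "basic_open ?A e \<subseteq> V"
      and sc: "\<And>\<psi>. \<psi> \<in> basic_open ?A e \<Longrightarrow> s \<psi> = germ ?A (nonvanishing ?A \<psi>) c" by metis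
    have sc': "s (h y) = germ ?A (nonvanishing ?A (h y)) c" if "y \<in> ?S" "e y \<noteq> 0" for y
      using sc h_basic[OF that(1) e(1)] that by blast
    have "section_value s (h y) = c y" if "y \<in> ?S" "e y \<noteq> 0" for y
      using sc'[OF that] germ_value_germ[OF A h_pt[OF that(1)] c] h_elt[OF c]
      by (simp add: section_value_def del: function_space_simps)
    with sc' c x e h_basic[OF _ e(1)] nonzero_open[OF e(1)] show ?thesis
      by (intro bexI[of _ c] exI[of _ "{x \<in> ?S. e x \<noteq> 0}"]) auto
  qed
  have H_sec: "H V s \<in> elts (sections ?F (?U V))"
    if V: "openin ?Y V" and s: "s \<in> elts (Spec_sections ?A V)" for V s
  proof -
    have "P (?U V) (H V s)"
    proof (rule glue[OF preim_open[OF V]])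
      fix x assume "x \<in> ?U V"
      from local[OF s this] obtain c W where W: "c \<in> elts ?A" "openin X W" "x \<in> W" "W \<subseteq> ?U V"
        "\<forall>y\<in>W. section_value s (h y) = c y" by blast
      have "restrict (H V s) W = restrict c W"
        using W(4,5) by (intro restrict_ext) (auto simp: H_def)
      with restr[OF W(2,1)] W show "\<exists>W. openin X W \<and> x \<in> W \<and> W \<subseteq> ?U V \<and> P W (restrict (H V s) W)"
        by auto
    qed (simp add: H_def)
    then show ?thesis by (simp add: H_def)
  qed
  have H_hom: "Cinf_hom (Spec_sections ?A V) (sections ?F (?U V)) (H V)" if V: "openin ?Y V" for V
    unfolding Cinf_hom_def
  proof (intro conjI allI impI)
    show "H V \<in> elts (Spec_sections ?A V) \<rightarrow> elts (sections ?F (?U V))"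
      using H_sec[OF V] by blast
    fix n f and s assume fs: "smooth_fun n f \<and> s \<in> {..<n} \<rightarrow>\<^sub>E elts (Spec_sections ?A V)"
    have "section_value (oper (Spec_sections ?A V) n f s) (h x) =
        f (\<lambda>i\<in>{..<n}. (\<lambda>i\<in>{..<n}. H V (s i)) i x)" if x: "x \<in> ?U V" for x
    proof -
      have "section_value (oper (Spec_sections ?A V) n f s) (h x) =
          f (\<lambda>i\<in>{..<n}. section_value (s i) (h x))"
        using x fs by (intro section_value_oper[OF A]) (auto intro: h_pt)
      also have "\<dots> = f (\<lambda>i\<in>{..<n}. (\<lambda>i\<in>{..<n}. H V (s i)) i x)"
        using x by (intro arg_cong[where f = f] restrict_cong_less) (simp add: H_def)
      finally show ?thesis .
    qed
    then show "H V (oper (Spec_sections ?A V) n f s) =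
        oper (sections ?F (?U V)) n f (\<lambda>i\<in>{..<n}. H V (s i))"
      unfolding function_space_simps(3) by (subst H_def) (rule restrict_ext)
  qed
  have H_bij: "bij_betw (H V) (elts (Spec_sections ?A V)) (elts (sections ?F (?U V)))"
    if V: "openin ?Y V" for V
  proof -
    have VA: "V \<subseteq> real_points ?A" using V unfolding openin_Spec[OF A] by blast
    \<comment> \<open>Equal value functions force the local representatives \<open>c\<close> and
      \<open>c'\<close> to agree on a common neighbourhood, hence to have equal germs.\<close>
    have "inj_on (H V) (elts (Spec_sections ?A V))"
    proof (rule inj_onI)
      fix s t assume s: "s \<in> elts (Spec_sections ?A V)" and t: "t \<in> elts (Spec_sections ?A V)"
        and eq: "H V s = H V t"
      show "s = t"
      proof (rule extensionalityI[of _ V])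
        fix \<phi> assume \<phi>: "\<phi> \<in> V"
        then obtain x where x: "x \<in> ?U V" "\<phi> = h x" using h_ex VA by blast
        obtain c W where c: "c \<in> elts ?A" "openin X W" "x \<in> W" "W \<subseteq> ?U V"
          "\<forall>y\<in>W. s (h y) = germ ?A (nonvanishing ?A (h y)) c" "\<forall>y\<in>W. section_value s (h y) = c y"
          using local[OF s x(1)] by blast
        obtain c' W' where c': "c' \<in> elts ?A" "openin X W'" "x \<in> W'"
          "\<forall>y\<in>W'. t (h y) = germ ?A (nonvanishing ?A (h y)) c'" "\<forall>y\<in>W'. section_value t (h y) = c' y"
          using local[OF t x(1)] by blast
        have "c y = c' y" if y: "y \<in> W \<inter> W'" for y
        proof -
          have "y \<in> ?U V" using y c(4) by blast
          then have "section_value s (h y) = section_value t (h y)"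
            using fun_cong[OF eq, of y] by (simp only: H_def restrict_apply if_True)
          with y c(6) c'(5) show ?thesis by simp
        qed
        from germ_local[OF openin_Int[OF c(2) c'(2)] _ c(1) c'(1) this] c c' x
        show "s \<phi> = t \<phi>" by (simp del: function_space_simps)
      qed (use s t in \<open>auto simp: Spec_sections_def PiE_def simp del: function_space_simps\<close>)
    qed
    moreover have "elts (sections ?F (?U V)) \<subseteq> H V ` elts (Spec_sections ?A V)"
    proof
      fix f assume f: "f \<in> elts (sections ?F (?U V))"
      have "\<exists>g. \<exists>W. g \<in> elts ?A \<and> openin X W \<and> x \<in> W \<and> W \<subseteq> ?U V \<and> restrict g W = restrict f W"
        if "x \<in> ?U V" for x
        using germs preim_open[OF V] f that unfolding germs_extend_def function_space_simps(1,4,6) by blast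
      then have "\<forall>x\<in>?U V. \<exists>g. \<exists>W. g \<in> elts ?A \<and> openin X W \<and> x \<in> W \<and> W \<subseteq> ?U V \<and>
          restrict g W = restrict f W" by (rule ballI)
      from bchoice[OF this] obtain g where "\<forall>x\<in>?U V. \<exists>W. g x \<in> elts ?A \<and> openin X W \<and> x \<in> W \<and>
          W \<subseteq> ?U V \<and> restrict (g x) W = restrict f W" by (rule exE)
      from bchoice[OF this] obtain W where gW': "\<forall>x\<in>?U V. g x \<in> elts ?A \<and> openin X (W x) \<and> x \<in> W x \<and>
          W x \<subseteq> ?U V \<and> restrict (g x) (W x) = restrict f (W x)" by (rule exE)
      have g: "g x \<in> elts ?A" and W: "openin X (W x)" "x \<in> W x" "W x \<subseteq> ?U V"
        and gW: "restrict (g x) (W x) = restrict f (W x)" if "x \<in> ?U V" for x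
        using bspec[OF gW' that] by blast+
      have gf: "g x y = f y" if "x \<in> ?U V" "y \<in> W x" for x y
        using fun_cong[OF gW[OF that(1)], of y] that(2) by simp
      define k where "k \<phi> = inv_into ?S h \<phi>" for \<phi>
      have k: "k (h x) = x" if "x \<in> ?S" for x
        using that h by (simp add: k_def bij_betw_def)
      \<comment> \<open>At each point, the germ of the chosen global extension of \<open>f\<close>
        there. Near \<open>x\<close> all these germs are germs of the single \<open>g x\<close>,
        since \<open>g x\<close> and \<open>g y\<close> both extend \<open>f\<close> near
        \<open>y\<close>.\<close>
      define s where "s = (\<lambda>\<phi>\<in>V. germ ?A (nonvanishing ?A \<phi>) (g (k \<phi>)))"
      have s_h: "s (h x) = germ ?A (nonvanishing ?A (h x)) (g x)" if "x \<in> ?U V" for x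
        using that k by (simp add: s_def del: function_space_simps)
      have "s \<in> elts (Spec_sections ?A V)"
      proof (rule Spec_sectionI[OF A])
        fix \<phi> assume \<phi>: "\<phi> \<in> V"
        then obtain x where x: "x \<in> ?U V" "\<phi> = h x" using h_ex VA by blast
        obtain e where e: "e \<in> elts ?A" "e x \<noteq> 0" "{y \<in> ?S. e y \<noteq> 0} \<subseteq> W x"
          by (rule basis[OF W(1,2)[OF x(1)]])
        have *: "\<psi> \<in> V \<and> s \<psi> = germ ?A (nonvanishing ?A \<psi>) (g x)" if \<psi>: "\<psi> \<in> basic_open ?A e" for \<psi>
        proof -
          have "\<psi> \<in> real_points ?A" using \<psi> unfolding basic_open_def by blast
          then obtain y where y: "y \<in> ?S" "\<psi> = h y" using h_ex by blast
          then have "y \<in> W x" using e \<psi> h_basic by blast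
          then have yV: "y \<in> ?U V" using W(3)[OF x(1)] by blast
          have "germ ?A (nonvanishing ?A (h y)) (g y) = germ ?A (nonvanishing ?A (h y)) (g x)"
            using \<open>y \<in> W x\<close> x(1) yV gf
            by (intro germ_local[OF openin_Int[OF W(1)[OF x(1)] W(1)[OF yV]]] g) (auto simp: W(2))
          then show ?thesis using s_h[OF yV] yV y(2) by simp
        qed
        have "\<phi> \<in> basic_open ?A e" using x e h_basic by blast
        with * e(1) g[OF x(1)]
        show "\<exists>c\<in>elts ?A. \<exists>e\<in>elts ?A. \<phi> \<in> basic_open ?A e \<and> basic_open ?A e \<subseteq> V \<and>
            (\<forall>\<psi>\<in>basic_open ?A e. s \<psi> = germ ?A (nonvanishing ?A \<psi>) c)" by blast
      qed (simp add: s_def)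
      moreover have "H V s = f"
      proof (rule extensionalityI[of _ "?U V"])
        fix x assume x: "x \<in> ?U V"
        then have "x \<in> ?S" by blast
        then have "section_value s (h x) = h x (g x)"
          using germ_value_germ[OF A h_pt g[OF x]] s_h[OF x] by (simp add: section_value_def)
        then show "H V s x = f x"
          using x h_elt[OF g[OF x]] gf[OF x W(2)[OF x]] by (simp add: H_def)
      qed (use f in \<open>auto simp: H_def\<close>)
      ultimately show "f \<in> H V ` elts (Spec_sections ?A V)" by blast
    qed
    ultimately show ?thesis
      using H_sec[OF V] unfolding bij_betw_def by blast
  qed
  have H_res: "H W (restrict s W) = restrict (H V s) (?U W)" if "W \<subseteq> V" for V W s
    using that by (auto simp: H_def section_value_def fun_eq_iff)
  have "ringed_space_iso ?F (Spec ?A)"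
    unfolding ringed_space_iso_def function_space_simps(1,4,5) Spec_simps
    using hom H_hom H_bij H_res by (intro exI[of _ h] exI[of _ H]) blast
  then show ?thesis
    unfolding affine_Cinf_scheme_def using A by blast
qed

text \<open>
  A local section \<open>f\<close> is multiplied with a global \<open>\<rho>\<close> that is \<open>1\<close> near \<open>e\<close> and whose support is
  closed and contained in the domain of \<open>f\<close>.
\<close>

lemma germs_extendI:
  assumes A: "\<And>U. openin X U \<Longrightarrow> is_Cinf_ring (sections (function_space X P) U)"
    and restr: "\<And>U f. openin X U \<Longrightarrow> f \<in> elts (sections (function_space X P) (topspace X)) \<Longrightarrow>
      P U (restrict f U)"
    and glue: "\<And>f. f \<in> extensional (topspace X) \<Longrightarrow>
      (\<And>x. x \<in> topspace X \<Longrightarrow> \<exists>W. openin X W \<and> x \<in> W \<and> P W (restrict f W)) \<Longrightarrow> P (topspace X) f"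
    and reg: "smoothly_regular (function_space X P)"
  shows "germs_extend (function_space X P)"
  unfolding germs_extend_def function_space_simps(1,4,6)
proof (intro allI impI, elim conjE)
  let ?F = "function_space X P" and ?S = "topspace X"
  let ?A = "sections ?F ?S"
  fix U e f assume U: "openin X U" "e \<in> U" and f: "f \<in> elts (sections ?F U)"
  have US: "U \<subseteq> ?S" by (rule openin_subset[OF U(1)])
  note AS = A[OF openin_topspace]
  obtain a where a: "a \<in> elts ?A" "a e \<noteq> 0" "{y \<in> ?S. a y \<noteq> 0} \<subseteq> U"
    by (rule smoothly_regular_basis[OF AS reg U])
  \<comment> \<open>Normalises \<open>a\<close> to the value 1 at \<open>e\<close>, inside the
    region where \<open>smooth_step\<close> is 1.\<close>
  define r where "r = 1 / a e"
  have r: "r \<noteq> 0" "r * a e = 1" using a(2) by (simp_all add: r_def)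
  define \<rho> where "\<rho> = app_elt ?A (\<lambda>t. smooth_step (r * t)) a"
  have u: "smooth_real (\<lambda>t. smooth_step (r * t))"
    by (intro smooth_real_intros smooth_real_compose[OF smooth_smooth_step])
  have \<rho>: "\<rho> \<in> elts ?A" unfolding \<rho>_def by (rule app_elt_closed[OF AS u a(1)])
  have \<rho>_eval: "\<rho> x = smooth_step (r * a x)" if "x \<in> ?S" for x
    unfolding \<rho>_def by (rule Cinf_hom_app[OF eval_hom[OF that] u a(1)])
  have op: "openin X {x \<in> ?S. r * a x \<in> W}" if "open W" for W
  proof -
    have "open {t. r * t \<in> W}"
      using open_vimage[OF that, of "\<lambda>t. r * t"] by (simp add: vimage_def continuous_intros)
    from smoothly_regular_open[OF reg a(1) this] show ?thesis by simp
  qed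
  define g where "g = (\<lambda>x\<in>?S. if x \<in> U then \<rho> x * f x else 0)"
  have "P ?S g"
  proof (rule glue)
    fix x assume x: "x \<in> ?S"
    show "\<exists>W. openin X W \<and> x \<in> W \<and> P W (restrict g W)"
    proof (cases "x \<in> U")
      case True
      have "restrict \<rho> U \<in> elts (sections ?F U)"
        using restr[OF U(1) \<rho>] by simp
      from mult_elt_closed[OF A[OF U(1)] this f]
      have "mult_elt (sections ?F U) (restrict \<rho> U) f \<in> elts (sections ?F U)" .
      moreover have "mult_elt (sections ?F U) (restrict \<rho> U) f = restrict g U"
        unfolding mult_elt_function using US by (intro restrict_ext) (auto simp: g_def)
      ultimately show ?thesis using True U(1) by auto
    next
      case False
      \<comment> \<open>Outside \<open>U\<close> the function \<open>a\<close> is zero, so this is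
        an open neighbourhood of the complement of \<open>U\<close>; the cutoff vanishes on it,
        including its part inside \<open>U\<close>.\<close>
      let ?W = "{x \<in> ?S. r * a x \<in> {..<1/4}}"
      have W: "openin X ?W" by (rule op) simp
      have "restrict g ?W = const_elt (sections ?F ?W) 0"
        unfolding const_elt_def function_space_simps
        by (intro restrict_ext) (auto simp: g_def \<rho>_eval smooth_step_eq_0)
      then have "P ?W (restrict g ?W)"
        using const_elt_closed[OF A[OF W], of 0] by simp
      moreover have "x \<in> ?W" using x False a(3) by auto
      ultimately show ?thesis using W by blast
    qed
  qed (simp add: g_def)
  then have "g \<in> elts ?A" by (simp add: g_def)
  moreover
  let ?W = "{x \<in> ?S. r * a x \<in> {1/2<..}}"
  have "openin X ?W" by (rule op) simp
  moreover have "e \<in> ?W" using US U(2) r by auto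
  moreover have WU: "?W \<subseteq> U"
  proof
    fix x assume "x \<in> ?W"
    then have "x \<in> ?S" "a x \<noteq> 0" by auto
    then show "x \<in> U" using a(3) by blast
  qed
  moreover have "restrict g ?W = restrict f ?W"
    using WU by (intro restrict_ext) (auto simp: g_def \<rho>_eval smooth_step_eq_1)
  ultimately show "\<exists>g\<in>elts ?A. \<exists>W. openin X W \<and> e \<in> W \<and> W \<subseteq> U \<and> restrict g W = restrict f W"
    by blast
qed

section \<open>Gateaux smooth functions\<close>

text \<open>Reindexing of tuples. It generalises \<open>half1\<close> because the induction passes
  to the derivative, which is reindexed by a different index map on tuples of double length.\<close>

definition sel :: "nat \<Rightarrow> (nat \<Rightarrow> nat) \<Rightarrow> (nat \<Rightarrow> 'a) \<Rightarrow> (nat \<Rightarrow> 'a)" where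
  "sel n \<sigma> z = (\<lambda>i\<in>{..<n}. z (\<sigma> i))"

lemma continuous_map_sel:
  "(\<And>i. i < n \<Longrightarrow> \<sigma> i < m) \<Longrightarrow>
    continuous_map (product_topology (\<lambda>_. T) {..<m}) (product_topology (\<lambda>_. T) {..<n}) (sel n \<sigma>)"
  unfolding sel_def[abs_def]
  by (intro continuous_map_tuple continuous_map_product_coordinates) auto

lemma half1_sel: "half1 n = sel n (\<lambda>i. i)"
  by (auto simp: half1_def sel_def fun_eq_iff)

lemma Gateaux_C_mono: "Gateaux_C (Suc k) T S n U f \<Longrightarrow> Gateaux_C k T S n U f"
proof (induction k arbitrary: n U f)
  case (Suc k)
  then obtain Df where "continuous_map (subtopology (product_topology (\<lambda>_. T) {..<n}) U) S f"
    "\<forall>z\<in>times_space n U. is_Gateaux_deriv S n f (half1 n z) (half2 n z) (Df z)"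
    "Gateaux_C (Suc k) T S (2 * n) (times_space n U) Df"
    unfolding Gateaux_C.simps(2)[of "Suc k"] by blast
  with Suc.IH[of "2 * n" "times_space n U" Df] show ?case
    unfolding Gateaux_C.simps(2)[of k] by blast
qed simp

lemma Gateaux_C_continuous:
  "Gateaux_C k T S n U f \<Longrightarrow> continuous_map (subtopology (product_topology (\<lambda>_. T) {..<n}) U) S f"
  by (cases k) auto

lemma Gateaux_C_subset: "Gateaux_C k T S n U f \<Longrightarrow> W \<subseteq> U \<Longrightarrow> Gateaux_C k T S n W f"
proof (induction k arbitrary: n U W f)
  case 0
  then show ?case by (auto intro: continuous_map_from_subtopology_mono)
next
  case (Suc k)
  from Suc.prems(1) obtain Df where Df: "continuous_map (subtopology (product_topology (\<lambda>_. T) {..<n}) U) S f"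
    "\<forall>z\<in>times_space n U. is_Gateaux_deriv S n f (half1 n z) (half2 n z) (Df z)"
    "Gateaux_C k T S (2 * n) (times_space n U) Df"
    unfolding Gateaux_C.simps by blast
  have "times_space n W \<subseteq> times_space n U"
    using Suc.prems(2) by (auto simp: times_space_def)
  with Df Suc.IH[OF Df(3) this] Suc.prems(2) show ?case
    unfolding Gateaux_C.simps using continuous_map_from_subtopology_mono by blast
qed

text \<open>Reindexing is linear, so the derivative at \<open>(x, v)\<close> is \<open>Df\<close> at
  the reindexed point and the reindexed direction, again a reindexing of \<open>Df\<close>.\<close>

lemma Gateaux_C_sel:
  "Gateaux_C k T S n U f \<Longrightarrow> (\<And>i. i < n \<Longrightarrow> \<sigma> i < m) \<Longrightarrow>
    Gateaux_C k T S m {z \<in> {..<m} \<rightarrow>\<^sub>E UNIV. sel n \<sigma> z \<in> U} (\<lambda>z. f (sel n \<sigma> z))"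
proof (induction k arbitrary: n m U f \<sigma>)
  have c: "continuous_map (subtopology (product_topology (\<lambda>_. T) {..<m})
      {z \<in> {..<m} \<rightarrow>\<^sub>E UNIV. sel n \<sigma> z \<in> U}) S (\<lambda>z. f (sel n \<sigma> z))"
    if "continuous_map (subtopology (product_topology (\<lambda>_. T) {..<n}) U) S f"
      "\<And>i. i < n \<Longrightarrow> \<sigma> i < m" for n m U f \<sigma>
  proof -
    have "continuous_map (subtopology (product_topology (\<lambda>_. T) {..<m})
        {z \<in> {..<m} \<rightarrow>\<^sub>E UNIV. sel n \<sigma> z \<in> U}) (subtopology (product_topology (\<lambda>_. T) {..<n}) U) (sel n \<sigma>)"
      unfolding continuous_map_in_subtopology
      using continuous_map_from_subtopology[OF continuous_map_sel[OF that(2)]] by auto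
    from continuous_map_compose[OF this that(1)] show ?thesis by (simp add: o_def)
  qed
  {
    case 0
    then show ?case using c by simp
  next
    case (Suc k)
    from Suc.prems(1) obtain Df where Df: "continuous_map (subtopology (product_topology (\<lambda>_. T) {..<n}) U) S f"
      "\<And>z. z\<in>times_space n U \<Longrightarrow> is_Gateaux_deriv S n f (half1 n z) (half2 n z) (Df z)"
      "Gateaux_C k T S (2 * n) (times_space n U) Df"
      unfolding Gateaux_C.simps by blast
    \<comment> \<open>Acts as \<open>\<sigma>\<close> on both halves; the second half of the target
      starts at \<open>n\<close>, that of the source at \<open>m\<close>.\<close>
    define \<tau> where "\<tau> i = (if i < n then \<sigma> i else m + \<sigma> (i - n))" for i
    have \<tau>: "\<tau> i < 2 * m" if "i < 2 * n" for i
      using that Suc.prems(2)[of i] Suc.prems(2)[of "i - n"] by (auto simp: \<tau>_def)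
    let ?U = "{z \<in> {..<m} \<rightarrow>\<^sub>E UNIV. sel n \<sigma> z \<in> U}"
    have h: "half1 n (sel (2 * n) \<tau> Z) = sel n \<sigma> (half1 m Z)"
      "half2 n (sel (2 * n) \<tau> Z) = sel n \<sigma> (half2 m Z)" for Z :: "nat \<Rightarrow> 'a"
      using Suc.prems(2) by (auto simp: half1_def half2_def sel_def \<tau>_def fun_eq_iff)
    have ts: "times_space m ?U = {Z \<in> {..<2 * m} \<rightarrow>\<^sub>E UNIV. sel (2 * n) \<tau> Z \<in> times_space n U}"
    proof -
      have "half1 m Z \<in> {..<m} \<rightarrow>\<^sub>E UNIV" "sel (2 * n) \<tau> Z \<in> {..<2 * n} \<rightarrow>\<^sub>E UNIV" for Z :: "nat \<Rightarrow> 'a"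
        by (auto simp: half1_def sel_def)
      then show ?thesis unfolding times_space_def using h(1) by auto
    qed
    have "is_Gateaux_deriv S m (\<lambda>z. f (sel n \<sigma> z)) (half1 m Z) (half2 m Z) (Df (sel (2 * n) \<tau> Z))"
      if "Z \<in> times_space m ?U" for Z
    proof -
      have Z: "sel (2 * n) \<tau> Z \<in> times_space n U" using that unfolding ts by blast
      have "sel n \<sigma> (\<lambda>i\<in>{..<m}. half1 m Z i + t *\<^sub>R half2 m Z i) =
          (\<lambda>i\<in>{..<n}. half1 n (sel (2 * n) \<tau> Z) i + t *\<^sub>R half2 n (sel (2 * n) \<tau> Z) i)" for t
        unfolding h using Suc.prems(2) by (auto simp: sel_def fun_eq_iff)
      with Df(2)[OF Z] show ?thesis
        unfolding is_Gateaux_deriv_def by (simp add: h(1))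
    qed
    moreover have "Gateaux_C k T S (2 * m) (times_space m ?U) (\<lambda>Z. Df (sel (2 * n) \<tau> Z))"
      unfolding ts by (rule Suc.IH[OF Df(3) \<tau>])
    ultimately show ?case
      unfolding Gateaux_C.simps by (intro conjI exI ballI c[OF Df(1)] Suc.prems(2))
  }
qed

lemma Gateaux_C_half1:
  "Gateaux_C k T S n U f \<Longrightarrow> Gateaux_C k T S (2 * n) (times_space n U) (\<lambda>z. f (half1 n z))"
  using Gateaux_C_sel[of k T S n U f "\<lambda>i. i" "2 * n"] by (simp add: half1_sel times_space_def)

text \<open>Reduces real targets to calculus in one variable along a line. Extensionality of
  \<open>x\<close> ensures that the line takes the value \<open>x\<close> at
  \<open>t = 0\<close>.\<close>

lemma is_Gateaux_deriv_real:
  assumes "x \<in> extensional {..<n}"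
  shows "is_Gateaux_deriv euclideanreal n f x v l \<longleftrightarrow>
    ((\<lambda>t. f (\<lambda>i\<in>{..<n}. x i + t *\<^sub>R v i)) has_real_derivative l) (at 0)"
proof -
  have "(\<lambda>i\<in>{..<n}. x i + 0 *\<^sub>R v i) = x"
    using assms by (auto simp: extensional_def fun_eq_iff)
  then show ?thesis
    unfolding is_Gateaux_deriv_def has_field_derivative_iff by (simp add: divide_inverse mult.commute)
qed

lemma half1_extensional: "half1 n z \<in> extensional {..<n}"
  by (simp add: half1_def)

text \<open>The derivative is \<open>total_diff m F\<close> applied to the functions
  \<open>f j\<close>, pulled back to base points by \<open>half1\<close>, and their derivatives.
  These are of class \<open>k\<close>, so the induction over all \<open>F\<close> applies to
  it.\<close>

lemma Gateaux_C_comp: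
  "smooth_fun m F \<Longrightarrow> (\<And>j. j < m \<Longrightarrow> Gateaux_C k T euclideanreal n U (f j)) \<Longrightarrow>
    Gateaux_C k T euclideanreal n U (\<lambda>x. F (\<lambda>j\<in>{..<m}. f j x))"
proof (induction k arbitrary: n m U F f)
  have c: "continuous_map (subtopology (product_topology (\<lambda>_. T) {..<n}) U) euclideanreal
      (\<lambda>x. F (\<lambda>j\<in>{..<m}. f j x))"
    if "smooth_fun m F"
      "\<And>j. j < m \<Longrightarrow> continuous_map (subtopology (product_topology (\<lambda>_. T) {..<n}) U) euclideanreal (f j)"
    for m F n U f
  proof -
    have "continuous_map (subtopology (product_topology (\<lambda>_. T) {..<n}) U)
        (product_topology (\<lambda>_. euclideanreal) {..<m}) (\<lambda>x. \<lambda>j\<in>{..<m}. f j x)"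
      by (intro continuous_map_tuple that(2))
    from continuous_map_compose[OF this smooth_fun_continuous[OF that(1)]]
    show ?thesis unfolding o_def .
  qed
  {
    case 0
    then show ?case unfolding Gateaux_C.simps by (rule c)
  next
    case (Suc k)
    have "\<forall>j. j < m \<longrightarrow> (\<exists>Df. (\<forall>z\<in>times_space n U.
        is_Gateaux_deriv euclideanreal n (f j) (half1 n z) (half2 n z) (Df z)) \<and>
        Gateaux_C k T euclideanreal (2 * n) (times_space n U) Df)"
      using Suc.prems(2) by simp
    then obtain Df where Df: "\<And>j z. j < m \<Longrightarrow> z\<in>times_space n U \<Longrightarrow>
        is_Gateaux_deriv euclideanreal n (f j) (half1 n z) (half2 n z) (Df j z)"
      "\<And>j. j < m \<Longrightarrow> Gateaux_C k T euclideanreal (2 * n) (times_space n U) (Df j)"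
      by metis
    let ?g = "\<lambda>j z. if j < m then f j (half1 n z) else Df (j - m) z"
    have "Gateaux_C k T euclideanreal (2 * n) (times_space n U)
        (\<lambda>z. total_diff m F (\<lambda>j\<in>{..<2 * m}. ?g j z))"
    proof (rule Suc.IH[OF smooth_fun_total_diff[OF Suc.prems(1)]])
      fix j assume "j < 2 * m"
      then show "Gateaux_C k T euclideanreal (2 * n) (times_space n U) (?g j)"
        using Df(2)[of "j - m"] Gateaux_C_half1[OF Gateaux_C_mono[OF Suc.prems(2)[of j]]]
        by (cases "j < m") simp_all
    qed
    moreover have "is_Gateaux_deriv euclideanreal n (\<lambda>x. F (\<lambda>j\<in>{..<m}. f j x)) (half1 n z) (half2 n z)
        (total_diff m F (\<lambda>j\<in>{..<2 * m}. ?g j z))" if z: "z \<in> times_space n U" for z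
    proof -
      have e: "(\<lambda>i\<in>{..<n}. half1 n z i + 0 *\<^sub>R half2 n z i) = half1 n z"
        by (auto simp: half1_def fun_eq_iff)
      have d: "((\<lambda>t. f j (\<lambda>i\<in>{..<n}. half1 n z i + t *\<^sub>R half2 n z i)) has_real_derivative Df j z) (at 0)"
        if "j < m" for j
        using Df(1)[OF that z] unfolding is_Gateaux_deriv_real[OF half1_extensional] .
      show ?thesis
        unfolding is_Gateaux_deriv_real[OF half1_extensional]
        using smooth_fun_chain_total_diff[OF Suc.prems(1),
            of "\<lambda>j t. f j (\<lambda>i\<in>{..<n}. half1 n z i + t *\<^sub>R half2 n z i)" "\<lambda>j. Df j z" 0, OF d]
        unfolding e .
    qed
    ultimately show ?case
      unfolding Gateaux_C.simps
      by (intro conjI exI ballI c[OF Suc.prems(1)] Gateaux_C_continuous[OF Suc.prems(2)])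
  }
qed

lemma topspace_lcvs:
  assumes "lcvs T"
  shows "topspace T = UNIV"
  using assms unfolding lcvs_def seminorm_topology_def by (auto simp: topology_generated_by_topspace)

context
  fixes T :: "'a::real_vector topology"
  assumes T: "lcvs T"
begin

text \<open>Uses continuity of addition and scalar multiplication. It follows that lines through a
  point of an open set stay there for small \<open>t\<close>, which makes Gateaux derivatives
  local.\<close>

lemma continuous_map_line:
  "continuous_map euclideanreal (product_topology (\<lambda>_. T) {..<n}) (\<lambda>t. \<lambda>i\<in>{..<n}. x i + t *\<^sub>R v i)"
proof (rule continuous_map_tuple)
  fix i
  have UNIV: "topspace T = UNIV" by (rule topspace_lcvs[OF T])
  have "continuous_map euclideanreal (prod_topology euclideanreal T) (\<lambda>t. (t, v i))"
    by (auto simp: continuous_map_pairwise o_def UNIV)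
  from continuous_map_compose[OF this] T
  have s: "continuous_map euclideanreal T (\<lambda>t. t *\<^sub>R v i)"
    unfolding lcvs_def by (fastforce simp: o_def)
  then have "continuous_map euclideanreal (prod_topology T T) (\<lambda>t. (x i, t *\<^sub>R v i))"
    by (auto simp: continuous_map_pairwise o_def UNIV)
  from continuous_map_compose[OF this] T
  show "continuous_map euclideanreal T (\<lambda>t. x i + t *\<^sub>R v i)"
    unfolding lcvs_def by (fastforce simp: o_def)
qed

lemma eventually_line_in:
  assumes W: "openin (product_topology (\<lambda>_. T) {..<n}) W" "x \<in> W"
  shows "\<forall>\<^sub>F t in at 0. (\<lambda>i\<in>{..<n}. x i + t *\<^sub>R v i) \<in> W"
proof -
  let ?l = "\<lambda>t. \<lambda>i\<in>{..<n}. x i + t *\<^sub>R v i"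
  have "x \<in> extensional {..<n}"
    using openin_subset[OF W(1)] W(2) by (auto simp: PiE_iff)
  then have "?l 0 = x" by (auto simp: extensional_def fun_eq_iff)
  moreover have "open {t. ?l t \<in> W}"
    using openin_continuous_map_preimage[OF continuous_map_line W(1)] by simp
  ultimately have "\<forall>\<^sub>F t in nhds 0. ?l t \<in> W"
    using W(2) eventually_nhds_in_open[of "{t. ?l t \<in> W}" 0] by simp
  then show ?thesis by (auto simp: eventually_at_filter elim: eventually_mono)
qed

lemma is_Gateaux_deriv_cong:
  assumes W: "openin (product_topology (\<lambda>_. T) {..<n}) W" "x \<in> W"
    and fg: "\<And>y. y \<in> W \<Longrightarrow> f y = g y" and f: "is_Gateaux_deriv S n f x v l"
  shows "is_Gateaux_deriv S n g x v l"
  unfolding is_Gateaux_deriv_def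
  by (rule limitin_transform_eventually[OF _ f[unfolded is_Gateaux_deriv_def]])
     (use eventually_line_in[OF W, of v] in eventually_elim, simp add: fg W)

lemma Gateaux_C_cong:
  assumes W: "openin (product_topology (\<lambda>_. T) {..<n}) W"
    and fg: "\<And>y. y \<in> W \<Longrightarrow> f y = g y" and f: "Gateaux_C k T S n W f"
  shows "Gateaux_C k T S n W g"
proof -
  have c: "continuous_map (subtopology (product_topology (\<lambda>_. T) {..<n}) W) S g"
    by (rule continuous_map_eq[OF Gateaux_C_continuous[OF f]]) (simp add: fg)
  show ?thesis
  proof (cases k)
    case 0
    then show ?thesis using c by simp
  next
    case (Suc k')
    obtain Df where Df: "\<forall>z\<in>times_space n W. is_Gateaux_deriv S n f (half1 n z) (half2 n z) (Df z)"
      "Gateaux_C k' T S (2 * n) (times_space n W) Df"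
      using f unfolding Suc Gateaux_C.simps by blast
    have "is_Gateaux_deriv S n g (half1 n z) (half2 n z) (Df z)" if "z \<in> times_space n W" for z
      using that Df(1) by (intro is_Gateaux_deriv_cong[OF W _ fg]) (auto simp: times_space_def)
    with Df(2) c show ?thesis unfolding Suc Gateaux_C.simps by blast
  qed
qed

lemma openin_times_space:
  assumes "openin (product_topology (\<lambda>_. T) {..<n}) U"
  shows "openin (product_topology (\<lambda>_. T) {..<2 * n}) (times_space n U)"
proof -
  have "continuous_map (product_topology (\<lambda>_. T) {..<2 * n}) (product_topology (\<lambda>_. T) {..<n}) (half1 n)"
    unfolding half1_sel by (rule continuous_map_sel) simp
  from openin_continuous_map_preimage[OF this assms] show ?thesis
    by (simp add: times_space_def topspace_lcvs[OF T])
qed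

text \<open>Limits in the reals are unique, so the derivatives on the pieces fit together;
  continuity is glued by the pasting lemma and higher orders by induction.\<close>

lemma Gateaux_C_glue:
  "openin (product_topology (\<lambda>_. T) {..<n}) U \<Longrightarrow>
   (\<And>x. x \<in> U \<Longrightarrow> \<exists>W. openin (product_topology (\<lambda>_. T) {..<n}) W \<and> x \<in> W \<and> W \<subseteq> U \<and>
      Gateaux_C k T euclideanreal n W f) \<Longrightarrow>
   Gateaux_C k T euclideanreal n U f"
proof (induction k arbitrary: n U f)
  have c: "continuous_map (subtopology (product_topology (\<lambda>_. T) {..<n}) U) euclideanreal f"
    if U: "openin (product_topology (\<lambda>_. T) {..<n}) U" and
      W: "\<And>x. x \<in> U \<Longrightarrow> \<exists>W. openin (product_topology (\<lambda>_. T) {..<n}) W \<and> x \<in> W \<and> W \<subseteq> U \<and>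
      Gateaux_C k T euclideanreal n W f" for n U and f :: "(nat \<Rightarrow> 'a) \<Rightarrow> real" and k
  proof (rule pasting_lemma[where I = "{W. openin (product_topology (\<lambda>_. T) {..<n}) W \<and> W \<subseteq> U \<and>
      Gateaux_C k T euclideanreal n W f}" and T = "\<lambda>W. W" and f = "\<lambda>_. f"])
    fix W assume W': "W \<in> {W. openin (product_topology (\<lambda>_. T) {..<n}) W \<and> W \<subseteq> U \<and>
      Gateaux_C k T euclideanreal n W f}"
    then show "openin (subtopology (product_topology (\<lambda>_. T) {..<n}) U) W"
      by (simp add: openin_open_subtopology U)
    have "U \<inter> W = W" using W' by blast
    then show "continuous_map (subtopology (subtopology (product_topology (\<lambda>_. T) {..<n}) U) W) euclideanreal f"
      using W' Gateaux_C_continuous by (simp add: subtopology_subtopology) blast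
  next
    fix x assume "x \<in> topspace (subtopology (product_topology (\<lambda>_. T) {..<n}) U)"
    then have "x \<in> U" by simp
    from W[OF this] show "\<exists>W. W \<in> {W. openin (product_topology (\<lambda>_. T) {..<n}) W \<and> W \<subseteq> U \<and>
      Gateaux_C k T euclideanreal n W f} \<and> x \<in> W \<and> f x = f x" by blast
  qed simp
  {
    case 0
    then show ?case unfolding Gateaux_C.simps(1) using c[of n U 0 f] by simp
  next
    case (Suc k)
    \<comment> \<open>A candidate independent of the pieces; by uniqueness it equals every local
      \<open>Df\<close> on the corresponding open set.\<close>
    define D where "D z = (SOME l. is_Gateaux_deriv euclideanreal n f (half1 n z) (half2 n z) l)" for z
    have loc: "\<exists>W. openin (product_topology (\<lambda>_. T) {..<n}) W \<and> x \<in> W \<and> W \<subseteq> U \<and>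
        (\<forall>z\<in>times_space n W. is_Gateaux_deriv euclideanreal n f (half1 n z) (half2 n z) (D z)) \<and>
        Gateaux_C k T euclideanreal (2 * n) (times_space n W) D" if "x \<in> U" for x
    proof -
      obtain W where W: "openin (product_topology (\<lambda>_. T) {..<n}) W" "x \<in> W" "W \<subseteq> U"
        and "Gateaux_C (Suc k) T euclideanreal n W f"
        using Suc.prems(2)[OF \<open>x \<in> U\<close>] by blast
      then obtain Df where Df: "\<forall>z\<in>times_space n W. is_Gateaux_deriv euclideanreal n f (half1 n z) (half2 n z) (Df z)"
        "Gateaux_C k T euclideanreal (2 * n) (times_space n W) Df"
        unfolding Gateaux_C.simps by blast
      have eq: "Df z = D z" if "z \<in> times_space n W" for z
      proof -
        have *: "is_Gateaux_deriv euclideanreal n f (half1 n z) (half2 n z) (Df z)" using Df(1) that by blast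
        then have "is_Gateaux_deriv euclideanreal n f (half1 n z) (half2 n z) (D z)"
          unfolding D_def by (rule someI)
        with * show ?thesis
          unfolding is_Gateaux_deriv_real[OF half1_extensional] by (rule DERIV_unique)
      qed
      from Gateaux_C_cong[OF openin_times_space[OF W(1)] this Df(2)] Df(1) W eq
      show ?thesis by (intro exI[of _ W]) auto
    qed
    have "is_Gateaux_deriv euclideanreal n f (half1 n z) (half2 n z) (D z)" if z: "z \<in> times_space n U" for z
    proof -
      have "half1 n z \<in> U" using z by (simp add: times_space_def)
      from loc[OF this] z show ?thesis by (auto simp: times_space_def)
    qed
    moreover have "Gateaux_C k T euclideanreal (2 * n) (times_space n U) D"
    proof (rule Suc.IH[OF openin_times_space[OF Suc.prems(1)]])
      fix z assume z: "z \<in> times_space n U"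
      then have "half1 n z \<in> U" by (simp add: times_space_def)
      from loc[OF this] obtain W where W: "openin (product_topology (\<lambda>_. T) {..<n}) W"
        "half1 n z \<in> W" "W \<subseteq> U" "Gateaux_C k T euclideanreal (2 * n) (times_space n W) D" by blast
      moreover have "z \<in> times_space n W" "times_space n W \<subseteq> times_space n U"
        using z W(2,3) by (auto simp: times_space_def)
      ultimately show "\<exists>W. openin (product_topology (\<lambda>_. T) {..<2 * n}) W \<and> z \<in> W \<and>
          W \<subseteq> times_space n U \<and> Gateaux_C k T euclideanreal (2 * n) W D"
        using openin_times_space by blast
    qed
    ultimately show ?case
      unfolding Gateaux_C.simps using c[OF Suc.prems] by blast
  }
qed

lemma openin_single:
  assumes "openin T U"
  shows "openin (product_topology (\<lambda>_. T) {..<1::nat}) {x \<in> {..<1} \<rightarrow>\<^sub>E UNIV. x 0 \<in> U}"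
  using openin_continuous_map_preimage[OF continuous_map_product_coordinates[of 0 "{..<1::nat}" "\<lambda>_. T"] assms]
  by (simp add: topspace_lcvs[OF T])

lemma Gateaux_space_ring: "is_Cinf_ring (sections (Gateaux_space T) UNIV)"
  unfolding Gateaux_space_def
proof (rule is_Cinf_ring_functions)
  fix n F and f :: "nat \<Rightarrow> 'a \<Rightarrow> real"
  assume F: "smooth_fun n F"
    and f: "f \<in> {..<n} \<rightarrow>\<^sub>E elts (sections (function_space T (Gateaux_smooth T euclideanreal)) UNIV)"
  then have "Gateaux_C k T euclideanreal 1 {x \<in> {..<1} \<rightarrow>\<^sub>E UNIV. x 0 \<in> UNIV} (\<lambda>x. f i (x 0))"
    if "i < n" for i k
    using that unfolding function_space_simps by (auto simp: PiE_iff Gateaux_smooth_def)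
  from Gateaux_C_comp[OF F this]
  show "Gateaux_smooth T euclideanreal UNIV (\<lambda>x\<in>UNIV. F (\<lambda>i\<in>{..<n}. f i x))"
    by (simp add: Gateaux_smooth_def)
qed

lemma Gateaux_smooth_restrict:
  assumes U: "openin T U" and f: "Gateaux_smooth T S UNIV f"
  shows "Gateaux_smooth T S U (restrict f U)"
  unfolding Gateaux_smooth_def
proof
  fix k
  have "Gateaux_C k T S 1 {x \<in> {..<1} \<rightarrow>\<^sub>E UNIV. x 0 \<in> U} (\<lambda>x. f (x 0))"
    by (rule Gateaux_C_subset[of _ _ _ _ "{x \<in> {..<1} \<rightarrow>\<^sub>E UNIV. x 0 \<in> UNIV}"])
       (use f in \<open>auto simp: Gateaux_smooth_def\<close>)
  then show "Gateaux_C k T S 1 {x \<in> {..<1} \<rightarrow>\<^sub>E UNIV. x 0 \<in> U} (\<lambda>x. restrict f U (x 0))"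
    by (rule Gateaux_C_cong[OF openin_single[OF U], rotated]) simp
qed

lemma Gateaux_smooth_glue:
  assumes U: "openin T U"
    and W: "\<And>x. x \<in> U \<Longrightarrow> \<exists>W. openin T W \<and> x \<in> W \<and> W \<subseteq> U \<and>
      Gateaux_smooth T euclideanreal W (restrict f W)"
  shows "Gateaux_smooth T euclideanreal U f"
  unfolding Gateaux_smooth_def
proof (intro allI Gateaux_C_glue[OF openin_single[OF U]])
  fix k and x :: "nat \<Rightarrow> 'a" assume x: "x \<in> {x \<in> {..<1} \<rightarrow>\<^sub>E UNIV. x 0 \<in> U}"
  then have "x 0 \<in> U" by blast
  from W[OF this] obtain W where W: "openin T W" "x 0 \<in> W" "W \<subseteq> U"
    and "Gateaux_smooth T euclideanreal W (restrict f W)" by blast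
  then have "Gateaux_C k T euclideanreal 1 {x \<in> {..<1} \<rightarrow>\<^sub>E UNIV. x 0 \<in> W} (\<lambda>x. restrict f W (x 0))"
    by (simp add: Gateaux_smooth_def)
  then have "Gateaux_C k T euclideanreal 1 {x \<in> {..<1} \<rightarrow>\<^sub>E UNIV. x 0 \<in> W} (\<lambda>x. f (x 0))"
    by (rule Gateaux_C_cong[OF openin_single[OF W(1)], rotated]) simp
  then show "\<exists>W. openin (product_topology (\<lambda>_. T) {..<1}) W \<and> x \<in> W \<and>
      W \<subseteq> {x \<in> {..<1} \<rightarrow>\<^sub>E UNIV. x 0 \<in> U} \<and> Gateaux_C k T euclideanreal 1 W (\<lambda>x. f (x 0))"
  proof (intro exI conjI)
    show "openin (product_topology (\<lambda>_. T) {..<1::nat}) {x \<in> {..<1} \<rightarrow>\<^sub>E UNIV. x 0 \<in> W}"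
      by (rule openin_single[OF W(1)])
  qed (use W(2,3) x in auto)
qed

lemma affine_Gateaux_spaceI:
  assumes "smoothly_regular (Gateaux_space T)" "realcompact (Gateaux_space T)"
    "germs_extend (Gateaux_space T)"
  shows "affine_Cinf_scheme TYPE('a \<Rightarrow> real) (Gateaux_space T)"
  using assms unfolding Gateaux_space_def
proof (intro affine_function_spaceI)
  show "is_Cinf_ring (sections (function_space T (Gateaux_smooth T euclideanreal)) (topspace T))"
    using Gateaux_space_ring by (simp only: Gateaux_space_def topspace_lcvs[OF T])
  show "Gateaux_smooth T euclideanreal U (restrict f U)"
    if "openin T U" "f \<in> elts (sections (function_space T (Gateaux_smooth T euclideanreal)) (topspace T))"
    for U f
    using that by (intro Gateaux_smooth_restrict) (auto simp: topspace_lcvs[OF T])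
qed (auto intro: Gateaux_smooth_glue)

end

section \<open>Conveniently smooth functions\<close>

lemma topspace_cinf: "topspace (cinf_topology T) = UNIV"
  using openin_subset[of "cinf_topology T" UNIV] by (auto simp: openin_cinf_topology)

lemma convenient_space_ring: "is_Cinf_ring (sections (convenient_space T) U)"
  unfolding convenient_space_def
proof (rule is_Cinf_ring_functions)
  fix n F and f :: "nat \<Rightarrow> 'a \<Rightarrow> real"
  assume F: "smooth_fun n F"
    and f: "f \<in> {..<n} \<rightarrow>\<^sub>E elts (sections (function_space (cinf_topology T) (conveniently_smooth T)) U)"
  show "conveniently_smooth T U (\<lambda>x\<in>U. F (\<lambda>i\<in>{..<n}. f i x))"
    unfolding conveniently_smooth_def
  proof (intro allI impI, elim conjE)
    fix \<gamma> assume \<gamma>: "smooth_curve T \<gamma>" "range \<gamma> \<subseteq> U"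
    have "smooth_real (\<lambda>t. f i (\<gamma> t))" if "i < n" for i
    proof -
      have "conveniently_smooth T U (f i)" using f that by auto
      then show ?thesis using \<gamma> by (auto simp: conveniently_smooth_def o_def)
    qed
    from smooth_real_comp[OF F this]
    have "smooth_real (\<lambda>t. F (\<lambda>i\<in>{..<n}. f i (\<gamma> t)))" .
    moreover have "(\<lambda>x\<in>U. F (\<lambda>i\<in>{..<n}. f i x)) \<circ> \<gamma> = (\<lambda>t. F (\<lambda>i\<in>{..<n}. f i (\<gamma> t)))"
    proof
      fix t
      have "\<gamma> t \<in> U" using \<gamma>(2) by blast
      then show "((\<lambda>x\<in>U. F (\<lambda>i\<in>{..<n}. f i x)) \<circ> \<gamma>) t = F (\<lambda>i\<in>{..<n}. f i (\<gamma> t))"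
        by (simp only: o_apply restrict_apply if_True)
    qed
    ultimately show "smooth_real ((\<lambda>x\<in>U. F (\<lambda>i\<in>{..<n}. f i x)) \<circ> \<gamma>)" by simp
  qed
qed

lemma conveniently_smooth_restrict:
  assumes "conveniently_smooth T UNIV f"
  shows "conveniently_smooth T U (restrict f U)"
  unfolding conveniently_smooth_def
proof (intro allI impI, elim conjE)
  fix \<gamma> assume \<gamma>: "smooth_curve T \<gamma>" "range \<gamma> \<subseteq> U"
  then have "restrict f U \<circ> \<gamma> = f \<circ> \<gamma>" by (auto simp: fun_eq_iff)
  with assms \<gamma> show "smooth_real (restrict f U \<circ> \<gamma>)" by (simp add: conveniently_smooth_def)
qed

text \<open>In a convenient space, smoothness of curves is detected by continuous linear
  functionals, so only the chain rule for real functions is needed.\<close>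

lemma smooth_curve_reparametrize:
  assumes T: "convenient T" and \<gamma>: "smooth_curve T \<gamma>" and p: "smooth_real p"
  shows "smooth_curve T (\<lambda>t. \<gamma> (p t))"
proof -
  have "smooth_real (l \<circ> (\<lambda>t. \<gamma> (p t)))" if "linear l" "continuous_map T euclideanreal l"
    for l :: "'a \<Rightarrow> real"
  proof -
    have "smooth_real (l \<circ> \<gamma>)" using T \<gamma> that unfolding convenient_def by blast
    from smooth_real_compose[OF this p] show ?thesis by (simp add: o_def)
  qed
  then show ?thesis using T unfolding convenient_def by blast
qed

text \<open>A curve in \<open>U\<close> lies in \<open>W\<close> only near a given time.
  Reparametrised it lies in \<open>W\<close> throughout, so \<open>f\<close> is smooth along it;
  since the two curves agree near that time, \<open>smooth_real_local\<close> applies.\<close>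

lemma conveniently_smooth_glue:
  assumes T: "convenient T"
    and W: "\<And>x. x \<in> U \<Longrightarrow> \<exists>W. openin (cinf_topology T) W \<and> x \<in> W \<and> conveniently_smooth T W (restrict f W)"
  shows "conveniently_smooth T U f"
  unfolding conveniently_smooth_def
proof (intro allI impI smooth_real_local, elim conjE)
  fix \<gamma> a assume \<gamma>: "smooth_curve T \<gamma>" "range \<gamma> \<subseteq> U"
  then have "\<gamma> a \<in> U" by blast
  from W[OF this] obtain W where W: "openin (cinf_topology T) W" "\<gamma> a \<in> W"
    "conveniently_smooth T W (restrict f W)" by blast
  then have "open (\<gamma> -` W)" using \<gamma>(1) by (simp add: openin_cinf_topology)
  with W(2) obtain e where e: "e > 0" "ball a e \<subseteq> \<gamma> -` W"
    unfolding open_contains_ball by blast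
  obtain p where p: "smooth_real p" "\<And>t. \<bar>p t - a\<bar> < e" "\<forall>\<^sub>F t in nhds a. p t = t"
    by (rule smooth_reparametrization[OF e(1)]) blast
  have in_W: "\<gamma> (p t) \<in> W" for t
  proof -
    have "p t \<in> ball a e" using p(2)[of t] by (simp add: dist_real_def abs_minus_commute)
    then show ?thesis using e(2) by blast
  qed
  then have "smooth_real (restrict f W \<circ> (\<lambda>t. \<gamma> (p t)))"
    using W(3) smooth_curve_reparametrize[OF T \<gamma>(1) p(1)] unfolding conveniently_smooth_def by blast
  moreover have "restrict f W \<circ> (\<lambda>t. \<gamma> (p t)) = (\<lambda>t. f (\<gamma> (p t)))"
    using in_W by (auto simp: fun_eq_iff)
  moreover have "\<forall>\<^sub>F t in nhds a. (f \<circ> \<gamma>) t = f (\<gamma> (p t))"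
    using p(3) by (rule eventually_mono) simp
  ultimately show "\<exists>v. smooth_real v \<and> (\<forall>\<^sub>F t in nhds a. (f \<circ> \<gamma>) t = v t)"
    by (intro exI[of _ "\<lambda>t. f (\<gamma> (p t))"]) simp
qed

lemma affine_convenient_spaceI:
  fixes T :: "'a::real_vector topology"
  assumes T: "convenient T"
    and "smoothly_regular (convenient_space T)" "realcompact (convenient_space T)"
  shows "affine_Cinf_scheme TYPE('a \<Rightarrow> real) (convenient_space T)"
proof -
  note ring = convenient_space_ring[of T, unfolded convenient_space_def]
  have restr: "conveniently_smooth T U (restrict f U)"
    if "f \<in> elts (sections (function_space (cinf_topology T) (conveniently_smooth T))
      (topspace (cinf_topology T)))" for U f
    using that by (intro conveniently_smooth_restrict) (simp add: topspace_cinf)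
  have "germs_extend (convenient_space T)"
    using assms(2) unfolding convenient_space_def
    by (intro germs_extendI ring restr) (auto intro: conveniently_smooth_glue[OF T])
  with assms(2,3) show ?thesis
    unfolding convenient_space_def
    by (intro affine_function_spaceI ring restr) (simp_all, meson conveniently_smooth_glue[OF T])
qed

text \<open>Types cannot be quantified inside a formula, so the element type of the ring is a
  parameter. The conditions are derived for an arbitrary type \<open>'c\<close>; in the converse the
  witness is the ring of global functions, whose elements have type
  \<open>'a \<Rightarrow> real\<close>.\<close>

theorem proposition1p3:
  fixes T :: "'a::real_vector topology"
  shows
    "(lcvs T \<longrightarrow>
        (affine_Cinf_scheme TYPE('a \<Rightarrow> real) (Gateaux_space T) \<longleftrightarrow>
           smoothly_regular (Gateaux_space T) \<and> realcompact (Gateaux_space T) \<and>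
           germs_extend (Gateaux_space T)) \<and>
        (affine_Cinf_scheme TYPE('c) (Gateaux_space T) \<longrightarrow>
           smoothly_regular (Gateaux_space T) \<and> realcompact (Gateaux_space T) \<and>
           germs_extend (Gateaux_space T))) \<and>
     (convenient T \<longrightarrow>
        (affine_Cinf_scheme TYPE('a \<Rightarrow> real) (convenient_space T) \<longleftrightarrow>
           smoothly_regular (convenient_space T) \<and> realcompact (convenient_space T)) \<and>
        (affine_Cinf_scheme TYPE('c) (convenient_space T) \<longrightarrow>
           smoothly_regular (convenient_space T) \<and> realcompact (convenient_space T)))"
proof (intro conjI impI iffI)
  assume T: "lcvs T"
  show "affine_Cinf_scheme TYPE('a \<Rightarrow> real) (Gateaux_space T)"
    if "smoothly_regular (Gateaux_space T) \<and> realcompact (Gateaux_space T) \<and> germs_extend (Gateaux_space T)"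
    using affine_Gateaux_spaceI[OF T] that by blast
next
  assume "convenient T"
  then show "affine_Cinf_scheme TYPE('a \<Rightarrow> real) (convenient_space T)"
    if "smoothly_regular (convenient_space T) \<and> realcompact (convenient_space T)"
    using affine_convenient_spaceI that by blast
qed (unfold affine_Cinf_scheme_def Gateaux_space_def convenient_space_def, (blast dest: affine_function_space)+)

end
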